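(* Every random dense countable subset of $(0,1)$ that satisfies the independence condition and is stationary has the uniform distribution.
   Context: A random countable subset of $(0,1)$ is given by a sequence of random variables $X_1,X_2,\dots:\Omega\to(0,1)$ on a probability space, the set being $\omega\mapsto\{X_1(\omega),X_2(\omega),\dots\}$; multiplicities are ignored. It is a random dense countable subset if this set is dense in $(0,1)$ for almost every $\omega$. Two random countable sets $\{X_k\}$ and $\{Y_k\}$, possibly on different probability spaces, are identically distributed if there is a probability measure $P$ on $(0,1)^\infty\times(0,1)^\infty$ with first marginal the law of $(X_1,X_2,\dots)$ and second marginal the law of $(Y_1,Y_2,\dots)$, such that $\{x_1,x_2,\dots\}=\{y_1,y_2,\dots\}$ for $P$-a.a. $(x,y)$. Independence condition. Let $n\ge2$ and $0=a_0<a_1<\dots<a_n=1$. The fragments $\{X_k\}\cap[a_{i-1},a_i)$, $i=1,\dots,n$, are called independent if there exist random variables $Y_{i,j}$ ($i=1,\dots,n$, $j=1,2,\dots$) on some probability space such that: - the random countable set $\{Y_{i,j}\}$ (enumerated as one sequence) is distributed like $\{X_1,X_2,\dots\}$; - $Y_{i,j}\in[a_{i-1},a_i)$ a.s. for all $i,j$; - the $n$ sequences $(Y_{1,j})_j,\dots,(Y_{n,j})_j$ are independent. The random dense countable set satisfies the independence condition if this holds for every $n\ge2$ and every such $a_0,\dots,a_n$. Stationarity. The set is stationary if for all $a,b,c,d\in(0,1)$ with $b-a=d-c>0$, the random dense countable subsets of $(0,1)$ given by $\{x\in(0,1): a+(b-a)x\in\{X_1,X_2,\dots\}\}$ and $\{x\in(0,1):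 c+(d-c)x\in\{X_1,X_2,\dots\}\}$ are identically distributed. Uniform distribution. The set has the uniform distribution if it is identically distributed with some $\{Y_1,Y_2,\dots\}$ whose joint law $\nu$ satisfies: - (i) for every $n$, the law of $(Y_1,\dots,Y_n)$ is absolutely continuous on $(0,1)^n$, with density $f_n$; - (ii) for Lebesgue-a.e. $x\in(0,1)$ and $\nu$-a.e. $(y_1,y_2,\dots)$, $\sum_n f_{n+1}(y_1,\dots,y_n,x)/f_n(y_1,\dots,y_n)=\infty$. *)

theory Defs
  imports "HOL-Probability.Probability"
begin

text \<open>The measurable space of sequences in (0,1); laws of random countable sets
  (given by sequences of random variables) are probability measures on it.\<close>
definition seqsp :: "(nat \<Rightarrow> real) measure" where
  "seqsp = PiM UNIV (\<lambda>_. restrict_space borel {0<..<1})"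

definition seq_law :: "'a measure \<Rightarrow> (nat \<Rightarrow> 'a \<Rightarrow> real) \<Rightarrow> (nat \<Rightarrow> real) measure" where
  "seq_law M X = distr M seqsp (\<lambda>\<omega> k. X k \<omega>)"

text \<open>Identically distributed random countable sets, expressed on the laws of the
  enumerating sequences: a coupling under which the two sets of values agree a.s.\<close>
definition ident_distr_rcs :: "(nat \<Rightarrow> real) measure \<Rightarrow> (nat \<Rightarrow> real) measure \<Rightarrow> bool" where
  "ident_distr_rcs \<mu> \<nu> \<longleftrightarrow>
     (\<exists>P. prob_space P \<and> sets P = sets (seqsp \<Otimes>\<^sub>M seqsp) \<and>
          distr P seqsp fst = \<mu> \<and> distr P seqsp snd = \<nu> \<and>
          (AE z in P. range (fst z) = range (snd z)))"

text \<open>Enumeration of the rescaled set {x in (0,1). a + (b-a) x \<in> {x_1, x_2, ...}}.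
  The fallback value 1/2 is only used when the set is empty (a null event for dense sets).\<close>
definition rescale :: "real \<Rightarrow> real \<Rightarrow> (nat \<Rightarrow> real) \<Rightarrow> nat \<Rightarrow> real" where
  "rescale a b x k =
     (if x k \<in> {a<..<b} then (x k - a) / (b - a)
      else if (\<exists>m. x m \<in> {a<..<b}) then (x (LEAST m. x m \<in> {a<..<b}) - a) / (b - a)
      else 1/2)"

definition stationary_rcs :: "(nat \<Rightarrow> real) measure \<Rightarrow> bool" where
  "stationary_rcs \<mu> \<longleftrightarrow>
     (\<forall>a b c d. a \<in> {0<..<1} \<longrightarrow> b \<in> {0<..<1} \<longrightarrow> c \<in> {0<..<1} \<longrightarrow> d \<in> {0<..<1} \<longrightarrow>
        b - a = d - c \<longrightarrow> b - a > 0 \<longrightarrow>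
        ident_distr_rcs (distr \<mu> seqsp (rescale a b)) (distr \<mu> seqsp (rescale c d)))"

text \<open>Independence condition. The random variables Y_{i,j}, i = 1..n, j in nat, on some
  probability space are represented by their joint law Q; the single enumeration of
  {Y_{i,j}} is k \<mapsto> Y_{1 + k mod n, k div n}.\<close>
definition indep_condition :: "(nat \<Rightarrow> real) measure \<Rightarrow> bool" where
  "indep_condition \<mu> \<longleftrightarrow>
     (\<forall>n::nat. \<forall>a::nat \<Rightarrow> real. n \<ge> 2 \<longrightarrow> a 0 = 0 \<longrightarrow> a n = 1 \<longrightarrow>
        (\<forall>i<n. a i < a (Suc i)) \<longrightarrow>
        (\<exists>Q. prob_space Q \<and> sets Q = sets (PiM {1..n} (\<lambda>_. seqsp)) \<and>
             ident_distr_rcs (distr Q seqsp (\<lambda>y k. y (1 + k mod n) (k div n))) \<mu> \<and>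
             (\<forall>i\<in>{1..n}. \<forall>j. AE y in Q. y i j \<in> {a (i - 1)..<a i}) \<and>
             prob_space.indep_vars Q (\<lambda>_. seqsp) (\<lambda>i y. y i) {1..n}))"

text \<open>Uniform distribution. f n is the density of (Y_1,...,Y_n) (coordinates 0..n-1)
  w.r.t. Lebesgue measure on R^n.\<close>
definition uniform_rcs :: "(nat \<Rightarrow> real) measure \<Rightarrow> bool" where
  "uniform_rcs \<mu> \<longleftrightarrow>
     (\<exists>\<nu> f. prob_space \<nu> \<and> sets \<nu> = sets seqsp \<and> ident_distr_rcs \<mu> \<nu> \<and>
        (\<forall>n. f n \<in> borel_measurable (PiM {..<n} (\<lambda>_. lborel :: real measure)) \<and>
             distr \<nu> (PiM {..<n} (\<lambda>_. lborel)) (\<lambda>y. restrict y {..<n})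
               = density (PiM {..<n} (\<lambda>_. lborel)) (f n)) \<and>
        (AE x in lborel. x \<in> {0<..<1} \<longrightarrow>
           (AE y in \<nu>. (\<Sum>m. f (Suc (Suc m)) ((restrict y {..<Suc m})(Suc m := x))
                              / f (Suc m) (restrict y {..<Suc m})) = (\<infinity>::ennreal))))"

end

theory Submission
  imports Defs
begin

text \<open>Counting points of the random set \<open>S\<close> in \<open>D\<close> gives an intensity that stationarity makes proportional to
  Lebesgue measure, hence \<open>0\<close> or \<open>\<infinity>\<close>, because \<open>S\<close> has infinitely many points in every interval.
  If \<open>S\<close> missed \<open>D\<close> with probability \<open>p > 0\<close>, cutting \<open>(0,1)\<close> into more and more independent cells would
  bound the intensity of \<open>D\<close> by \<open>- ln p\<close>. So \<open>S\<close> meets \<open>D\<close> almost surely or almost never, according to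
  whether \<open>D\<close> has positive Lebesgue measure; by independence of the cells this remains true for sets \<open>D\<close>
  depending on finitely many points of \<open>S\<close>, as far as the remaining points are concerned.

  Consequently a greedy selection, with external randomness, picks from \<open>S\<close> a new point that is uniform
  given any finite number of points already picked. An enumeration of \<open>S\<close> alternates such uniform
  points with the first point not picked yet: it exhausts \<open>S\<close>, its finite-dimensional laws have
  densities, and every uniform step contributes a ratio \<open>f (n + 1) / f n = 1\<close> to the series.\<close>

text \<open>Intervals have infinite intensity, so the uniqueness of locally finite
  translation-invariant measures cannot be quoted. A Fubini argument over shifts replaces it; it
  runs on the law of the set, which is finite. Functionals are written in terms of
  \<open>range x\<close>, because a coupling preserves the set but not its enumeration.

  The two directions of the hitting dichotomy serve different ends. Since null sets are missed,
  every fresh point, however chosen, has an absolutely continuous conditional law. Since sets of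
  positive measure are hit, the greedy selection cannot leave part of the uniform law uncovered.
  Both are needed for all tuples of points simultaneously, because the tuple already chosen depends
  on the set and on external randomness. That randomness turns a fractional acceptance probability
  into an actual choice.

  Uniform steps alone make the series diverge but might leave out points of the set. The steps that
  take the first remaining point repair this, and for them the mere existence of a density is
  enough.\<close>

section \<open>Sequence space, and functionals that depend only on the set of values\<close>

lemma space_seqsp: "space seqsp = {x. \<forall>k. x k \<in> {0<..<1}}"
  by (auto simp: seqsp_def space_PiM PiE_def Pi_def extensional_def)

lemma measurable_seqsp_nth [measurable]: "(\<lambda>x. x k) \<in> borel_measurable seqsp"
proof -
  have "(\<lambda>x. x k) \<in> measurable seqsp (restrict_space borel {0<..<1})"
    unfolding seqsp_def by (rule measurable_component_singleton) simp
  then show ?thesis by (rule measurable_restrict_space2_iff[THEN iffD1, THEN conjunct1])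
qed

lemma measurable_seqsp_nth':
  assumes f: "f \<in> measurable N seqsp" and g: "g \<in> measurable N (count_space UNIV)"
  shows "(\<lambda>w. f w (g w)) \<in> borel_measurable N"
proof -
  have "(\<lambda>w. f w k) \<in> borel_measurable N" for k
    using measurable_compose[OF f measurable_seqsp_nth] .
  then show ?thesis using g by (rule measurable_compose_countable)
qed

lemma measurable_into_seqsp:
  assumes "\<And>k. (\<lambda>w. f w k) \<in> borel_measurable N"
    and "\<And>w k. w \<in> space N \<Longrightarrow> f w k \<in> {0<..<1}"
  shows "f \<in> measurable N seqsp"
  unfolding seqsp_def
proof (rule measurable_PiM_single')
  show "f \<in> space N \<rightarrow> (\<Pi>\<^sub>E i\<in>UNIV. space (restrict_space borel {0<..<1}))"
    using assms(2) by (auto simp: PiE_def Pi_def extensional_def)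
next
  fix i :: nat
  show "(\<lambda>w. f w i) \<in> N \<rightarrow>\<^sub>M restrict_space borel {0<..<1}"
    using assms by (intro measurable_restrict_space2) auto
qed

text \<open>Under the coupling both sequences have the same range, so a property of the range passes
  from one to the other. Measurability is what allows the exceptional event to be pushed down to the
  second marginal.\<close>

lemma ident_distr_rcs_AE:
  assumes id: "ident_distr_rcs \<mu> \<nu>"
    and ae: "AE x in \<mu>. \<phi> (range x)"
    and meas: "Measurable.pred seqsp (\<lambda>x. \<phi> (range x))"
  shows "AE x in \<nu>. \<phi> (range x)"
proof -
  from id obtain P where P: "sets P = sets (seqsp \<Otimes>\<^sub>M seqsp)"
    "distr P seqsp fst = \<mu>" "distr P seqsp snd = \<nu>" "AE z in P. range (fst z) = range (snd z)"
    unfolding ident_distr_rcs_def by blast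
  have fst: "fst \<in> measurable P seqsp" and snd: "snd \<in> measurable P seqsp"
    using P(1) by (auto simp: measurable_cong_sets[OF P(1) refl])
  have "AE z in P. \<phi> (range (fst z))"
    using ae unfolding P(2)[symmetric] by (rule AE_distrD[OF fst])
  with P(4) have "AE z in P. \<phi> (range (snd z))" by eventually_elim simp
  then show ?thesis
    unfolding P(3)[symmetric] using meas by (subst AE_distr_iff[OF snd]) (auto simp: pred_def)
qed

lemma ident_distr_rcs_nn_integral:
  assumes id: "ident_distr_rcs \<mu> \<nu>"
    and meas: "(\<lambda>x. g (range x)) \<in> borel_measurable seqsp"
  shows "(\<integral>\<^sup>+x. g (range x) \<partial>\<mu>) = (\<integral>\<^sup>+x. g (range x) \<partial>\<nu>)"
proof -
  from id obtain P where P: "sets P = sets (seqsp \<Otimes>\<^sub>M seqsp)"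
    "distr P seqsp fst = \<mu>" "distr P seqsp snd = \<nu>" "AE z in P. range (fst z) = range (snd z)"
    unfolding ident_distr_rcs_def by blast
  have fst: "fst \<in> measurable P seqsp" and snd: "snd \<in> measurable P seqsp"
    using P(1) by (auto simp: measurable_cong_sets[OF P(1) refl])
  have "(\<integral>\<^sup>+x. g (range x) \<partial>\<mu>) = (\<integral>\<^sup>+z. g (range (fst z)) \<partial>P)"
    unfolding P(2)[symmetric] using meas by (intro nn_integral_distr[OF fst]) simp
  also have "\<dots> = (\<integral>\<^sup>+z. g (range (snd z)) \<partial>P)"
    using P(4) by (intro nn_integral_cong_AE) auto
  also have "\<dots> = (\<integral>\<^sup>+x. g (range x) \<partial>\<nu>)"
    unfolding P(3)[symmetric] using meas by (intro nn_integral_distr[OF snd, symmetric]) simp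
  finally show ?thesis .
qed

text \<open>Each value is charged at its first occurrence, so multiplicities are ignored. The left
  side shows that only the set matters, the right side is visibly measurable in the
  sequence.\<close>

lemma nn_integral_count_space_range:
  fixes x :: "nat \<Rightarrow> 'a" and f :: "'a \<Rightarrow> ennreal"
  shows "(\<integral>\<^sup>+t. f t \<partial>count_space (range x)) = (\<Sum>k. if x k \<in> x ` {..<k} then 0 else f (x k))"
proof -
  define F where "F = {k. x k \<notin> x ` {..<k}}"
  have inj: "inj_on x F"
  proof (rule linorder_inj_onI)
    fix i j assume "i < j" "i \<in> F" "j \<in> F"
    then show "x i \<noteq> x j" unfolding F_def by (metis (mono_tags, lifting) imageI lessThan_iff mem_Collect_eq)
  qed auto
  have "\<exists>i\<in>F. x i = x k" for k
  proof -
    define i where "i = (LEAST i. x i = x k)"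
    have "x i = x k" unfolding i_def by (rule LeastI) simp
    moreover have "x j \<noteq> x k" if "j < i" for j using that not_less_Least i_def by blast
    ultimately have "i \<in> F" unfolding F_def by force
    with \<open>x i = x k\<close> show ?thesis by blast
  qed
  then have "range x \<subseteq> x ` F" by (metis image_eqI image_subsetI)
  then have "x ` F = range x" by blast
  with inj have "bij_betw x F (range x)" unfolding bij_betw_def by simp
  then have "(\<integral>\<^sup>+t. f t \<partial>count_space (range x)) = (\<integral>\<^sup>+k. f (x k) \<partial>count_space F)"
    by (rule nn_integral_bij_count_space[symmetric])
  also have "\<dots> = (\<integral>\<^sup>+k. f (x k) * indicator F k \<partial>count_space UNIV)"
    by (rule nn_integral_count_space_indicator) auto
  also have "\<dots> = (\<Sum>k. f (x k) * indicator F k)"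
    by (rule nn_integral_count_space_nat)
  also have "\<dots> = (\<Sum>k. if x k \<in> x ` {..<k} then 0 else f (x k))"
    by (rule suminf_cong) (auto simp: F_def indicator_def)
  finally show ?thesis .
qed

lemma measurable_nn_integral_range [measurable (raw)]:
  assumes [measurable]: "(\<lambda>(w, t). f w t) \<in> borel_measurable (N \<Otimes>\<^sub>M borel)"
    and [measurable]: "X \<in> measurable N seqsp"
  shows "(\<lambda>w. \<integral>\<^sup>+t. f w t \<partial>count_space (range (X w))) \<in> borel_measurable N"
proof -
  have [measurable]: "(\<lambda>w. X w k) \<in> borel_measurable N" for k
    by (rule measurable_seqsp_nth'[OF assms(2)]) simp
  have "(\<lambda>w. f w (X w k)) \<in> borel_measurable N" for k by measurable
  moreover have "Measurable.pred N (\<lambda>w. X w k \<in> X w ` {..<k})" for k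
  proof -
    have "(\<lambda>w. X w k \<in> X w ` {..<k}) = (\<lambda>w. \<exists>j\<in>{..<k}. X w k = X w j)" by auto
    then show ?thesis by simp
  qed
  ultimately show ?thesis unfolding nn_integral_count_space_range by simp
qed

lemma measurable_rescale:
  assumes "a < b" shows "rescale a b \<in> measurable seqsp seqsp"
proof (rule measurable_into_seqsp)
  fix k show "(\<lambda>x. rescale a b x k) \<in> borel_measurable seqsp"
  proof -
    have [measurable]: "(\<lambda>x. x (LEAST m. x m \<in> {a<..<b})) \<in> borel_measurable seqsp"
      by (rule measurable_seqsp_nth'[OF measurable_ident_sets]) auto
    show ?thesis unfolding rescale_def by measurable
  qed
next
  fix x :: "nat \<Rightarrow> real" and k
  have "x (LEAST m. x m \<in> {a<..<b}) \<in> {a<..<b}" if "\<exists>m. x m \<in> {a<..<b}"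
    using LeastI_ex[OF that] .
  then show "rescale a b x k \<in> {0<..<1}" using assms unfolding rescale_def by (auto simp: field_simps)
qed

lemma range_rescale:
  assumes "a < b" "\<exists>k. x k \<in> {a<..<b}"
  shows "range (rescale a b x) = (\<lambda>t. (t - a) / (b - a)) ` (range x \<inter> {a<..<b})"
proof (intro equalityI subsetI)
  fix v assume "v \<in> range (rescale a b x)"
  moreover have "x (LEAST m. x m \<in> {a<..<b}) \<in> {a<..<b}"
    using LeastI_ex[OF assms(2)] .
  ultimately show "v \<in> (\<lambda>t. (t - a) / (b - a)) ` (range x \<inter> {a<..<b})"
    using assms(2) unfolding rescale_def by (auto split: if_splits)
next
  fix v assume "v \<in> (\<lambda>t. (t - a) / (b - a)) ` (range x \<inter> {a<..<b})"
  then obtain k where "x k \<in> {a<..<b}" "v = (x k - a) / (b - a)" by auto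
  then have "v = rescale a b x k" by (simp add: rescale_def)
  then show "v \<in> range (rescale a b x)" by blast
qed

text \<open>Rescaling discards the points outside the interval, which is harmless when f vanishes
  there. A point inside is required, for otherwise the fallback value 1/2 would be counted.\<close>

lemma nn_integral_range_rescale:
  assumes "a < b" "\<exists>k. x k \<in> {a<..<b}" "\<And>t. t \<notin> {a<..<b} \<Longrightarrow> f t = 0"
  shows "(\<integral>\<^sup>+v. f (a + (b - a) * v) \<partial>count_space (range (rescale a b x)))
       = (\<integral>\<^sup>+t. f t \<partial>count_space (range x))"
proof -
  let ?h = "\<lambda>t. (t - a) / (b - a)"
  have "bij_betw ?h (range x \<inter> {a<..<b}) (range (rescale a b x))"
    unfolding range_rescale[OF assms(1,2)] using assms(1) by (auto simp: bij_betw_def inj_on_def)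
  then have "(\<integral>\<^sup>+v. f (a + (b - a) * v) \<partial>count_space (range (rescale a b x)))
      = (\<integral>\<^sup>+t. f (a + (b - a) * ?h t) \<partial>count_space (range x \<inter> {a<..<b}))"
    by (rule nn_integral_bij_count_space[symmetric])
  also have "\<dots> = (\<integral>\<^sup>+t. f t \<partial>count_space (range x \<inter> {a<..<b}))"
    using assms(1) by simp
  also have "\<dots> = (\<integral>\<^sup>+t. f t * indicator (range x \<inter> {a<..<b}) t \<partial>count_space UNIV)"
    by (simp add: nn_integral_count_space_indicator)
  also have "\<dots> = (\<integral>\<^sup>+t. f t * indicator (range x) t \<partial>count_space UNIV)"
    using assms(3) by (intro nn_integral_cong) (auto simp: indicator_def)
  also have "\<dots> = (\<integral>\<^sup>+t. f t \<partial>count_space (range x))"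
    by (simp add: nn_integral_count_space_indicator)
  finally show ?thesis .
qed

lemma dense_meets_interval:
  assumes "{0<..<1} \<subseteq> closure (range x)" "0 \<le> a" "a < b" "b \<le> (1::real)"
  shows "\<exists>k. x k \<in> {a<..<b}"
proof -
  have "(a + b) / 2 \<in> closure (range x)" using assms by auto
  then have "\<exists>y\<in>range x. dist y ((a + b) / 2) < (b - a) / 2"
    using closure_approachable[THEN iffD1, rule_format, of _ "range x" "(b - a) / 2"] assms(3) by simp
  then obtain k where "dist (x k) ((a + b) / 2) < (b - a) / 2" by auto
  then have "x k \<in> {a<..<b}" by (auto simp: dist_real_def abs_less_iff field_simps)
  then show ?thesis ..
qed

lemma dense_infinite_interval:
  assumes "{0<..<1} \<subseteq> closure (range x)" "0 \<le> a" "a < b" "b \<le> (1::real)"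
  shows "infinite (range x \<inter> {a<..<b})"
proof
  assume fin: "finite (range x \<inter> {a<..<b})"
  \<comment> \<open>The leftmost point in the interval, or b if there is none: no point is left in
    \<open>{a<..<c}\<close>, against density.\<close>
  define c where "c = Min (insert b (range x \<inter> {a<..<b}))"
  have "a < c" "c \<le> b" using fin assms(3) by (auto simp: c_def)
  then obtain k where "x k \<in> {a<..<c}" using dense_meets_interval[OF assms(1,2), of c] assms(4) by auto
  moreover from this have "c \<le> x k" using fin \<open>c \<le> b\<close> unfolding c_def by (intro Min_le) auto
  ultimately show False by auto
qed

section \<open>The intensity measure and its invariance under shifts\<close>

locale rcs =
  fixes \<mu> :: "(nat \<Rightarrow> real) measure"
  assumes prob_mu: "prob_space \<mu>"
    and sets_mu: "sets \<mu> = sets seqsp"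
    and dense_mu: "AE x in \<mu>. {0<..<1} \<subseteq> closure (range x)"
    and indep_mu: "indep_condition \<mu>"
    and stat_mu: "stationary_rcs \<mu>"
begin

sublocale mu: prob_space \<mu> by (rule prob_mu)

lemma measurable_mu: "measurable \<mu> N = measurable seqsp N"
  by (rule measurable_cong_sets[OF sets_mu refl])

lemma measurable_mu_nth [measurable]: "(\<lambda>x. x k) \<in> borel_measurable \<mu>"
  by (simp add: measurable_mu)

lemma space_mu: "space \<mu> = {x. \<forall>k. x k \<in> {0<..<1}}"
  using sets_eq_imp_space_eq[OF sets_mu] by (simp add: space_seqsp)

text \<open>The Campbell functional of the random set. For an indicator it is the expected number of
  points, each counted once.\<close>

definition intensity :: "(real \<Rightarrow> ennreal) \<Rightarrow> ennreal" where
  "intensity f = (\<integral>\<^sup>+x. (\<integral>\<^sup>+t. f t \<partial>count_space (range x)) \<partial>\<mu>)"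

lemma intensity_rescale:
  assumes ab: "0 < a" "a < b" "b < 1" and [measurable]: "f \<in> borel_measurable borel"
    and f: "\<And>t. t \<notin> {a<..<b} \<Longrightarrow> f t = 0"
  shows "(\<integral>\<^sup>+x. (\<integral>\<^sup>+v. f (a + (b - a) * v) \<partial>count_space (range x)) \<partial>(distr \<mu> seqsp (rescale a b)))
     = intensity f"
proof -
  have r: "rescale a b \<in> measurable \<mu> seqsp" using measurable_rescale[OF ab(2)] by (simp add: measurable_mu)
  have "(\<integral>\<^sup>+x. (\<integral>\<^sup>+v. f (a + (b - a) * v) \<partial>count_space (range x)) \<partial>(distr \<mu> seqsp (rescale a b)))
    = (\<integral>\<^sup>+x. (\<integral>\<^sup>+v. f (a + (b - a) * v) \<partial>count_space (range (rescale a b x))) \<partial>\<mu>)"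
    by (rule nn_integral_distr[OF r]) measurable
  also have "\<dots> = intensity f" unfolding intensity_def
  proof (rule nn_integral_cong_AE)
    show "AE x in \<mu>. (\<integral>\<^sup>+v. f (a + (b - a) * v) \<partial>count_space (range (rescale a b x)))
      = (\<integral>\<^sup>+t. f t \<partial>count_space (range x))"
      using dense_mu
    proof eventually_elim
      case (elim x)
      then show ?case
        using ab f by (intro nn_integral_range_rescale dense_meets_interval) auto
    qed
  qed
  finally show ?thesis .
qed

text \<open>Stationarity compares the rescaled sets of two intervals of equal length. Both sides are
  therefore computed in rescaled coordinates, where the same function F appears because the scale
  factor b - a is the same; f has to live on (a,b), the only part that the rescaled set
  sees.\<close>

lemma intensity_shift:
  assumes ab: "0 < a" "a < b" "b < 1" "0 < a + s" "b + s < 1"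
    and [measurable]: "f \<in> borel_measurable borel"
    and f: "\<And>t. t \<notin> {a<..<b} \<Longrightarrow> f t = 0"
  shows "intensity f = intensity (\<lambda>t. f (t - s))"
proof -
  define F where "F v = f (a + (b - a) * v)" for v
  have [measurable]: "F \<in> borel_measurable borel" unfolding F_def by measurable
  have eq: "ident_distr_rcs (distr \<mu> seqsp (rescale a b)) (distr \<mu> seqsp (rescale (a + s) (b + s)))"
    using stat_mu ab unfolding stationary_rcs_def by (auto intro!: stat_mu[unfolded stationary_rcs_def, rule_format])
  have "intensity f = (\<integral>\<^sup>+x. (\<integral>\<^sup>+v. F v \<partial>count_space (range x)) \<partial>(distr \<mu> seqsp (rescale a b)))"
    unfolding F_def using ab f by (intro intensity_rescale[symmetric]) auto
  also have "\<dots> = (\<integral>\<^sup>+x. (\<integral>\<^sup>+v. F v \<partial>count_space (range x)) \<partial>(distr \<mu> seqsp (rescale (a + s) (b + s))))"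
    by (rule ident_distr_rcs_nn_integral[OF eq]) measurable
  also have "\<dots> = (\<integral>\<^sup>+x. (\<integral>\<^sup>+v. f ((a + s) + ((b + s) - (a + s)) * v - s) \<partial>count_space (range x))
      \<partial>(distr \<mu> seqsp (rescale (a + s) (b + s))))"
    unfolding F_def by (simp add: algebra_simps)
  also have "\<dots> = intensity (\<lambda>t. f (t - s))"
    using ab f by (intro intensity_rescale[where f="\<lambda>t. f (t - s)"]) auto
  finally show ?thesis .
qed

lemma nn_integral_lborel_shift_indicator:
  assumes "D \<in> sets borel"
  shows "(\<integral>\<^sup>+s. indicator D (c + s) \<partial>lborel) = emeasure lborel D"
    and "(\<integral>\<^sup>+s. indicator D (c - s) \<partial>lborel) = emeasure lborel (D::real set)"
  using nn_integral_real_affine[of "indicator D" 1 c] nn_integral_real_affine[of "indicator D" "-1" c] assms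
  by simp_all

text \<open>Count the points t in C with t + s in D, take expectations and integrate over all shifts
  s: this gives the length of D times the intensity of C. After a shift by s, allowed by
  stationarity, the same integral is the length of C times the intensity of D. The intensity may
  fail to be sigma-finite, so the integrals are exchanged between \<open>lborel\<close> and
  \<open>\<mu>\<close>, and then, for fixed x, between \<open>lborel\<close> and a series.\<close>

lemma intensity_product:
  assumes [measurable]: "C \<in> sets borel" "D \<in> sets borel"
    and d: "0 < d" "C \<subseteq> {d<..<1-d}" "D \<subseteq> {d<..<1-d}"
  shows "emeasure lborel D * intensity (indicator C) = emeasure lborel C * intensity (indicator D)"
proof -
  interpret pair_sigma_finite "lborel :: real measure" \<mu> by unfold_locales
  have [measurable]: "(\<lambda>x. x) \<in> measurable \<mu> seqsp" by (simp add: measurable_mu)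
  have "intensity (\<lambda>t. indicator C t * indicator D (t + s))
      = intensity (\<lambda>t. indicator C (t - s) * indicator D t)" for s
  proof (cases "\<bar>s\<bar> < 1 - 2 * d")
    case True
    have "intensity (\<lambda>t. indicator C t * indicator D (t + s))
      = intensity (\<lambda>t. indicator C (t - s) * indicator D (t - s + s))"
    \<comment> \<open>This interval is the set of t for which both t and t + s lie in
      \<open>{d<..<1-d}\<close>; the margin d keeps it and its shift inside (0,1). For larger shifts
      there is no such t and both sides are 0.\<close>
    proof (rule intensity_shift[where a="max d (d - s)" and b="min (1 - d) (1 - d - s)"])
      show "indicator C t * indicator D (t + s) = (0::ennreal)"
        if "t \<notin> {max d (d - s)<..<min (1 - d) (1 - d - s)}" for t
        using that d by (auto simp: indicator_def split: if_splits)
    qed (use True d in \<open>auto simp: max_def min_def abs_if split: if_splits\<close>)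
    then show ?thesis by simp
  next
    case False
    have 1: "indicator C t * indicator D (t + s) = (0::ennreal)" for t
      using False d by (fastforce simp: indicator_def abs_if split: if_splits)
    have "indicator C (t - s) * indicator D t = (0::ennreal)" for t
      using 1[of "t - s"] by simp
    then show ?thesis by (simp only: 1)
  qed
  then have "(\<integral>\<^sup>+s. intensity (\<lambda>t. indicator C t * indicator D (t + s)) \<partial>lborel)
      = (\<integral>\<^sup>+s. intensity (\<lambda>t. indicator C (t - s) * indicator D t) \<partial>lborel)" by simp
  note eq = this
  \<comment> \<open>The exchange for a kernel G whose integral over s does not depend on t. It is
    used with C fixed and D moving, and the other way round.\<close>
  have int: "(\<integral>\<^sup>+s. intensity (\<lambda>t. F t * G t s) \<partial>lborel) = c * intensity F"
    if [measurable]: "F \<in> borel_measurable borel" "case_prod G \<in> borel_measurable (borel \<Otimes>\<^sub>M borel)"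
      and c: "\<And>t. (\<integral>\<^sup>+s. G t s \<partial>lborel) = c"
    for F :: "real \<Rightarrow> ennreal" and G :: "real \<Rightarrow> real \<Rightarrow> ennreal" and c
  proof -
    have [measurable]: "G t \<in> borel_measurable borel" for t
      using measurable_Pair2[OF that(2), of t] by simp
    have [measurable]: "(\<lambda>z. G (snd z) (fst (fst z))) \<in> borel_measurable ((lborel \<Otimes>\<^sub>M \<mu>) \<Otimes>\<^sub>M borel)"
    proof -
      have "(\<lambda>z. (snd z, fst (fst z))) \<in> measurable ((lborel \<Otimes>\<^sub>M \<mu>) \<Otimes>\<^sub>M borel) (borel \<Otimes>\<^sub>M borel)"
        by measurable
      from measurable_compose[OF this that(2)] show ?thesis by simp
    qed
    have "(\<lambda>w. \<integral>\<^sup>+t. F t * G t (fst w) \<partial>count_space (range (snd w))) \<in> borel_measurable (lborel \<Otimes>\<^sub>M \<mu>)"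
    proof (rule measurable_nn_integral_range)
      show "(\<lambda>(w, t). F t * G t (fst w)) \<in> borel_measurable ((lborel \<Otimes>\<^sub>M \<mu>) \<Otimes>\<^sub>M borel)"
        unfolding split_beta' by (intro borel_measurable_times_ennreal) measurable
      show "snd \<in> lborel \<Otimes>\<^sub>M \<mu> \<rightarrow>\<^sub>M seqsp" using measurable_snd[of lborel \<mu>] by (simp add: measurable_cong_sets[OF refl sets_mu])
    qed
    then have meas: "(\<lambda>(s, x). \<integral>\<^sup>+t. F t * G t s \<partial>count_space (range x)) \<in> borel_measurable (lborel \<Otimes>\<^sub>M \<mu>)"
      by (simp add: split_beta')
    have "(\<integral>\<^sup>+s. intensity (\<lambda>t. F t * G t s) \<partial>lborel)
        = (\<integral>\<^sup>+x. (\<integral>\<^sup>+s. (\<integral>\<^sup>+t. F t * G t s \<partial>count_space (range x)) \<partial>lborel) \<partial>\<mu>)"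
      unfolding intensity_def
      by (rule Fubini'[OF meas, symmetric])
    also have "\<dots> = (\<integral>\<^sup>+x. (\<integral>\<^sup>+t. c * F t \<partial>count_space (range x)) \<partial>\<mu>)"
    proof (rule nn_integral_cong)
      fix x assume "x \<in> space \<mu>"
      have m: "(\<lambda>s. if x k \<in> x ` {..<k} then 0 else F (x k) * G (x k) s) \<in> borel_measurable lborel" for k
        by (cases "x k \<in> x ` {..<k}") simp_all
      have "(\<integral>\<^sup>+s. (\<integral>\<^sup>+t. F t * G t s \<partial>count_space (range x)) \<partial>lborel)
        = (\<Sum>k. \<integral>\<^sup>+s. (if x k \<in> x ` {..<k} then 0 else F (x k) * G (x k) s) \<partial>lborel)"
        unfolding nn_integral_count_space_range by (rule nn_integral_suminf[OF m])
      also have "\<dots> = (\<Sum>k. (if x k \<in> x ` {..<k} then 0 else c * F (x k)))"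
      proof (rule suminf_cong)
        fix k show "(\<integral>\<^sup>+s. (if x k \<in> x ` {..<k} then 0 else F (x k) * G (x k) s) \<partial>lborel)
          = (if x k \<in> x ` {..<k} then 0 else c * F (x k))"
          by (cases "x k \<in> x ` {..<k}") (simp_all add: nn_integral_cmult c mult.commute)
      qed
      finally show "(\<integral>\<^sup>+s. (\<integral>\<^sup>+t. F t * G t s \<partial>count_space (range x)) \<partial>lborel)
        = (\<integral>\<^sup>+t. c * F t \<partial>count_space (range x))"
        unfolding nn_integral_count_space_range .
    qed
    also have "\<dots> = (\<integral>\<^sup>+x. c * (\<integral>\<^sup>+t. F t \<partial>count_space (range x)) \<partial>\<mu>)"
      by (simp add: nn_integral_cmult)
    also have "\<dots> = c * intensity F"
      unfolding intensity_def
      by (intro nn_integral_cmult measurable_nn_integral_range) (simp_all add: split_beta' measurable_mu)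
    finally show ?thesis .
  qed
  have "emeasure lborel D * intensity (indicator C)
      = (\<integral>\<^sup>+s. intensity (\<lambda>t. indicator C t * indicator D (t + s)) \<partial>lborel)"
    by (rule int[symmetric]) (simp_all add: nn_integral_lborel_shift_indicator split_beta')
  also have "\<dots> = (\<integral>\<^sup>+s. intensity (\<lambda>t. indicator D t * indicator C (t - s)) \<partial>lborel)"
    unfolding eq by (simp only: mult.commute)
  also have "\<dots> = emeasure lborel C * intensity (indicator D)"
    by (rule int) (simp_all add: nn_integral_lborel_shift_indicator split_beta')
  finally show ?thesis .
qed

lemma intensity_interval:
  assumes "0 \<le> a" "a < b" "b \<le> 1"
  shows "intensity (indicator {a<..<b}) = \<infinity>"
proof -
  have "(\<integral>\<^sup>+t. indicator {a<..<b} t \<partial>count_space (range x)) = \<infinity>"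
    if "{0<..<1} \<subseteq> closure (range x)" for x
  proof -
    have "(\<integral>\<^sup>+t. indicator {a<..<b} t \<partial>count_space (range x))
      = (\<integral>\<^sup>+t. indicator (range x \<inter> {a<..<b}) t \<partial>count_space (range x))"
      by (intro nn_integral_cong) (auto simp: indicator_def)
    also have "\<dots> = emeasure (count_space (range x)) (range x \<inter> {a<..<b})"
      by (rule nn_integral_indicator) auto
    also have "\<dots> = \<infinity>"
      using dense_infinite_interval[OF that assms] by (simp add: emeasure_count_space)
    finally show ?thesis .
  qed
  note top = this
  from dense_mu have "AE x in \<mu>. (\<integral>\<^sup>+t. indicator {a<..<b} t \<partial>count_space (range x)) = \<infinity>"
    by (rule eventually_mono) (rule top)
  then have "intensity (indicator {a<..<b}) = (\<integral>\<^sup>+x. \<infinity> \<partial>\<mu>)"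
    unfolding intensity_def by (rule nn_integral_cong_AE)
  then show ?thesis by (simp add: mu.emeasure_space_1)
qed

text \<open>Comparison with \<open>{d<..<1-d}\<close>, which has positive finite length and infinite
  intensity: \<open>intensity_product\<close> becomes (length of D) * \<infinity> = (1 - 2 d) *
  (intensity of D), where 0 * \<infinity> = 0. For d at least 1/2 the set D is empty.\<close>

lemma intensity_null_or_infinite:
  assumes [measurable]: "D \<in> sets borel" and d: "0 < d" "D \<subseteq> {d<..<1-d}"
  shows "intensity (indicator D) = (if emeasure lborel D = 0 then 0 else \<infinity>)"
proof (cases "d < 1 / 2")
  case True
  have "emeasure lborel D * \<infinity> = emeasure lborel {d<..<1-d} * intensity (indicator D)"
    using intensity_product[of "{d<..<1-d}" D d] intensity_interval[of d "1-d"] True d by simp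
  moreover have "ennreal (1 - 2 * d) * c \<noteq> \<top>" if "c \<noteq> \<top>" for c
    using that by (simp add: ennreal_mult_eq_top_iff)
  ultimately show ?thesis using True d
    by (auto simp: ennreal_mult_top split: if_splits) metis
next
  case False
  with d have "D = {}" by auto
  then show ?thesis by (simp add: intensity_def)
qed
end

section \<open>Independent fragments and the probability of missing a set\<close>

text \<open>The indices 1 to n are those of the fragments in \<open>indep_condition\<close> for the
  cut points i / n. Half-open cells put each point of (0,1) into exactly one of them.\<close>

definition cell :: "nat \<Rightarrow> nat \<Rightarrow> real set" where
  "cell n i = {(real i - 1) / real n..<real i / real n}"

lemma cell_measurable [measurable, simp]: "cell n i \<in> sets borel"
  unfolding cell_def by simp

lemma in_cell_iff:
  assumes "n > 0" "i > 0" "0 \<le> t" shows "t \<in> cell n i \<longleftrightarrow> i = Suc (nat \<lfloor>real n * t\<rfloor>)"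
proof -
  have "t \<in> cell n i \<longleftrightarrow> \<lfloor>real n * t\<rfloor> = int i - 1"
    unfolding floor_eq_iff using assms by (auto simp: cell_def field_simps)
  also have "\<dots> \<longleftrightarrow> i = Suc (nat \<lfloor>real n * t\<rfloor>)"
    using assms by (auto simp: nat_eq_iff2)
  finally show ?thesis .
qed

lemma in_some_cell:
  assumes "n > 0" "0 < t" "t < 1" shows "\<exists>i\<in>{1..n}. t \<in> cell n i"
proof
  have "real n * t < real n" using assms by simp
  then have "\<lfloor>real n * t\<rfloor> < int n" by linarith
  then show "Suc (nat \<lfloor>real n * t\<rfloor>) \<in> {1..n}" using assms by auto
  show "t \<in> cell n (Suc (nat \<lfloor>real n * t\<rfloor>))" using in_cell_iff assms by simp
qed

lemma range_enum:
  fixes y :: "nat \<Rightarrow> nat \<Rightarrow> 'a"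
  assumes "n > 0"
  shows "range (\<lambda>k. y (1 + k mod n) (k div n)) = (\<Union>i\<in>{1..n}. range (y i))"
proof (intro equalityI subsetI)
  fix t assume "t \<in> (\<Union>i\<in>{1..n}. range (y i))"
  then obtain i j where "i \<in> {1..n}" "t = y i j" by auto
  moreover from this have "((i - 1) + n * j) mod n = i - 1" "((i - 1) + n * j) div n = j"
    using assms by (cases i; simp)+
  ultimately have "t = y (1 + ((i - 1) + n * j) mod n) (((i - 1) + n * j) div n)" by simp
  then show "t \<in> range (\<lambda>k. y (1 + k mod n) (k div n))" by blast
next
  fix t assume "t \<in> range (\<lambda>k. y (1 + k mod n) (k div n))"
  then obtain k where "t = y (1 + k mod n) (k div n)" by auto
  then show "t \<in> (\<Union>i\<in>{1..n}. range (y i))"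
    using assms by (intro UN_I[of "1 + k mod n"]) (auto simp: Suc_le_eq)
qed

text \<open>As soon as 1 / n is below all distances in a finite subset F of A, the points of F
  occupy different cells. The partitions are not nested, so the number of occupied cells need not
  increase with n; a lower limit is all that Fatou's lemma asks for.\<close>

lemma card_cells_liminf:
  assumes "A \<subseteq> {0<..<1}"
  shows "emeasure (count_space UNIV) A
     \<le> liminf (\<lambda>n. \<Sum>i\<in>{1..n}. if A \<inter> cell n i = {} then 0 else (1::ennreal))"
proof -
  define N where "N n = card {i\<in>{1..n}. A \<inter> cell n i \<noteq> {}}" for n
  have N: "(\<Sum>i\<in>{1..n}. if A \<inter> cell n i = {} then 0 else (1::ennreal)) = of_nat (N n)" for n
    unfolding N_def by (simp add: sum.If_cases Int_def)
  have fin: "of_nat (card F) \<le> liminf (\<lambda>n. of_nat (N n) :: ennreal)" if F: "finite F" "F \<subseteq> A" for F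
  proof (rule Liminf_bounded)
    have "eventually (\<lambda>n. real n * \<bar>s - t\<bar> > 1) sequentially" if "s \<noteq> t" for s t :: real
    proof -
      have "filterlim (\<lambda>n. real n * \<bar>s - t\<bar>) at_top sequentially"
        using that by (intro filterlim_at_top_mult_tendsto_pos[where c="\<bar>s - t\<bar>"] tendsto_const filterlim_real_sequentially) 
           auto
      then show ?thesis by (simp add: filterlim_at_top_dense)
    qed
    then have "eventually (\<lambda>n. s \<noteq> t \<longrightarrow> real n * \<bar>s - t\<bar> > 1) sequentially" for s t :: real
      by (cases "s = t") auto
    then have "eventually (\<lambda>n. \<forall>s\<in>F. \<forall>t\<in>F. s \<noteq> t \<longrightarrow> real n * \<bar>s - t\<bar> > 1) sequentially"
      using F(1) by (intro eventually_ball_finite ballI) auto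
    then show "\<forall>\<^sub>F n in sequentially. of_nat (card F) \<le> (of_nat (N n) :: ennreal)"
      using eventually_gt_at_top[of 0]
    proof eventually_elim
      case (elim n)
      have "inj_on (\<lambda>t. Suc (nat \<lfloor>real n * t\<rfloor>)) F"
      proof (rule inj_onI, rule ccontr)
        fix s t assume st: "s \<in> F" "t \<in> F" "Suc (nat \<lfloor>real n * s\<rfloor>) = Suc (nat \<lfloor>real n * t\<rfloor>)" "s \<noteq> t"
        moreover have "0 < s" "0 < t" using F assms st(1,2) by auto
        then have "0 \<le> \<lfloor>real n * s\<rfloor>" "0 \<le> \<lfloor>real n * t\<rfloor>" by simp_all
        ultimately have "\<lfloor>real n * s\<rfloor> = \<lfloor>real n * t\<rfloor>" by (simp only: nat.inject eq_nat_nat_iff)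
        then have "\<bar>real n * s - real n * t\<bar> < 1" by linarith
        moreover have "1 < \<bar>real n * s - real n * t\<bar>"
          using elim st by (simp add: abs_mult right_diff_distrib[symmetric])
        ultimately show False by simp
      qed
      then have "card F = card ((\<lambda>t. Suc (nat \<lfloor>real n * t\<rfloor>)) ` F)" by (simp add: card_image)
      also have "\<dots> \<le> N n" unfolding N_def
      proof (rule card_mono)
        show "(\<lambda>t. Suc (nat \<lfloor>real n * t\<rfloor>)) ` F \<subseteq> {i \<in> {1..n}. A \<inter> cell n i \<noteq> {}}"
        proof safe
          fix t assume t: "t \<in> F"
          then have t': "0 < t" "t < 1" "t \<in> A" using F assms by auto
          from in_some_cell[OF elim(2) t'(1,2)] obtain i where "i \<in> {1..n}" "t \<in> cell n i" by auto
          with t' elim show "Suc (nat \<lfloor>real n * t\<rfloor>) \<in> {1..n}" by (simp add: in_cell_iff)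
          have "t \<in> A \<inter> cell n (Suc (nat \<lfloor>real n * t\<rfloor>))" using t' elim by (simp add: in_cell_iff)
          then show "A \<inter> cell n (Suc (nat \<lfloor>real n * t\<rfloor>)) = {} \<Longrightarrow> False" by blast
        qed
      qed simp
      finally show ?case by simp
    qed
  qed
  show ?thesis
  proof (cases "finite A")
    case True
    then show ?thesis unfolding N using fin[of A] by simp
  next
    case False
    have "of_nat m \<le> liminf (\<lambda>n. of_nat (N n) :: ennreal)" for m
      using fin infinite_arbitrarily_large[OF False, of m] by blast
    then have "liminf (\<lambda>n. of_nat (N n) :: ennreal) = \<top>"
      using ennreal_Ex_less_of_nat by (metis linorder_not_less top.not_eq_extremum)
    then show ?thesis unfolding N by simp
  qed
qed

context rcs begin

text \<open>Independence of the coordinate sequences says that their joint law is the product of its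
  marginals \<open>R i\<close>. Later arguments use only this product and the coupling with
  \<open>\<mu>\<close>.\<close>

lemma fragments:
  assumes n: "n \<ge> 2"
  obtains R where "\<And>i. prob_space (R i)" "\<And>i. sets (R i) = sets seqsp"
    "\<And>i. i \<in> {1..n} \<Longrightarrow> AE z in R i. \<forall>j. z j \<in> cell n i"
    "ident_distr_rcs (distr (PiM {1..n} R) seqsp (\<lambda>y k. y (1 + k mod n) (k div n))) \<mu>"
proof -
  have "\<exists>Q. prob_space Q \<and> sets Q = sets (PiM {1..n} (\<lambda>_. seqsp)) \<and>
             ident_distr_rcs (distr Q seqsp (\<lambda>y k. y (1 + k mod n) (k div n))) \<mu> \<and>
             (\<forall>i\<in>{1..n}. \<forall>j. AE y in Q. y i j \<in> {real (i - 1) / real n..<real i / real n}) \<and>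
             prob_space.indep_vars Q (\<lambda>_. seqsp) (\<lambda>i y. y i) {1..n}"
    using n by (intro indep_mu[unfolded indep_condition_def, rule_format]) (auto simp: divide_strict_right_mono)
  then obtain Q where Q: "prob_space Q" and sets_Q: "sets Q = sets (PiM {1..n} (\<lambda>_. seqsp))"
    and id: "ident_distr_rcs (distr Q seqsp (\<lambda>y k. y (1 + k mod n) (k div n))) \<mu>"
    and loc: "\<And>i j. i \<in> {1..n} \<Longrightarrow> AE y in Q. y i j \<in> {real (i - 1) / real n..<real i / real n}"
    and indep: "prob_space.indep_vars Q (\<lambda>_. seqsp) (\<lambda>i y. y i) {1..n}" by blast
  interpret Q: prob_space Q by fact
  have proj: "(\<lambda>y. y i) \<in> measurable Q seqsp" if "i \<in> {1..n}" for i
    using that by (simp add: measurable_cong_sets[OF sets_Q refl])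
  \<comment> \<open>Product spaces want a probability measure at every index; \<open>\<mu>\<close>
    fills the places outside {1..n}.\<close>
  define R where "R i = (if i \<in> {1..n} then distr Q seqsp (\<lambda>y. y i) else \<mu>)" for i
  have "PiM {1..n} R = (\<Pi>\<^sub>M i\<in>{1..n}. distr Q seqsp (\<lambda>y. y i))"
    by (rule PiM_cong) (auto simp: R_def)
  also have "\<dots> = distr Q (PiM {1..n} (\<lambda>_. seqsp)) (\<lambda>y. \<lambda>i\<in>{1..n}. y i)"
    using indep proj n by (subst (asm) Q.indep_vars_iff_distr_eq_PiM') auto
  also have "\<dots> = distr Q Q (\<lambda>y. y)"
  proof (rule distr_cong)
    fix y assume "y \<in> space Q"
    then have "y \<in> extensional {1..n}"
      unfolding sets_eq_imp_space_eq[OF sets_Q] by (auto simp: space_PiM PiE_def)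
    then show "(\<lambda>i\<in>{1..n}. y i) = y" by (simp add: extensional_restrict)
  qed (auto simp: sets_Q)
  finally have PiM_R: "PiM {1..n} R = Q" by simp
  show thesis
  proof
    show "prob_space (R i)" for i
      by (cases "i \<in> {1..n}") (simp_all add: R_def Q.prob_space_distr[OF proj] prob_mu)
    show "sets (R i) = sets seqsp" for i by (simp add: R_def sets_mu)
    show "AE z in R i. \<forall>j. z j \<in> cell n i" if "i \<in> {1..n}" for i
    proof -
      have "AE y in Q. \<forall>j. y i j \<in> cell n i"
        using loc that by (simp add: AE_all_countable cell_def of_nat_diff)
      moreover have "{z\<in>space seqsp. \<forall>j. z j \<in> cell n i} \<in> sets seqsp" by measurable
      moreover have "R i = distr Q seqsp (\<lambda>y. y i)" using that by (simp only: R_def if_True)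
      ultimately show ?thesis by (simp only: AE_distr_iff[OF proj[OF that]])
    qed
    show "ident_distr_rcs (distr (PiM {1..n} R) seqsp (\<lambda>y k. y (1 + k mod n) (k div n))) \<mu>"
      unfolding PiM_R by (rule id)
  qed
qed

lemma hit_null:
  assumes D [measurable]: "D \<in> sets borel" and d: "0 < d" "D \<subseteq> {d<..<1-d}" and 0: "emeasure lborel D = 0"
  shows "AE x in \<mu>. range x \<inter> D = {}"
proof -
  have "(\<lambda>x. \<integral>\<^sup>+t. indicator D t \<partial>count_space (range x)) \<in> borel_measurable \<mu>"
    by (rule measurable_nn_integral_range) (simp_all add: measurable_mu)
  then have "AE x in \<mu>. (\<integral>\<^sup>+t. indicator D t \<partial>count_space (range x)) = 0"
    using intensity_null_or_infinite[OF D d] 0 by (simp add: nn_integral_0_iff_AE intensity_def)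
  then show ?thesis
  proof eventually_elim
    case (elim x)
    then have "indicator D t = (0::ennreal)" if "t \<in> range x" for t
      using that by (elim rangeE) (simp add: nn_integral_0_iff_AE AE_count_space)
    then show ?case by (auto simp: indicator_def)
  qed
qed

lemma miss_measurable [measurable]:
  assumes [measurable]: "D \<in> sets borel"
  shows "Measurable.pred seqsp (\<lambda>x. range x \<inter> D = {})"
proof -
  have eq: "(\<lambda>x. range x \<inter> D = {}) = (\<lambda>x. \<forall>k. x k \<notin> D)" by auto
  show ?thesis unfolding eq by measurable
qed

text \<open>Let q_i be the probability that fragment i misses D. Independence makes p the product of
  the q_i, and the expected number of cells in which D is hit is the sum of the 1 - q_i. Since 1 - q
  is at most - ln q, that sum is at most - ln p, uniformly in n. By Fatou's lemma and
  \<open>card_cells_liminf\<close> the bound passes to the expected number of points in D.\<close>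

lemma intensity_le_ln_miss:
  assumes D [measurable]: "D \<in> sets borel" and D01: "D \<subseteq> {0<..<1}"
    and pos: "0 < measure \<mu> {x\<in>space \<mu>. range x \<inter> D = {}}" (is "0 < ?p")
  shows "intensity (indicator D) \<le> ennreal (- ln ?p)"
proof -
  define N where "N n S = (\<Sum>i\<in>{1..n}. if S \<inter> (D \<inter> cell n i) = {} then 0 else (1::ennreal))" for n S
  have N_meas [measurable]: "(\<lambda>x. N n (range x)) \<in> borel_measurable seqsp" for n
    unfolding N_def by (intro borel_measurable_sum measurable_If) (simp_all add: pred_def[symmetric])
  have bound: "(\<integral>\<^sup>+x. N n (range x) \<partial>\<mu>) \<le> ennreal (- ln ?p)" if n: "n \<ge> 2" for n
  proof -
    obtain R where R: "\<And>i. prob_space (R i)" "\<And>i. sets (R i) = sets seqsp"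
      "\<And>i. i \<in> {1..n} \<Longrightarrow> AE z in R i. \<forall>j. z j \<in> cell n i"
      "ident_distr_rcs (distr (PiM {1..n} R) seqsp (\<lambda>y k. y (1 + k mod n) (k div n))) \<mu>"
      using fragments[OF n] by blast
    interpret R: finite_product_prob_space R "{1..n}"
      using R(1) by (simp add: finite_product_prob_space_def product_prob_space_def
        product_sigma_finite_def product_prob_space_axioms_def finite_product_sigma_finite_def
        finite_product_sigma_finite_axioms_def prob_space_imp_sigma_finite)
    have mR: "measurable (R i) N = measurable seqsp N" for i and N :: "'z measure" by (rule measurable_cong_sets[OF R(2) refl])
    have spR: "space (R i) = space seqsp" for i by (rule sets_eq_imp_space_eq[OF R(2)])
    let ?Q = "PiM {1..n} R" and ?E = "\<lambda>(y::nat \<Rightarrow> nat \<Rightarrow> real) k. y (1 + k mod n) (k div n)"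
    have comp: "(\<lambda>y. y i) \<in> measurable ?Q seqsp" if "i \<in> {1..n}" for i
      using measurable_component_singleton[OF that, of R] by (simp add: measurable_cong_sets[OF refl R(2)])
    have E: "?E \<in> measurable ?Q seqsp"
    proof (rule measurable_into_seqsp)
      fix k
      have k: "1 + k mod n \<in> {1..n}" using n by (simp add: Suc_le_eq)
      show "(\<lambda>y. y (1 + k mod n) (k div n)) \<in> borel_measurable ?Q"
        by (rule measurable_compose[OF comp[OF k] measurable_seqsp_nth])
      fix y assume "y \<in> space ?Q"
      then show "y (1 + k mod n) (k div n) \<in> {0<..<1}"
        using measurable_space[OF comp[OF k]] by (simp add: space_seqsp)
    qed
    have ran: "range (?E y) = (\<Union>i\<in>{1..n}. range (y i))" for y using n by (intro range_enum) simp
    have AEcomp: "AE y in ?Q. P (y i)" if i: "i \<in> {1..n}" and "AE z in R i. P z" for i P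
      using that R(1) by (intro AE_PiM_component) auto
    define q where "q i = measure (R i) {z\<in>space (R i). range z \<inter> D = {}}" for i
    have q_sets: "{z\<in>space (R i). range z \<inter> D = {}} \<in> sets (R i)" for i
      using miss_measurable[OF D] by (simp add: pred_def R(2) spR)
    have q01: "0 \<le> q i" "q i \<le> 1" for i
      using prob_space.prob_le_1[OF R(1)] by (simp_all add: q_def)
    \<comment> \<open>The union of the fragments misses D exactly if every fragment does, so p
      factorises.\<close>
    have "ennreal ?p = (\<integral>\<^sup>+x. (if range x \<inter> D = {} then 1 else 0) \<partial>\<mu>)"
    proof -
      have "ennreal ?p = emeasure \<mu> {x\<in>space \<mu>. range x \<inter> D = {}}" by (simp add: mu.emeasure_eq_measure)
      also have "\<dots> = (\<integral>\<^sup>+x. indicator {x\<in>space \<mu>. range x \<inter> D = {}} x \<partial>\<mu>)"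
        using miss_measurable[OF D] unfolding pred_def
        by (subst nn_integral_indicator) (simp_all add: sets_mu sets_eq_imp_space_eq[OF sets_mu])
      finally show ?thesis by (auto intro!: nn_integral_cong elim!: trans simp: indicator_def)
    qed
    also have "\<dots> = (\<integral>\<^sup>+x. (if range x \<inter> D = {} then 1 else 0) \<partial>distr ?Q seqsp ?E)"
      by (rule ident_distr_rcs_nn_integral[OF R(4), symmetric]) simp
    also have "\<dots> = (\<integral>\<^sup>+y. (if range (?E y) \<inter> D = {} then 1 else 0) \<partial>?Q)"
      by (rule nn_integral_distr[OF E]) simp
    also have "\<dots> = (\<integral>\<^sup>+y. indicator (PiE {1..n} (\<lambda>i. {z\<in>space (R i). range z \<inter> D = {}})) y \<partial>?Q)"
      unfolding ran
    proof (rule nn_integral_cong)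
      fix y assume "y \<in> space ?Q"
      then have "y \<in> PiE {1..n} (\<lambda>i. {z\<in>space (R i). range z \<inter> D = {}}) \<longleftrightarrow> (\<forall>i\<in>{1..n}. range (y i) \<inter> D = {})"
        by (auto simp: space_PiM PiE_iff)
      moreover have "(\<Union>i\<in>{1..n}. range (y i)) \<inter> D = {} \<longleftrightarrow> (\<forall>i\<in>{1..n}. range (y i) \<inter> D = {})" by blast
      ultimately show "(if (\<Union>i\<in>{1..n}. range (y i)) \<inter> D = {} then 1 else (0::ennreal))
        = indicator (PiE {1..n} (\<lambda>i. {z\<in>space (R i). range z \<inter> D = {}})) y"
        by (simp only: indicator_def of_bool_def)
    qed
    also have "\<dots> = emeasure ?Q (PiE {1..n} (\<lambda>i. {z\<in>space (R i). range z \<inter> D = {}}))"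
      using q_sets by (intro nn_integral_indicator sets_PiM_I_finite) auto
    also have "\<dots> = ennreal (\<Prod>i\<in>{1..n}. q i)"
      using q_sets by (subst R.measure_times)
        (auto simp: q_def R.M.emeasure_eq_measure prod_ennreal)
    finally have p: "?p = (\<Prod>i\<in>{1..n}. q i)"
      using pos by (subst (asm) ennreal_inj) (auto intro!: prod_nonneg q01)
    have "(\<integral>\<^sup>+x. N n (range x) \<partial>\<mu>) = (\<integral>\<^sup>+x. N n (range x) \<partial>distr ?Q seqsp ?E)"
      by (rule ident_distr_rcs_nn_integral[OF R(4), symmetric]) simp
    also have "\<dots> = (\<integral>\<^sup>+y. N n (range (?E y)) \<partial>?Q)"
      by (rule nn_integral_distr[OF E]) simp
    also have "\<dots> = (\<integral>\<^sup>+y. (\<Sum>i\<in>{1..n}. if range (y i) \<inter> D = {} then 0 else 1) \<partial>?Q)"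
    proof (rule nn_integral_cong_AE)
      have "AE y in ?Q. \<forall>i\<in>{1..n}. \<forall>j. y i j \<in> cell n i"
        using R(3) by (intro AE_finite_allI AEcomp) auto
      \<comment> \<open>Nonnegative points lie in at most one cell by \<open>in_cell_iff\<close>.
        Hence only fragment i can meet cell i, and counting hit cells amounts to counting hit
        fragments.\<close>
      moreover have "AE y in ?Q. \<forall>i\<in>{1..n}. \<forall>j. 0 < y i j"
      proof (intro AE_I2 ballI allI)
        fix y i j assume "y \<in> space ?Q" "i \<in> {1..n}"
        then show "0 < y i j" using measurable_space[OF comp[of i]] by (simp add: space_seqsp)
      qed
      ultimately show "AE y in ?Q. N n (range (?E y)) = (\<Sum>i\<in>{1..n}. if range (y i) \<inter> D = {} then 0 else 1)"
      proof eventually_elim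
        case (elim y)
        have "(\<Union>l\<in>{1..n}. range (y l)) \<inter> (D \<inter> cell n i) = range (y i) \<inter> D" if i: "i \<in> {1..n}" for i
        proof (intro equalityI subsetI)
          fix t assume "t \<in> (\<Union>l\<in>{1..n}. range (y l)) \<inter> (D \<inter> cell n i)"
          then obtain l j where l: "l \<in> {1..n}" "t = y l j" "t \<in> cell n i" "t \<in> D" by auto
          moreover from elim l have "t \<in> cell n l" "0 < t" by auto
          ultimately have "i = l" using i by (auto simp: in_cell_iff)
          with l show "t \<in> range (y i) \<inter> D" by auto
        qed (use elim i in auto)
        then show ?case unfolding N_def ran by (intro sum.cong) auto
      qed
    qed
    also have "\<dots> = (\<Sum>i\<in>{1..n}. \<integral>\<^sup>+y. (if range (y i) \<inter> D = {} then 0 else 1) \<partial>?Q)"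
      using measurable_compose[OF comp miss_measurable[OF D]]
      by (intro nn_integral_sum measurable_If) (auto simp: pred_def)
    also have "\<dots> = (\<Sum>i\<in>{1..n}. ennreal (1 - q i))"
    proof (rule sum.cong)
      fix i assume i: "i \<in> {1..n}"

      have "(\<integral>\<^sup>+y. (if range (y i) \<inter> D = {} then 0 else 1) \<partial>?Q)
        = (\<integral>\<^sup>+z. (if range z \<inter> D = {} then 0 else 1) \<partial>distr ?Q (R i) (\<lambda>y. y i))"
        using i by (intro nn_integral_distr[symmetric]) (simp_all add: mR)
      also have "distr ?Q (R i) (\<lambda>y. y i) = R i"
        using i R(1) by (intro distr_PiM_component) auto
      also have "(\<integral>\<^sup>+z. (if range z \<inter> D = {} then 0 else 1) \<partial>R i)
        = (\<integral>\<^sup>+z. indicator (space (R i) - {z\<in>space (R i). range z \<inter> D = {}}) z \<partial>R i)"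
        by (rule nn_integral_cong) (auto simp: indicator_def)
      also have "\<dots> = emeasure (R i) (space (R i) - {z\<in>space (R i). range z \<inter> D = {}})"
        using q_sets by (intro nn_integral_indicator) auto
      also have "\<dots> = ennreal (1 - q i)"
        using q_sets by (simp add: R.M.emeasure_eq_measure R.M.prob_compl q_def)
      finally show "(\<integral>\<^sup>+y. (if range (y i) \<inter> D = {} then 0 else 1) \<partial>?Q) = ennreal (1 - q i)" .
    qed simp
    also have "\<dots> = ennreal (\<Sum>i\<in>{1..n}. 1 - q i)" using q01 by (intro sum_ennreal) auto
    also have "(\<Sum>i\<in>{1..n}. 1 - q i) \<le> - ln ?p"
    proof -
      \<comment> \<open>No factor vanishes because the product p is positive, so the logarithm of
        the product splits.\<close>
      have "0 < q i" if "i \<in> {1..n}" for i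
        using pos p that q01(1)[of i] by (metis finite_atLeastAtMost less_eq_real_def prod_zero_iff order_less_irrefl)
      moreover from this have "q i \<noteq> 0" if "i \<in> {1..n}" for i using that by force
      then have "ln ?p = (\<Sum>i\<in>{1..n}. ln (q i))" unfolding p by (intro ln_prod finite_atLeastAtMost)
      moreover have "(\<Sum>i\<in>{1..n}. ln (q i)) \<le> (\<Sum>i\<in>{1..n}. q i - 1)"
        using calculation(1) by (intro sum_mono ln_le_minus_one)
      ultimately show ?thesis by (simp add: sum_subtractf)
    qed
    finally show ?thesis by (simp add: ennreal_leI)
  qed
  have "intensity (indicator D) \<le> (\<integral>\<^sup>+x. liminf (\<lambda>n. N n (range x)) \<partial>\<mu>)"
    unfolding intensity_def
  proof (rule nn_integral_mono)
    fix x assume "x \<in> space \<mu>"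
    have "(\<integral>\<^sup>+t. indicator D t \<partial>count_space (range x)) = (\<integral>\<^sup>+t. indicator D t * indicator (range x) t \<partial>count_space UNIV)"
      by (rule nn_integral_count_space_indicator) auto
    also have "\<dots> = (\<integral>\<^sup>+t. indicator (range x \<inter> D) t \<partial>count_space UNIV)"
      by (rule nn_integral_cong) (auto simp: indicator_def)
    also have "\<dots> = emeasure (count_space UNIV) (range x \<inter> D)" by (rule nn_integral_indicator) auto
    also have "\<dots> \<le> liminf (\<lambda>n. N n (range x))"
      unfolding N_def Int_assoc[symmetric] using D01 by (intro card_cells_liminf) auto
    finally show "(\<integral>\<^sup>+t. indicator D t \<partial>count_space (range x)) \<le> liminf (\<lambda>n. N n (range x))" .
  qed
  also have "\<dots> \<le> liminf (\<lambda>n. \<integral>\<^sup>+x. N n (range x) \<partial>\<mu>)"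
    using N_meas by (intro nn_integral_liminf) (simp add: measurable_mu)
  also have "\<dots> \<le> ennreal (- ln ?p)"
    using bound by (intro Liminf_le) (auto simp: eventually_sequentially)
  finally show ?thesis .
qed
end

section \<open>The hitting dichotomy, for fixed sets and for sets depending on points\<close>

lemma ident_distr_rcs_sym:
  assumes "ident_distr_rcs \<mu> \<nu>" shows "ident_distr_rcs \<nu> \<mu>"
proof -
  from assms obtain P where P: "prob_space P" "sets P = sets (seqsp \<Otimes>\<^sub>M seqsp)"
    "distr P seqsp fst = \<mu>" "distr P seqsp snd = \<nu>" "AE z in P. range (fst z) = range (snd z)"
    unfolding ident_distr_rcs_def by blast
  let ?sw = "\<lambda>z. (snd z, fst z)"
  have [measurable]: "fst \<in> measurable P seqsp" "snd \<in> measurable P seqsp"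
    by (simp_all add: measurable_cong_sets[OF P(2) refl])
  have sw: "?sw \<in> measurable P (seqsp \<Otimes>\<^sub>M seqsp)" by measurable
  have "AE z in distr P (seqsp \<Otimes>\<^sub>M seqsp) ?sw. range (fst z) = range (snd z)"
  proof (subst AE_distr_iff[OF sw])
    \<comment> \<open>Equality of ranges in terms of countable quantifiers over coordinates, which
      makes it a measurable event.\<close>
    have eq: "(range (fst z) = range (snd z)) \<longleftrightarrow> (\<forall>i. \<exists>j. fst z i = snd z j) \<and> (\<forall>j. \<exists>i. snd z j = fst z i)"
      for z :: "(nat \<Rightarrow> real) \<times> (nat \<Rightarrow> real)"
      by (auto simp: set_eq_iff image_iff)
    have [measurable]: "(\<lambda>z. fst z i) \<in> borel_measurable (seqsp \<Otimes>\<^sub>M seqsp)"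
      "(\<lambda>z. snd z i) \<in> borel_measurable (seqsp \<Otimes>\<^sub>M seqsp)" for i
      by (rule measurable_compose[OF _ measurable_seqsp_nth], simp)+
    show "{z \<in> space (seqsp \<Otimes>\<^sub>M seqsp). range (fst z) = range (snd z)} \<in> sets (seqsp \<Otimes>\<^sub>M seqsp)"
      unfolding eq by measurable
  qed (use P(5) in auto)
  then show ?thesis
    unfolding ident_distr_rcs_def
    using prob_space.prob_space_distr[OF P(1) sw]
    by (intro exI[of _ "distr P (seqsp \<Otimes>\<^sub>M seqsp) ?sw"])
      (simp add: distr_distr[OF _ sw] comp_def P(3,4))
qed

definition U01 :: "real measure" where "U01 = density lborel (indicator {0<..<1})"

lemma sets_U01 [simp, measurable_cong]: "sets U01 = sets borel" by (simp add: U01_def)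
lemma space_U01 [simp]: "space U01 = UNIV" by (simp add: U01_def)

lemma emeasure_U01: "D \<in> sets borel \<Longrightarrow> emeasure U01 D = emeasure lborel (D \<inter> {0<..<1})"
proof -
  assume D: "D \<in> sets borel"
  have "(\<lambda>t. indicator {0<..<1} t * indicator D t) = (indicator (D \<inter> {0<..<1}) :: real \<Rightarrow> ennreal)"
    by (auto simp: indicator_def)
  then show ?thesis using D unfolding U01_def by (simp add: emeasure_density)
qed

lemma prob_space_U01: "prob_space U01"
proof (rule prob_spaceI)
  have "emeasure U01 UNIV = emeasure lborel (UNIV \<inter> {0<..<1::real})" by (rule emeasure_U01) simp
  then show "emeasure U01 (space U01) = 1" unfolding space_U01 by simp
qed

interpretation U01: prob_space U01 by (rule prob_space_U01)

context rcs begin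

text \<open>The right side of the equivalence is constant in x. In this form both halves of the
  dichotomy pass together through couplings and Fubini.\<close>

lemma hit_iff:
  assumes D [measurable]: "D \<in> sets borel"
  shows "AE x in \<mu>. range x \<inter> D \<noteq> {} \<longleftrightarrow> emeasure U01 D \<noteq> 0"
proof -
  \<comment> \<open>The intensity is only controlled at a positive distance from 0 and 1, so (0,1)
    is exhausted by the intervals \<open>I m\<close>. With the 3 in the denominator
    \<open>e m\<close> stays below 1/2 and below \<open>inverse (real (Suc m))\<close>.\<close>
  define e where "e m = 1 / (real m + 3)" for m :: nat
  define I where "I m = {e m<..<1 - e m}" for m
  have d: "0 < e m" "D \<inter> I m \<subseteq> {e m<..<1 - e m}" for m
    by (auto simp: I_def e_def)
  have I01: "I m \<subseteq> {0<..<1}" for m using d(1)[of m] by (auto simp: I_def)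
  have UN: "D \<inter> {0<..<1} = (\<Union>m. D \<inter> I m)"
  proof (intro equalityI subsetI)
    fix t assume t: "t \<in> D \<inter> {0<..<1}"
    then obtain m where "inverse (real (Suc m)) < min t (1 - t)"
      using reals_Archimedean[of "min t (1 - t)"] by auto
    moreover have "e m < inverse (real (Suc m))" by (simp add: e_def field_simps)
    ultimately have "t \<in> I m" by (auto simp: I_def)
    with t show "t \<in> (\<Union>m. D \<inter> I m)" by blast
  qed (use I01 in blast)
  have [measurable]: "I m \<in> sets borel" for m by (simp add: I_def)
  have ran: "range x \<inter> D = range x \<inter> (D \<inter> {0<..<1})" if "x \<in> space \<mu>" for x
    using that by (auto simp: space_mu)
  show ?thesis
  proof (cases "emeasure U01 D = 0")
    case True
    then have "emeasure lborel (D \<inter> I m) = 0" for m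
      using I01[of m] emeasure_mono[of "D \<inter> I m" "D \<inter> {0<..<1}" lborel] by (auto simp: emeasure_U01)
    then have "AE x in \<mu>. range x \<inter> (D \<inter> I m) = {}" for m by (intro hit_null[OF _ d]) auto
    then have "AE x in \<mu>. \<forall>m. range x \<inter> (D \<inter> I m) = {}" by (simp add: AE_all_countable)
    then show ?thesis using AE_space
      by eventually_elim (use True UN ran in auto)
  next
    case False
    then have "emeasure lborel (\<Union>m. D \<inter> I m) \<noteq> 0" by (simp add: emeasure_U01 UN)
    then obtain m where m: "emeasure lborel (D \<inter> I m) \<noteq> 0"
    proof (rule contrapos_np)
      assume "\<not> thesis"
      with that have "emeasure lborel (D \<inter> I m) = 0" for m by blast
      then show "emeasure lborel (\<Union>m. D \<inter> I m) = 0" by (intro emeasure_UN_eq_0) auto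
    qed
    then have "intensity (indicator (D \<inter> I m)) = \<infinity>"
      using intensity_null_or_infinite[OF _ d(1) d(2), of m] by simp
    moreover have "D \<inter> I m \<subseteq> {0<..<1}" using I01 by blast
    ultimately have "measure \<mu> {x\<in>space \<mu>. range x \<inter> (D \<inter> I m) = {}} = 0"
      using intensity_le_ln_miss[of "D \<inter> I m"] by (auto simp: zero_less_measure_iff top_unique)
    moreover have "{x\<in>space \<mu>. range x \<inter> (D \<inter> I m) = {}} \<in> sets \<mu>"
      using miss_measurable[of "D \<inter> I m"] by (simp add: pred_def sets_mu sets_eq_imp_space_eq[OF sets_mu])
    ultimately have "AE x in \<mu>. range x \<inter> (D \<inter> I m) \<noteq> {}"
      by (subst AE_iff_measurable[OF _ refl]) (simp_all add: mu.emeasure_eq_measure)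
    then show ?thesis by eventually_elim (use False in auto)
  qed
qed

end

lemma ex_list_PiE:
  assumes "s \<in> PiE {..<n} (\<lambda>_. f ` UNIV)"
  shows "\<exists>\<kappa>. length \<kappa> = n \<and> s = (\<lambda>l\<in>{..<n}. f (\<kappa> ! l))"
proof -
  have "\<forall>l<n. \<exists>k. s l = f k" using assms by (auto simp: PiE_def Pi_def)
  then obtain k where k: "\<And>l. l < n \<Longrightarrow> s l = f (k l)" by metis
  have "s = (\<lambda>l\<in>{..<n}. f (map k [0..<n] ! l))"
    using assms k by (auto simp: PiE_def extensional_def fun_eq_iff)
  then show ?thesis by (intro exI[of _ "map k [0..<n]"]) simp
qed

text \<open>The tuples of points form a family that varies with the sequence. Naming them by lists
  of positions gives a fixed countable index set, as needed for measurability and for combining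
  almost sure statements.\<close>

lemma PiE_range_iff:
  fixes f :: "nat \<Rightarrow> 'a"
  shows "(\<forall>s\<in>PiE {..<n} (\<lambda>_. range f). P s) \<longleftrightarrow> (\<forall>\<kappa>. length \<kappa> = n \<longrightarrow> P (\<lambda>l\<in>{..<n}. f (\<kappa> ! l)))"
proof (intro iffI allI impI ballI)
  fix \<kappa> :: "nat list" assume "\<forall>s\<in>PiE {..<n} (\<lambda>_. range f). P s" "length \<kappa> = n"
  then show "P (\<lambda>l\<in>{..<n}. f (\<kappa> ! l))" by (elim bspec) simp
next
  fix s assume *: "\<forall>\<kappa>. length \<kappa> = n \<longrightarrow> P (\<lambda>l\<in>{..<n}. f (\<kappa> ! l))" and "s \<in> PiE {..<n} (\<lambda>_. range f)"
  with ex_list_PiE[OF this(2)] show "P s" by blast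
qed

lemma measurable_emeasure_section:
  assumes "B \<in> sets (N \<Otimes>\<^sub>M borel)" "f \<in> measurable M N"
  shows "(\<lambda>w. emeasure U01 {t. (f w, t) \<in> B}) \<in> borel_measurable M"
proof -
  have "sets (N \<Otimes>\<^sub>M borel) = sets (N \<Otimes>\<^sub>M U01)" by (rule sets_pair_measure_cong) simp_all
  then have "(\<lambda>s. emeasure U01 (Pair s -` B)) \<in> borel_measurable N"
    using assms(1) by (intro U01.measurable_emeasure_Pair) simp
  from measurable_compose[OF assms(2) this] show ?thesis unfolding vimage_def .
qed

lemma sections_measurable:
  assumes "B \<in> sets (N \<Otimes>\<^sub>M borel)" shows "{t. (s, t) \<in> B} \<in> sets borel"
  using sets_Pair1[OF assms, of s] unfolding vimage_def .

lemma bex_range: "(\<exists>t\<in>range f. P t) \<longleftrightarrow> (\<exists>k. P (f k))"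
  by blast

context rcs begin

text \<open>If sections of \<open>B\<close> avoid the cells of the given points, they only see fragments that are independent of
  these points, so that Fubini reduces the claim to a fixed set.\<close>

lemma hit_separated:
  fixes n m :: nat
  assumes m: "m \<ge> 2" and B [measurable]: "B \<in> sets (PiM {..<n} (\<lambda>_. borel) \<Otimes>\<^sub>M borel)"
    and sep: "\<And>s t i l. (s, t) \<in> B \<Longrightarrow> l < n \<Longrightarrow> s l \<in> cell m i \<Longrightarrow> t \<notin> cell m i"
  shows "AE x in \<mu>. \<forall>s\<in>PiE {..<n} (\<lambda>_. range x).
      (\<exists>t\<in>range x. (s, t) \<in> B) \<longleftrightarrow> emeasure U01 {t. (s, t) \<in> B} \<noteq> 0"
proof -
  let ?N = "PiM {..<n} (\<lambda>_. borel :: real measure)"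
  obtain R where R: "\<And>i. prob_space (R i)" "\<And>i. sets (R i) = sets seqsp"
    "\<And>i. i \<in> {1..m} \<Longrightarrow> AE z in R i. \<forall>j. z j \<in> cell m i"
    "ident_distr_rcs (distr (PiM {1..m} R) seqsp (\<lambda>y k. y (1 + k mod m) (k div m))) \<mu>"
    using fragments[OF m] by blast
  interpret R: product_prob_space R
    using R(1) by (simp add: product_prob_space_def product_sigma_finite_def
      product_prob_space_axioms_def prob_space_imp_sigma_finite)
  let ?Q = "PiM {1..m} R" and ?E = "\<lambda>(y::nat \<Rightarrow> nat \<Rightarrow> real) k. y (1 + k mod m) (k div m)"
  have comp: "(\<lambda>y. y i) \<in> measurable (PiM I R) seqsp" if "i \<in> I" for i I
    using measurable_component_singleton[OF that, of R] by (simp add: measurable_cong_sets[OF refl R(2)])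
  have comp2: "(\<lambda>y. y i j) \<in> borel_measurable (PiM I R)" if "i \<in> I" for i j I
    by (rule measurable_compose[OF comp[OF that] measurable_seqsp_nth])
  have k_in: "1 + k mod m \<in> {1..m}" for k using m by (simp add: Suc_le_eq)
  have E: "?E \<in> measurable ?Q seqsp"
  proof (rule measurable_into_seqsp)
    show "(\<lambda>y. y (1 + k mod m) (k div m)) \<in> borel_measurable ?Q" for k
      by (rule comp2[OF k_in])
    show "y (1 + k mod m) (k div m) \<in> {0<..<1}" if "y \<in> space ?Q" for y k
      using measurable_space[OF comp[OF k_in] that] by (simp add: space_seqsp)
  qed
  have ran: "range (?E y) = (\<Union>i\<in>{1..m}. range (y i))" for y using m by (intro range_enum) simp
  have selE: "(\<lambda>x. \<lambda>l\<in>{..<n}. x (\<kappa> ! l)) \<in> measurable seqsp ?N" for \<kappa>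
    by (rule measurable_restrict) simp
  \<comment> \<open>For a general measure space, since it is applied both on the product of the
    fragments and on the sequence space.\<close>
  have hitm: "Measurable.pred M (\<lambda>w. (\<exists>j. (f w, g w j) \<in> B) \<longleftrightarrow> emeasure U01 {t. (f w, t) \<in> B} \<noteq> 0)"
    if [measurable]: "f \<in> measurable M ?N" "\<And>j. (\<lambda>w. g w j) \<in> borel_measurable M" for M :: "'z measure" and f and g :: "'z \<Rightarrow> nat \<Rightarrow> real"
  proof -
    have "(\<lambda>w. (f w, g w j)) \<in> measurable M (?N \<Otimes>\<^sub>M borel)" for j by measurable
    then have "Measurable.pred M (\<lambda>w. (f w, g w j) \<in> B)" for j
      by (rule pred_sets2[OF B])
    then have p1: "Measurable.pred M (\<lambda>w. \<exists>j. (f w, g w j) \<in> B)"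
      by (intro pred_intros_countable)
    have "(\<lambda>w. emeasure U01 {t. (f w, t) \<in> B}) \<in> borel_measurable M"
      by (rule measurable_emeasure_section[OF B that(1)])
    then have p2: "Measurable.pred M (\<lambda>w. emeasure U01 {t. (f w, t) \<in> B} \<noteq> 0)"
      by simp
    show ?thesis using p1 p2 by (rule pred_intros_logic)
  qed
  have one: "AE y in ?Q. (\<exists>t\<in>(\<Union>i\<in>{1..m}. range (y i)). (s y, t) \<in> B) \<longleftrightarrow> emeasure U01 {t. (s y, t) \<in> B} \<noteq> 0"
    if s_def: "s = (\<lambda>y. \<lambda>l\<in>{..<n}. y (1 + (\<kappa> ! l) mod m) ((\<kappa> ! l) div m))" for s \<kappa>
  proof -
    \<comment> \<open>Position k of the joint enumeration belongs to fragment
      \<open>1 + k mod m\<close>. So J consists of the fragments from which s takes its points, and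
      K of all others.\<close>
    define J where "J = (\<lambda>l. 1 + (\<kappa> ! l) mod m) ` {..<n}"
    define K where "K = {1..m} - J"
    have J: "J \<subseteq> {1..m}" "finite J" using k_in by (auto simp: J_def)
    have JK: "J \<inter> K = {}" "J \<union> K = {1..m}" "finite K" using J by (auto simp: K_def)
    have merge: "distr (PiM J R \<Otimes>\<^sub>M PiM K R) ?Q (merge J K) = ?Q"
      using R.distr_merge[OF JK(1) J(2) JK(3)] by (simp only: JK(2))
    have merge_meas: "merge J K \<in> measurable (PiM J R \<Otimes>\<^sub>M PiM K R) ?Q"
      using measurable_merge[of J K R] by (simp only: JK(2))
    interpret PJ: prob_space "PiM J R" by (rule prob_space_PiM) (rule R(1))
    interpret PK: prob_space "PiM K R" by (rule prob_space_PiM) (rule R(1))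
    interpret PJK: pair_sigma_finite "PiM J R" "PiM K R" by unfold_locales
    have s_meas: "s \<in> measurable ?Q ?N" unfolding s_def
      by (intro measurable_restrict comp2 k_in)
    have s_J: "s (merge J K (v, w)) = s v" for v w
      unfolding s_def by (rule restrict_ext) (auto simp: merge_def J_def)
    have AEJ: "AE v in PiM J R. \<forall>i\<in>J. \<forall>j. v i j \<in> cell m i"
      using R(1,3) J by (intro AE_finite_allI AE_PiM_component) auto
    have "AE z in PiM J R \<Otimes>\<^sub>M PiM K R. (\<exists>t\<in>(\<Union>i\<in>{1..m}. range (merge J K z i)). (s (merge J K z), t) \<in> B)
          \<longleftrightarrow> emeasure U01 {t. (s (merge J K z), t) \<in> B} \<noteq> 0"
    proof (rule PJK.AE_pair_measure)
      have "Measurable.pred ?Q (\<lambda>y. (\<exists>k. (s y, ?E y k) \<in> B) \<longleftrightarrow> emeasure U01 {t. (s y, t) \<in> B} \<noteq> 0)"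
        using s_meas comp2[OF k_in] by (intro hitm) auto
      then have "Measurable.pred ?Q (\<lambda>y. (\<exists>t\<in>range (?E y). (s y, t) \<in> B) \<longleftrightarrow> emeasure U01 {t. (s y, t) \<in> B} \<noteq> 0)"
        by (simp only: bex_range)
      from measurable_compose[OF merge_meas this]
      show "{z \<in> space (PiM J R \<Otimes>\<^sub>M PiM K R).
          (\<exists>t\<in>(\<Union>i\<in>{1..m}. range (merge J K z i)). (s (merge J K z), t) \<in> B)
          \<longleftrightarrow> emeasure U01 {t. (s (merge J K z), t) \<in> B} \<noteq> 0} \<in> sets (PiM J R \<Otimes>\<^sub>M PiM K R)"
        unfolding ran pred_def .
      show "AE v in PiM J R. AE w in PiM K R.
          (\<exists>t\<in>(\<Union>i\<in>{1..m}. range (merge J K (v, w) i)). (s (merge J K (v, w)), t) \<in> B)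
          \<longleftrightarrow> emeasure U01 {t. (s (merge J K (v, w)), t) \<in> B} \<noteq> 0"
        using AEJ
      proof eventually_elim
        case (elim v)
        define D where "D = {t. (s v, t) \<in> B}"
        have D [measurable]: "D \<in> sets borel" unfolding D_def by (rule sections_measurable[OF B])
        have avoid: "v' i j \<notin> D" if i: "i \<in> J" and v': "\<And>j. v' i j \<in> cell m i" for v' i j
        proof -
          from i obtain l where l: "l < n" "i = 1 + (\<kappa> ! l) mod m" by (auto simp: J_def)
          then have "s v l \<in> cell m i" using elim i by (auto simp: s_def)
          then show ?thesis using sep[of "s v" "v' i j" l i] l v' by (auto simp: D_def)
        qed
        have split: "(\<exists>t\<in>(\<Union>i\<in>{1..m}. range (merge J K (v', w) i)). t \<in> D) \<longleftrightarrow> (\<exists>i\<in>K. \<exists>j. w i j \<in> D)"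
          if "\<forall>i\<in>J. \<forall>j. v' i j \<in> cell m i" for v' w
        proof -
          have "(\<exists>t\<in>(\<Union>i\<in>{1..m}. range (merge J K (v', w) i)). t \<in> D)
            \<longleftrightarrow> (\<exists>i\<in>J. \<exists>j. v' i j \<in> D) \<or> (\<exists>i\<in>K. \<exists>j. w i j \<in> D)"
          proof -
            have "merge J K (v', w) i = v' i" if "i \<in> J" for i using that by (simp add: merge_def)
            moreover have "merge J K (v', w) i = w i" if "i \<in> K" for i using that JK(1) by (auto simp: merge_def)
            moreover have "(\<exists>t\<in>(\<Union>i\<in>J \<union> K. range (merge J K (v', w) i)). t \<in> D)
              \<longleftrightarrow> (\<exists>i\<in>J. \<exists>j. merge J K (v', w) i j \<in> D) \<or> (\<exists>i\<in>K. \<exists>j. merge J K (v', w) i j \<in> D)" by blast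
            ultimately show ?thesis unfolding JK(2)[symmetric] by (simp cong: bex_cong)
          qed
          then show ?thesis using avoid[of _ v'] that by blast
        qed
        \<comment> \<open>With v frozen, D is a fixed Borel set: the dichotomy holds for it under
          \<open>\<mu>\<close>, hence for the union of the fragments.\<close>
        have "AE x in distr ?Q seqsp ?E. range x \<inter> D \<noteq> {} \<longleftrightarrow> emeasure U01 D \<noteq> 0"
        proof (rule ident_distr_rcs_AE[where \<phi>="\<lambda>S. S \<inter> D \<noteq> {} \<longleftrightarrow> emeasure U01 D \<noteq> 0"])
          show "ident_distr_rcs \<mu> (distr ?Q seqsp ?E)" by (rule ident_distr_rcs_sym[OF R(4)])
          show "AE x in \<mu>. range x \<inter> D \<noteq> {} \<longleftrightarrow> emeasure U01 D \<noteq> 0" by (rule hit_iff[OF D])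
          show "Measurable.pred seqsp (\<lambda>x. range x \<inter> D \<noteq> {} \<longleftrightarrow> emeasure U01 D \<noteq> 0)"
            by measurable
        qed
        then have "AE y in ?Q. range (?E y) \<inter> D \<noteq> {} \<longleftrightarrow> emeasure U01 D \<noteq> 0"
          by (rule AE_distrD[OF E])
        then have "AE y in distr (PiM J R \<Otimes>\<^sub>M PiM K R) ?Q (merge J K).
            (\<exists>t\<in>(\<Union>i\<in>{1..m}. range (y i)). t \<in> D) \<longleftrightarrow> emeasure U01 D \<noteq> 0"
          unfolding ran merge by eventually_elim blast
        then have "AE z in PiM J R \<Otimes>\<^sub>M PiM K R.
            (\<exists>t\<in>(\<Union>i\<in>{1..m}. range (merge J K z i)). t \<in> D) \<longleftrightarrow> emeasure U01 D \<noteq> 0"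
          by (rule AE_distrD[OF merge_meas])
        \<comment> \<open>Here v' is a second copy of the J-coordinates, while D still belongs to v.
          Almost every v' stays in the cells of J, which D avoids, so the statement reduces to one
          about w alone. Being constant in v', it holds outright, and then in particular together
          with the original v.\<close>
        from PJK.AE_pair[OF this] AEJ
        have "AE v' in PiM J R. AE w in PiM K R. (\<exists>i\<in>K. \<exists>j. w i j \<in> D) \<longleftrightarrow> emeasure U01 D \<noteq> 0"
          by eventually_elim (simp only: split)
        then have "AE w in PiM K R. (\<exists>i\<in>K. \<exists>j. w i j \<in> D) \<longleftrightarrow> emeasure U01 D \<noteq> 0"
          by (simp only: PJ.AE_const)
        then show ?case
          by eventually_elim (simp only: s_J D_def mem_Collect_eq split[OF elim, unfolded D_def mem_Collect_eq])
      qed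
    qed
    then have "AE y in distr (PiM J R \<Otimes>\<^sub>M PiM K R) ?Q (merge J K).
       (\<exists>k. (s y, ?E y k) \<in> B) \<longleftrightarrow> emeasure U01 {t. (s y, t) \<in> B} \<noteq> 0"
    proof (subst AE_distr_iff[OF merge_meas])
      show "{y \<in> space ?Q. (\<exists>k. (s y, ?E y k) \<in> B) \<longleftrightarrow> emeasure U01 {t. (s y, t) \<in> B} \<noteq> 0} \<in> sets ?Q"
        unfolding pred_def[symmetric] using s_meas comp2[OF k_in] by (intro hitm) auto
    qed (simp only: ran[symmetric] bex_range)
    then show ?thesis unfolding merge ran[symmetric] by simp
  qed
  have "AE x in distr ?Q seqsp ?E. \<forall>s\<in>PiE {..<n} (\<lambda>_. range x).
      (\<exists>t\<in>range x. (s, t) \<in> B) \<longleftrightarrow> emeasure U01 {t. (s, t) \<in> B} \<noteq> 0"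
  proof -
    have "AE x in distr ?Q seqsp ?E. (\<exists>j. ((\<lambda>l\<in>{..<n}. x (\<kappa> ! l)), x j) \<in> B)
       \<longleftrightarrow> emeasure U01 {t. ((\<lambda>l\<in>{..<n}. x (\<kappa> ! l)), t) \<in> B} \<noteq> 0" for \<kappa>
    proof (subst AE_distr_iff[OF E])
      show "{x \<in> space seqsp. (\<exists>j. ((\<lambda>l\<in>{..<n}. x (\<kappa> ! l)), x j) \<in> B)
       \<longleftrightarrow> emeasure U01 {t. ((\<lambda>l\<in>{..<n}. x (\<kappa> ! l)), t) \<in> B} \<noteq> 0} \<in> sets seqsp"
        unfolding pred_def[symmetric] by (intro hitm selE) simp
      show "AE y in ?Q. (\<exists>j. ((\<lambda>l\<in>{..<n}. ?E y (\<kappa> ! l)), ?E y j) \<in> B)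
       \<longleftrightarrow> emeasure U01 {t. ((\<lambda>l\<in>{..<n}. ?E y (\<kappa> ! l)), t) \<in> B} \<noteq> 0"
        using one[OF refl, of \<kappa>] unfolding ran[symmetric] by simp
    qed
    then show ?thesis unfolding PiE_range_iff AE_all_countable by simp
  qed
  then show ?thesis
  proof (rule ident_distr_rcs_AE[OF R(4), where \<phi>="\<lambda>S. \<forall>s\<in>PiE {..<n} (\<lambda>_. S).
      (\<exists>t\<in>S. (s, t) \<in> B) \<longleftrightarrow> emeasure U01 {t. (s, t) \<in> B} \<noteq> 0"])
    have "Measurable.pred seqsp (\<lambda>x. \<forall>\<kappa>. length \<kappa> = n \<longrightarrow> ((\<exists>j. ((\<lambda>l\<in>{..<n}. x (\<kappa> ! l)), x j) \<in> B)
       \<longleftrightarrow> emeasure U01 {t. ((\<lambda>l\<in>{..<n}. x (\<kappa> ! l)), t) \<in> B} \<noteq> 0))"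
    proof (rule pred_intros_countable)
      fix \<kappa> :: "nat list"
      have "Measurable.pred seqsp (\<lambda>x. (\<exists>j. ((\<lambda>l\<in>{..<n}. x (\<kappa> ! l)), x j) \<in> B)
       \<longleftrightarrow> emeasure U01 {t. ((\<lambda>l\<in>{..<n}. x (\<kappa> ! l)), t) \<in> B} \<noteq> 0)"
        by (intro hitm selE) simp
      then show "Measurable.pred seqsp (\<lambda>x. length \<kappa> = n \<longrightarrow> ((\<exists>j. ((\<lambda>l\<in>{..<n}. x (\<kappa> ! l)), x j) \<in> B)
       \<longleftrightarrow> emeasure U01 {t. ((\<lambda>l\<in>{..<n}. x (\<kappa> ! l)), t) \<in> B} \<noteq> 0))"
        by (cases "length \<kappa> = n") simp_all
    qed
    then show "Measurable.pred seqsp (\<lambda>x. \<forall>s\<in>PiE {..<n} (\<lambda>_. range x).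
      (\<exists>t\<in>range x. (s, t) \<in> B) \<longleftrightarrow> emeasure U01 {t. (s, t) \<in> B} \<noteq> 0)"
      unfolding PiE_range_iff by simp
  qed
qed

end

context rcs begin

text \<open>Separation is removed by refinement: a point t different from the finitely many s l is
  in another cell than each of them once the partition is fine enough. So the separated pieces of B
  exhaust its part with fresh t, and deleting the values of s from a section does not change its
  measure, finite sets being null.\<close>

lemma hit_fresh:
  fixes n :: nat
  assumes B [measurable]: "B \<in> sets (PiM {..<n} (\<lambda>_. borel) \<Otimes>\<^sub>M borel)"
  shows "AE x in \<mu>. \<forall>s\<in>PiE {..<n} (\<lambda>_. range x).
      (\<exists>t\<in>range x. t \<notin> s ` {..<n} \<and> (s, t) \<in> B) \<longleftrightarrow> emeasure U01 {t. (s, t) \<in> B} \<noteq> 0"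
proof -
  let ?N = "PiM {..<n} (\<lambda>_. borel :: real measure)"
  \<comment> \<open>Different floors of m * t and m * s l mean different cells. The floors are
    compared as reals so that Borel measurability applies, and m + 2 is used afterwards because
    \<open>hit_separated\<close> starts at two cells.\<close>
  define C where "C m = {z \<in> space (?N \<Otimes>\<^sub>M borel). z \<in> B \<and> (\<forall>l\<in>{..<n}. real_of_int \<lfloor>real m * fst z l\<rfloor> \<noteq> real_of_int \<lfloor>real m * snd z\<rfloor>)}" for m
  have C_meas: "C m \<in> sets (?N \<Otimes>\<^sub>M borel)" for m
  proof -
    have "Measurable.pred (?N \<Otimes>\<^sub>M borel) (\<lambda>z. real_of_int \<lfloor>real m * fst z l\<rfloor> \<noteq> real_of_int \<lfloor>real m * snd z\<rfloor>)"
      if "l \<in> {..<n}" for l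
    proof -
      have fst: "(\<lambda>z. fst z l) \<in> borel_measurable (?N \<Otimes>\<^sub>M (borel :: real measure))"
        using that by (intro measurable_compose[OF measurable_fst] measurable_component_singleton) simp
      have "(\<lambda>t. real_of_int \<lfloor>real m * t\<rfloor>) \<in> borel_measurable borel"
        by (rule measurable_compose[OF _ borel_measurable_real_floor]) simp
      from measurable_compose[OF fst this] measurable_compose[OF measurable_snd this]
      show ?thesis unfolding pred_def by (rule borel_measurable_neq)
    qed
    moreover have "Measurable.pred (?N \<Otimes>\<^sub>M borel) (\<lambda>z. z \<in> B)"
      using B sets.sets_into_space[OF B] by (simp add: pred_def Collect_conj_eq Int_absorb1)
    ultimately have "Measurable.pred (?N \<Otimes>\<^sub>M borel)
        (\<lambda>z. z \<in> B \<and> (\<forall>l\<in>{..<n}. real_of_int \<lfloor>real m * fst z l\<rfloor> \<noteq> real_of_int \<lfloor>real m * snd z\<rfloor>))"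
      by (intro pred_intros_logic(3) pred_intros_finite(3)) auto
    then show ?thesis unfolding C_def pred_def .
  qed
  have C_sep: "t \<notin> cell (m + 2) i" if "(s, t) \<in> C (m + 2)" "l < n" "s l \<in> cell (m + 2) i" for s t i l m
  proof
    assume "t \<in> cell (m + 2) i"
    then have "\<lfloor>real (m + 2) * t\<rfloor> = int i - 1" "\<lfloor>real (m + 2) * s l\<rfloor> = int i - 1"
      unfolding floor_eq_iff using that(3) by (auto simp: cell_def field_simps)
    with that show False by (auto simp: C_def)
  qed
  have C_UN: "(\<exists>m. (s, t) \<in> C (m + 2)) \<longleftrightarrow> t \<notin> s ` {..<n} \<and> (s, t) \<in> B" if "s \<in> space ?N" for s t
  proof
    assume R: "t \<notin> s ` {..<n} \<and> (s, t) \<in> B"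
    have "\<forall>\<^sub>F m in sequentially. \<lfloor>real (m + 2) * s l\<rfloor> \<noteq> \<lfloor>real (m + 2) * t\<rfloor>" if "l < n" for l
    proof -
      have "s l \<noteq> t" using R that by auto
      then have "filterlim (\<lambda>m. \<bar>s l - t\<bar> * real m) at_top sequentially"
        by (intro filterlim_tendsto_pos_mult_at_top[OF tendsto_const] filterlim_real_sequentially) simp
      then have "\<forall>\<^sub>F m in sequentially. \<bar>s l - t\<bar> * real m > 1" by (simp add: filterlim_at_top_dense)
      then show ?thesis
      proof eventually_elim
        case (elim m)
        have "\<bar>s l - t\<bar> * real m \<le> \<bar>s l - t\<bar> * real (m + 2)" by (intro mult_left_mono) auto
        also have "\<dots> = \<bar>real (m + 2) * s l - real (m + 2) * t\<bar>"
        proof -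
          have "real (m + 2) * s l - real (m + 2) * t = (s l - t) * real (m + 2)"
            by (simp only: left_diff_distrib mult.commute)
          then show ?thesis by (simp only: abs_mult abs_of_nat)
        qed
        finally have "1 < \<bar>real (m + 2) * s l - real (m + 2) * t\<bar>" using elim by simp
        then show ?case by linarith
      qed
    qed
    then have "\<forall>\<^sub>F m in sequentially. \<forall>l\<in>{..<n}. \<lfloor>real (m + 2) * s l\<rfloor> \<noteq> \<lfloor>real (m + 2) * t\<rfloor>"
      by (intro eventually_ball_finite) auto
    then obtain m where "\<forall>l\<in>{..<n}. \<lfloor>real (m + 2) * s l\<rfloor> \<noteq> \<lfloor>real (m + 2) * t\<rfloor>"
      by (auto simp: eventually_sequentially)
    then have "(s, t) \<in> C (m + 2)" using R that by (auto simp: C_def space_pair_measure)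
    then show "\<exists>m. (s, t) \<in> C (m + 2)" ..
  qed (auto simp: C_def)
  have "AE x in \<mu>. \<forall>m. \<forall>s\<in>PiE {..<n} (\<lambda>_. range x).
      (\<exists>t\<in>range x. (s, t) \<in> C (m + 2)) \<longleftrightarrow> emeasure U01 {t. (s, t) \<in> C (m + 2)} \<noteq> 0"
    unfolding AE_all_countable
  proof
    fix m show "AE x in \<mu>. \<forall>s\<in>PiE {..<n} (\<lambda>_. range x).
      (\<exists>t\<in>range x. (s, t) \<in> C (m + 2)) \<longleftrightarrow> emeasure U01 {t. (s, t) \<in> C (m + 2)} \<noteq> 0"
      by (rule hit_separated[of "m + 2"]) (use C_meas C_sep in auto)
  qed
  then show ?thesis
  proof eventually_elim
    case (elim x)
    show ?case
    proof
      fix s assume s: "s \<in> PiE {..<n} (\<lambda>_. range x)"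
      then have sN: "s \<in> space ?N" by (auto simp: space_PiM PiE_def)
      have sec: "{t. (s, t) \<in> C m} \<in> sets U01" for m using sections_measurable[OF C_meas] by simp
      have secB: "{t. (s, t) \<in> B} \<in> sets U01" using sections_measurable[OF B] by simp
      have "(\<exists>t\<in>range x. t \<notin> s ` {..<n} \<and> (s, t) \<in> B) \<longleftrightarrow> (\<exists>m. \<exists>t\<in>range x. (s, t) \<in> C (m + 2))"
        using C_UN[OF sN] by blast
      also have "\<dots> \<longleftrightarrow> (\<exists>m. emeasure U01 {t. (s, t) \<in> C (m + 2)} \<noteq> 0)" using elim s by blast
      also have "\<dots> \<longleftrightarrow> emeasure U01 (\<Union>m. {t. (s, t) \<in> C (m + 2)}) \<noteq> 0"
        using sec emeasure_UN_eq_0[of U01 "\<lambda>m. {t. (s, t) \<in> C (m + 2)}"]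
          emeasure_mono[of "{t. (s, t) \<in> C (m + 2)}" "\<Union>m. {t. (s, t) \<in> C (m + 2)}" U01 for m]
        by (auto simp: emeasure_eq_0) (metis UN_upper UNIV_I emeasure_eq_0 sets.countable_UN' countableI_type)
      also have "(\<Union>m. {t. (s, t) \<in> C (m + 2)}) = {t. (s, t) \<in> B} - s ` {..<n}"
        using C_UN[OF sN] by auto
      also have "emeasure U01 ({t. (s, t) \<in> B} - s ` {..<n}) = emeasure U01 {t. (s, t) \<in> B}"
      proof (rule emeasure_Diff_null_set)
        have "emeasure U01 (s ` {..<n}) \<le> emeasure lborel (s ` {..<n})"
          by (subst emeasure_U01) (auto intro!: emeasure_mono finite_imp_closed borel_closed)
        also have "\<dots> = 0" by (rule emeasure_lborel_countable) (simp add: countable_finite)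
        finally show "s ` {..<n} \<in> null_sets U01"
          by (auto simp: null_sets_def intro!: finite_imp_closed borel_closed)
      qed (rule secB)
      finally show "(\<exists>t\<in>range x. t \<notin> s ` {..<n} \<and> (s, t) \<in> B) \<longleftrightarrow> emeasure U01 {t. (s, t) \<in> B} \<noteq> 0" .
    qed
  qed
qed
end

section \<open>Greedy randomised selection of a point with prescribed conditional law\<close>

text \<open>Here \<open>q\<close> is the conditional probability that no candidate has been accepted so far, and \<open>r\<close> is the part of
  the target density that remains to be covered; the next candidate is accepted with the largest
  conditional probability that keeps the covered part below the target.\<close>

lemma greedy_step:
  fixes W :: "'w measure" and L :: "'z measure" and Z :: "'w \<Rightarrow> 'z" and q :: "'w \<Rightarrow> real" and r :: "'z \<Rightarrow> real"
  assumes W: "prob_space W" and L: "prob_space L" and Z [measurable]: "Z \<in> measurable W L" and G [measurable]: "G \<in> sets W"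
    and q [measurable]: "q \<in> borel_measurable W" and q01: "\<And>\<omega>. 0 \<le> q \<omega> \<and> q \<omega> \<le> 1"
    and r [measurable]: "r \<in> borel_measurable L" and r01: "\<And>z. 0 \<le> r z \<and> r z \<le> 1"
    and ac: "\<And>B. B \<in> null_sets L \<Longrightarrow> AE \<omega> in W. \<omega> \<in> G \<longrightarrow> Z \<omega> \<notin> B"
  obtains q' r' where "q' \<in> borel_measurable W" "r' \<in> borel_measurable L"
    "\<And>\<omega>. 0 \<le> q' \<omega> \<and> q' \<omega> \<le> q \<omega>" "\<And>z. 0 \<le> r' z \<and> r' z \<le> r z"
    "\<And>\<omega>. \<omega> \<notin> G \<Longrightarrow> q' \<omega> = q \<omega>" "\<And>\<omega>. \<omega> \<in> G \<Longrightarrow> r' (Z \<omega>) \<noteq> 0 \<Longrightarrow> q' \<omega> = 0"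
    "\<And>A. A \<in> sets L \<Longrightarrow> (\<integral>\<^sup>+\<omega>. ennreal (q \<omega> - q' \<omega>) * indicator A (Z \<omega>) \<partial>W)
        = (\<integral>\<^sup>+z. ennreal (r z - r' z) * indicator A z \<partial>L)"
proof -
  interpret W: prob_space W by fact
  interpret L: prob_space L by fact
  \<comment> \<open>H weights each outcome by the probability that nothing has been accepted yet,
    restricted to G, where the current candidate is allowed. Its image \<open>\<nu>\<close> under Z
    is the law of what is on offer at this step, of total mass at most 1.\<close>
  define H where "H \<omega> = ennreal (q \<omega>) * indicator G \<omega>" for \<omega>
  have [measurable]: "H \<in> borel_measurable W" unfolding H_def by measurable
  define \<nu> where "\<nu> = distr (density W H) L Z"
  have Z' [measurable]: "Z \<in> measurable (density W H) L" by simp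
  have sets_\<nu>: "sets \<nu> = sets L" by (simp add: \<nu>_def)
  have int_\<nu>: "(\<integral>\<^sup>+z. f z \<partial>\<nu>) = (\<integral>\<^sup>+\<omega>. H \<omega> * f (Z \<omega>) \<partial>W)"
    if [measurable]: "f \<in> borel_measurable L" for f :: "'z \<Rightarrow> ennreal"
    unfolding \<nu>_def by (simp add: nn_integral_distr nn_integral_density)
  have fin: "finite_measure \<nu>"
  proof
    have "emeasure \<nu> (space \<nu>) = (\<integral>\<^sup>+z. 1 \<partial>\<nu>)" by simp
    also have "\<dots> = (\<integral>\<^sup>+\<omega>. H \<omega> \<partial>W)" using int_\<nu>[of "\<lambda>_. 1"] by simp
    also have "\<dots> \<le> (\<integral>\<^sup>+\<omega>. 1 \<partial>W)" unfolding H_def using q01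
      by (intro nn_integral_mono) (auto simp: indicator_def ennreal_le_1)
    finally show "emeasure \<nu> (space \<nu>) \<noteq> \<infinity>" by (auto simp: W.emeasure_space_1 top_unique)
  qed
  \<comment> \<open>Allowed candidates avoid null sets of L. This gives the offer a density D with
    respect to the target.\<close>
  have abs: "absolutely_continuous L \<nu>"
    unfolding absolutely_continuous_def
  proof
    fix B assume B: "B \<in> null_sets L"
    then have [measurable]: "B \<in> sets L" by auto
    have "emeasure \<nu> B = (\<integral>\<^sup>+z. indicator B z \<partial>\<nu>)" by (simp add: sets_\<nu>)
    also have "\<dots> = (\<integral>\<^sup>+\<omega>. H \<omega> * indicator B (Z \<omega>) \<partial>W)" by (rule int_\<nu>) simp
    also have "\<dots> = (\<integral>\<^sup>+\<omega>. 0 \<partial>W)"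
      using ac[OF B] by (intro nn_integral_cong_AE) (auto simp: H_def indicator_def)
    finally show "B \<in> null_sets \<nu>" by (simp add: null_sets_def sets_\<nu>)
  qed
  from L.real_RN_deriv[OF fin abs sets_\<nu>]
  obtain D where D [measurable]: "D \<in> borel_measurable L"
    and RN: "AE z in L. RN_deriv L \<nu> z = ennreal (D z)" and D0: "\<And>z. 0 \<le> D z" by blast
  have int_D: "(\<integral>\<^sup>+z. f z \<partial>\<nu>) = (\<integral>\<^sup>+z. ennreal (D z) * f z \<partial>L)"
    if [measurable]: "f \<in> borel_measurable L" for f :: "'z \<Rightarrow> ennreal"
  proof -
    have "(\<integral>\<^sup>+z. f z \<partial>\<nu>) = (\<integral>\<^sup>+z. f z \<partial>density L (RN_deriv L \<nu>))"
      using L.density_RN_deriv[OF abs sets_\<nu>] by simp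
    also have "\<dots> = (\<integral>\<^sup>+z. RN_deriv L \<nu> z * f z \<partial>L)" by (simp add: nn_integral_density)
    also have "\<dots> = (\<integral>\<^sup>+z. ennreal (D z) * f z \<partial>L)"
      using RN by (intro nn_integral_cong_AE) auto
    finally show ?thesis .
  qed
  \<comment> \<open>Acceptance with probability p reduces the density D to the minimum of D and r.
    Where D is 0 the first branch applies, so there is no division by 0.\<close>
  define p where "p z = (if D z \<le> r z then 1 else r z / D z)" for z
  have [measurable]: "p \<in> borel_measurable L" unfolding p_def by measurable
  have p01: "0 \<le> p z \<and> p z \<le> 1" for z
    using r01[of z] D0[of z] by (auto simp: p_def divide_le_eq)
  have Dp: "D z * p z = min (D z) (r z)" for z
    using r01[of z] D0[of z] by (auto simp: p_def min_def)
  define q' where "q' \<omega> = q \<omega> - q \<omega> * indicator G \<omega> * p (Z \<omega>)" for \<omega>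
  define r' where "r' z = r z - min (D z) (r z)" for z
  show thesis
  proof
    show "q' \<in> borel_measurable W" unfolding q'_def by measurable
    show "r' \<in> borel_measurable L" unfolding r'_def by measurable
    show "0 \<le> q' \<omega> \<and> q' \<omega> \<le> q \<omega>" for \<omega>
      using p01[of "Z \<omega>"] q01[of \<omega>] by (auto simp: q'_def indicator_def mult_left_le)
    show "0 \<le> r' z \<and> r' z \<le> r z" for z using r01[of z] D0[of z] by (auto simp: r'_def)
    show "q' \<omega> = q \<omega>" if "\<omega> \<notin> G" for \<omega> using that by (simp add: q'_def)
    \<comment> \<open>A nonzero remainder means D < r, hence p = 1: the candidate is accepted for
      certain and no weight is left.\<close>
    show "q' \<omega> = 0" if "\<omega> \<in> G" "r' (Z \<omega>) \<noteq> 0" for \<omega>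
      using that by (auto simp: q'_def p_def r'_def min_def split: if_splits)
    fix A assume [measurable]: "A \<in> sets L"
    have "(\<integral>\<^sup>+\<omega>. ennreal (q \<omega> - q' \<omega>) * indicator A (Z \<omega>) \<partial>W)
      = (\<integral>\<^sup>+\<omega>. H \<omega> * (ennreal (p (Z \<omega>)) * indicator A (Z \<omega>)) \<partial>W)"
      using p01 q01 by (intro nn_integral_cong) (auto simp: q'_def H_def indicator_def ennreal_mult)
    also have "\<dots> = (\<integral>\<^sup>+z. ennreal (D z) * (ennreal (p z) * indicator A z) \<partial>L)"
      by (subst int_\<nu>[symmetric, of "\<lambda>z. ennreal (p z) * indicator A z"]) (simp_all add: int_D)
    also have "\<dots> = (\<integral>\<^sup>+z. ennreal (r z - r' z) * indicator A z \<partial>L)"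
      using D0 p01 by (intro nn_integral_cong) (simp add: r'_def Dp[symmetric] ennreal_mult mult.assoc)
    finally show "(\<integral>\<^sup>+\<omega>. ennreal (q \<omega> - q' \<omega>) * indicator A (Z \<omega>) \<partial>W)
        = (\<integral>\<^sup>+z. ennreal (r z - r' z) * indicator A z \<partial>L)" .
  qed
qed

text \<open>Suppose part of the target is never covered. Over a past \<open>T \<omega>\<close> for
  which the uncovered section has positive measure, \<open>hit\<close> yields an allowed candidate
  in it; since the remainder there is positive, that candidate has used up all the weight q. But
  weight and remainder have equal mass over every measurable set of pasts, so the remainder vanishes
  there as well. Thus both limits are 0, and the accepted shares add up to the whole target.\<close>

lemma greedy:
  fixes W :: "'w measure" and N :: "'n measure" and X :: "nat \<Rightarrow> 'w \<Rightarrow> real"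
  defines "L \<equiv> N \<Otimes>\<^sub>M U01"
  assumes W: "prob_space W" and T [measurable]: "T \<in> measurable W N" and N: "distr W N T = N"
    and X [measurable]: "\<And>k. X k \<in> borel_measurable W" and G [measurable]: "\<And>k. G k \<in> sets W"
    and ac: "\<And>B. B \<in> sets (N \<Otimes>\<^sub>M borel) \<Longrightarrow>
      AE \<omega> in W. emeasure U01 {t. (T \<omega>, t) \<in> B} = 0 \<longrightarrow> (\<forall>k. \<omega> \<in> G k \<longrightarrow> (T \<omega>, X k \<omega>) \<notin> B)"
    and hit: "\<And>B. B \<in> sets (N \<Otimes>\<^sub>M borel) \<Longrightarrow>
      AE \<omega> in W. emeasure U01 {t. (T \<omega>, t) \<in> B} \<noteq> 0 \<longrightarrow> (\<exists>k. \<omega> \<in> G k \<and> (T \<omega>, X k \<omega>) \<in> B)"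
  obtains q where "\<And>k. q k \<in> borel_measurable W" "\<And>k \<omega>. 0 \<le> q k \<omega>" "\<And>k \<omega>. q (Suc k) \<omega> \<le> q k \<omega>"
    "\<And>\<omega>. q 0 \<omega> = 1" "\<And>k \<omega>. \<omega> \<notin> G k \<Longrightarrow> q (Suc k) \<omega> = q k \<omega>" "AE \<omega> in W. (\<lambda>k. q k \<omega>) \<longlonglongrightarrow> 0"
    "\<And>A. A \<in> sets L \<Longrightarrow>
      (\<Sum>k. \<integral>\<^sup>+\<omega>. ennreal (q k \<omega> - q (Suc k) \<omega>) * indicator A (T \<omega>, X k \<omega>) \<partial>W) = emeasure L A"
proof -
  interpret W: prob_space W by fact
  interpret N: prob_space N using W.prob_space_distr[OF T] by (simp add: N)
  interpret NU: pair_prob_space N U01 by unfold_locales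
  have L: "prob_space L" unfolding L_def by (rule NU.prob_space_axioms)
  interpret L: prob_space L by (rule L)
  have sets_L [measurable_cong]: "sets L = sets (N \<Otimes>\<^sub>M borel)" unfolding L_def by (rule sets_pair_measure_cong) simp_all
  have spL: "space L = space N \<times> UNIV" by (simp add: L_def space_pair_measure)
  define Z where "Z k \<omega> = (T \<omega>, X k \<omega>)" for k \<omega>
  have Z [measurable]: "Z k \<in> measurable W L" for k
    unfolding Z_def measurable_cong_sets[OF refl sets_L] by measurable
  have null: "AE \<omega> in W. \<omega> \<in> G k \<longrightarrow> Z k \<omega> \<notin> B" if B: "B \<in> null_sets L" for k B
  proof -
    have B' [measurable]: "B \<in> sets (N \<Otimes>\<^sub>M borel)" using B sets_L by auto
    have "AE z in L. z \<notin> B" using B by (rule AE_not_in)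
    then have "AE t in N. AE y in U01. (t, y) \<notin> B" unfolding L_def by (rule NU.AE_pair)
    then have "AE t in distr W N T. AE y in U01. (t, y) \<notin> B" by (simp only: N)
    then have "AE \<omega> in W. AE y in U01. (T \<omega>, y) \<notin> B" by (rule AE_distrD[OF T])
    with ac[OF B'] show ?thesis
    proof eventually_elim
      case (elim \<omega>)
      have "emeasure U01 {t. (T \<omega>, t) \<in> B} = 0"
        using elim(2) sections_measurable[OF B', of "T \<omega>"]
        by (subst (asm) AE_iff_measurable[OF _ refl]) (auto simp: emeasure_eq_0)
      with elim(1) show ?case by (simp add: Z_def)
    qed
  qed
  \<comment> \<open>The state is the pair of current weight and current remainder. Dependent choice
    does not name its starting state, so P prescribes it at k = 0.\<close>
  define P where "P k s \<longleftrightarrow> fst s \<in> borel_measurable W \<and> snd s \<in> borel_measurable L \<and>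
      (\<forall>\<omega>. 0 \<le> fst s \<omega> \<and> fst s \<omega> \<le> 1) \<and> (\<forall>z. 0 \<le> snd s z \<and> snd s z \<le> 1) \<and>
      (k = 0 \<longrightarrow> fst s = (\<lambda>_. 1) \<and> snd s = (\<lambda>_. 1))" for k :: nat and s :: "('w \<Rightarrow> real) \<times> ('n \<times> real \<Rightarrow> real)"
  define Q where "Q k s s' \<longleftrightarrow> (\<forall>\<omega>. fst s' \<omega> \<le> fst s \<omega>) \<and> (\<forall>z. snd s' z \<le> snd s z) \<and>
      (\<forall>\<omega>. \<omega> \<notin> G k \<longrightarrow> fst s' \<omega> = fst s \<omega>) \<and> (\<forall>\<omega>. \<omega> \<in> G k \<longrightarrow> snd s' (Z k \<omega>) \<noteq> 0 \<longrightarrow> fst s' \<omega> = 0) \<and>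
      (\<forall>A\<in>sets L. (\<integral>\<^sup>+\<omega>. ennreal (fst s \<omega> - fst s' \<omega>) * indicator A (Z k \<omega>) \<partial>W)
        = (\<integral>\<^sup>+z. ennreal (snd s z - snd s' z) * indicator A z \<partial>L))"
    for k and s s' :: "('w \<Rightarrow> real) \<times> ('n \<times> real \<Rightarrow> real)"
  have "\<exists>f. \<forall>k. P k (f k) \<and> Q k (f k) (f (Suc k))"
  proof (rule dependent_nat_choice)
    show "\<exists>s. P 0 s" by (intro exI[of _ "(\<lambda>_. 1, \<lambda>_. 1)"]) (simp add: P_def)
    fix s k assume s: "P k s"
    then have "fst s \<in> borel_measurable W" "snd s \<in> borel_measurable L"
      "\<And>\<omega>. 0 \<le> fst s \<omega> \<and> fst s \<omega> \<le> 1" "\<And>z. 0 \<le> snd s z \<and> snd s z \<le> 1" unfolding P_def by blast+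
    from greedy_step[OF W L Z G this(1,3,2,4) null]
    obtain q' r' where qr: "q' \<in> borel_measurable W" "r' \<in> borel_measurable L"
      "\<And>\<omega>. 0 \<le> q' \<omega> \<and> q' \<omega> \<le> fst s \<omega>" "\<And>z. 0 \<le> r' z \<and> r' z \<le> snd s z"
      "\<And>\<omega>. \<omega> \<notin> G k \<Longrightarrow> q' \<omega> = fst s \<omega>" "\<And>\<omega>. \<omega> \<in> G k \<Longrightarrow> r' (Z k \<omega>) \<noteq> 0 \<Longrightarrow> q' \<omega> = 0"
      "\<And>A. A \<in> sets L \<Longrightarrow> (\<integral>\<^sup>+\<omega>. ennreal (fst s \<omega> - q' \<omega>) * indicator A (Z k \<omega>) \<partial>W)
        = (\<integral>\<^sup>+z. ennreal (snd s z - r' z) * indicator A z \<partial>L)" by blast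
    have "fst s \<omega> \<le> 1" "snd s z \<le> 1" for \<omega> z using s unfolding P_def by blast+
    then have "q' \<omega> \<le> 1" "r' z \<le> 1" for \<omega> z using qr(3)[of \<omega>] qr(4)[of z] by (meson order_trans)+
    with qr have "P (Suc k) (q', r') \<and> Q k s (q', r')"
      unfolding P_def Q_def by simp
    then show "\<exists>s'. P (Suc k) s' \<and> Q k s s'" by blast
  qed
  then obtain f where f: "\<And>k. P k (f k)" "\<And>k. Q k (f k) (f (Suc k))" by blast
  define q r where "q k = fst (f k)" and "r k = snd (f k)" for k
  have q [measurable]: "q k \<in> borel_measurable W" and r [measurable]: "r k \<in> borel_measurable L"
    and q01: "0 \<le> q k \<omega> \<and> q k \<omega> \<le> 1" and r01: "0 \<le> r k z \<and> r k z \<le> 1"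
    and init: "q 0 = (\<lambda>_. 1)" "r 0 = (\<lambda>_. 1)" for k \<omega> z
    using f(1)[of k] f(1)[of 0] unfolding P_def q_def r_def by blast+
  have q_mono: "q (Suc k) \<omega> \<le> q k \<omega>" and r_mono: "r (Suc k) z \<le> r k z"
    and q_G: "\<omega> \<notin> G k \<Longrightarrow> q (Suc k) \<omega> = q k \<omega>" and q_zero: "\<omega> \<in> G k \<Longrightarrow> r (Suc k) (Z k \<omega>) \<noteq> 0 \<Longrightarrow> q (Suc k) \<omega> = 0"
    and bal: "A \<in> sets L \<Longrightarrow> (\<integral>\<^sup>+\<omega>. ennreal (q k \<omega> - q (Suc k) \<omega>) * indicator A (Z k \<omega>) \<partial>W)
        = (\<integral>\<^sup>+z. ennreal (r k z - r (Suc k) z) * indicator A z \<partial>L)" for k \<omega> z A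
    using f(2)[of k] unfolding Q_def q_def r_def by blast+
  \<comment> \<open>At k = 0 both sides are the measure of A under N. By \<open>bal\<close> on the
    strip over A each step takes the same amount from both, and this amount is finite and may be
    cancelled.\<close>
  have mass: "(\<integral>\<^sup>+\<omega>. ennreal (q k \<omega>) * indicator A (T \<omega>) \<partial>W) = (\<integral>\<^sup>+z. ennreal (r k z) * indicator A (fst z) \<partial>L)"
    if A [measurable]: "A \<in> sets N" for k A
  proof (induction k)
    case 0
    have "(\<integral>\<^sup>+\<omega>. indicator A (T \<omega>) \<partial>W) = (\<integral>\<^sup>+t. indicator A t \<partial>distr W N T)"
      by (subst nn_integral_distr[OF T]) auto
    also have "\<dots> = (\<integral>\<^sup>+t. (\<integral>\<^sup>+y. indicator A t \<partial>U01) \<partial>N)" unfolding N using U01.emeasure_space_1 by simp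
    also have "\<dots> = (\<integral>\<^sup>+z. indicator A (fst z) \<partial>L)" unfolding L_def
      by (subst U01.nn_integral_fst[symmetric]) auto
    finally show ?case by (simp add: init)
  next
    case (Suc k)
    have AU: "A \<times> UNIV \<in> sets L" unfolding sets_L by simp
    let ?a = "\<integral>\<^sup>+\<omega>. ennreal (q k \<omega> - q (Suc k) \<omega>) * indicator A (T \<omega>) \<partial>W"
    have a: "?a = (\<integral>\<^sup>+z. ennreal (r k z - r (Suc k) z) * indicator A (fst z) \<partial>L)"
      using bal[OF AU, of k] by (simp add: Z_def indicator_times)
    have "q k \<omega> - q (Suc k) \<omega> \<le> 1" for \<omega> using q01[of k \<omega>] q01[of "Suc k" \<omega>] by linarith
    then have "?a \<le> (\<integral>\<^sup>+\<omega>. 1 \<partial>W)"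
      by (intro nn_integral_mono) (simp add: indicator_def ennreal_le_1)
    then have fin: "?a \<noteq> \<infinity>" by (auto simp: W.emeasure_space_1 top_unique)
    have "?a + (\<integral>\<^sup>+\<omega>. ennreal (q (Suc k) \<omega>) * indicator A (T \<omega>) \<partial>W)
       = (\<integral>\<^sup>+\<omega>. ennreal (q k \<omega>) * indicator A (T \<omega>) \<partial>W)"
      using q01 q_mono
      by (subst nn_integral_add[symmetric]) (auto intro!: nn_integral_cong simp: distrib_right[symmetric] simp flip: ennreal_plus)
    also have "\<dots> = (\<integral>\<^sup>+z. ennreal (r k z) * indicator A (fst z) \<partial>L)" by (rule Suc)
    also have "\<dots> = ?a + (\<integral>\<^sup>+z. ennreal (r (Suc k) z) * indicator A (fst z) \<partial>L)" unfolding a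
      using r01 r_mono
      by (subst nn_integral_add[symmetric]) (auto intro!: nn_integral_cong simp: distrib_right[symmetric] simp flip: ennreal_plus)
    finally show ?case using fin by (simp add: ennreal_add_left_cancel)
  qed
  define qi where "qi \<omega> = (INF k. ennreal (q k \<omega>))" for \<omega>
  define ri where "ri z = (INF k. ennreal (r k z))" for z
  have [measurable]: "qi \<in> borel_measurable W" "ri \<in> borel_measurable L" unfolding qi_def ri_def by measurable
  have INF_ind: "(INF k. g k * indicator S x) = (INF k. g k) * indicator S x" for g :: "nat \<Rightarrow> ennreal" and S and x :: 'b
    by (cases "x \<in> S") auto
  have mass_inf: "(\<integral>\<^sup>+\<omega>. qi \<omega> * indicator A (T \<omega>) \<partial>W) = (\<integral>\<^sup>+z. ri z * indicator A (fst z) \<partial>L)"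
    if A [measurable]: "A \<in> sets N" for A
  proof -
    have "(\<integral>\<^sup>+\<omega>. qi \<omega> * indicator A (T \<omega>) \<partial>W) = (\<integral>\<^sup>+\<omega>. (INF k. ennreal (q k \<omega>) * indicator A (T \<omega>)) \<partial>W)"
      by (simp add: qi_def INF_ind)
    also have "\<dots> = (INF k. \<integral>\<^sup>+\<omega>. ennreal (q k \<omega>) * indicator A (T \<omega>) \<partial>W)"
    proof (rule nn_integral_monotone_convergence_INF_decseq)
      show "decseq (\<lambda>k \<omega>. ennreal (q k \<omega>) * indicator A (T \<omega>))"
        using q_mono by (intro decseq_SucI le_funI mult_right_mono ennreal_leI) auto
      have "(\<integral>\<^sup>+\<omega>. ennreal (q 0 \<omega>) * indicator A (T \<omega>) \<partial>W) \<le> (\<integral>\<^sup>+\<omega>. 1 \<partial>W)"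
        by (intro nn_integral_mono) (auto simp: indicator_def init)
      then show "(\<integral>\<^sup>+\<omega>. ennreal (q 0 \<omega>) * indicator A (T \<omega>) \<partial>W) < \<infinity>"
        by (simp add: W.emeasure_space_1 order_le_less_trans)
    qed auto
    also have "\<dots> = (INF k. \<integral>\<^sup>+z. ennreal (r k z) * indicator A (fst z) \<partial>L)" by (simp add: mass)
    also have "\<dots> = (\<integral>\<^sup>+z. (INF k. ennreal (r k z) * indicator A (fst z)) \<partial>L)"
    proof (rule nn_integral_monotone_convergence_INF_decseq[symmetric])
      show "decseq (\<lambda>k z. ennreal (r k z) * indicator A (fst z))"
        using r_mono by (intro decseq_SucI le_funI mult_right_mono ennreal_leI) auto
      have "(\<integral>\<^sup>+z. ennreal (r 0 z) * indicator A (fst z) \<partial>L) \<le> (\<integral>\<^sup>+z. 1 \<partial>L)"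
        by (intro nn_integral_mono) (auto simp: indicator_def init)
      then show "(\<integral>\<^sup>+z. ennreal (r 0 z) * indicator A (fst z) \<partial>L) < \<infinity>"
        by (simp add: L.emeasure_space_1 order_le_less_trans)
    qed auto
    also have "\<dots> = (\<integral>\<^sup>+z. ri z * indicator A (fst z) \<partial>L)" by (simp add: ri_def INF_ind)
    finally show ?thesis .
  qed
  \<comment> \<open>B is what is never covered, and the set A defined next contains the pasts over
    which B has positive measure. Over A the weight is used up; off A the remainder is 0 almost
    everywhere by the choice of A.\<close>
  define B where "B = {z\<in>space L. ri z \<noteq> 0}"
  have B: "B \<in> sets (N \<Otimes>\<^sub>M borel)" unfolding sets_L[symmetric] B_def by measurable
  define A where "A = {t\<in>space N. emeasure U01 {y. (t, y) \<in> B} \<noteq> 0}"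
  have A [measurable]: "A \<in> sets N"
    using measurable_emeasure_section[OF B measurable_ident_sets[OF refl]] unfolding A_def by measurable
  have "AE \<omega> in W. qi \<omega> * indicator A (T \<omega>) = 0"
    using hit[OF B]
  proof eventually_elim
    case (elim \<omega>)
    show ?case
    proof (cases "T \<omega> \<in> A")
      case True
      with elim obtain k where k: "\<omega> \<in> G k" "Z k \<omega> \<in> B" by (auto simp: A_def Z_def)
      then have "ri (Z k \<omega>) \<noteq> 0" by (simp add: B_def)
      moreover have "ri (Z k \<omega>) \<le> ennreal (r (Suc k) (Z k \<omega>))" unfolding ri_def by (rule INF_lower) simp
      ultimately have "q (Suc k) \<omega> = 0" using k by (intro q_zero) auto
      then have "qi \<omega> \<le> 0" unfolding qi_def by (intro INF_lower2[of "Suc k"]) auto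
      then show ?thesis by simp
    qed simp
  qed
  then have "(\<integral>\<^sup>+\<omega>. qi \<omega> * indicator A (T \<omega>) \<partial>W) = 0" by (simp add: nn_integral_0_iff_AE)
  then have "(\<integral>\<^sup>+z. ri z * indicator A (fst z) \<partial>L) = 0" by (simp add: mass_inf)
  then have 1: "AE z in L. ri z * indicator A (fst z) = 0" by (simp add: nn_integral_0_iff_AE)
  have 2: "AE z in L. fst z \<notin> A \<longrightarrow> ri z = 0"
    unfolding L_def
  proof (rule NU.AE_pair_measure)
    show "{z \<in> space (N \<Otimes>\<^sub>M U01). fst z \<notin> A \<longrightarrow> ri z = 0} \<in> sets (N \<Otimes>\<^sub>M U01)"
      unfolding L_def[symmetric] by measurable
    show "AE t in N. AE y in U01. fst (t, y) \<notin> A \<longrightarrow> ri (t, y) = 0"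
    proof (rule AE_I2)
      fix t assume t: "t \<in> space N"
      show "AE y in U01. fst (t, y) \<notin> A \<longrightarrow> ri (t, y) = 0"
      proof (cases "t \<in> A")
        case False
        then have "emeasure U01 {y. (t, y) \<in> B} = 0" using t by (simp add: A_def)
        then have "AE y in U01. (t, y) \<notin> B"
          using sections_measurable[OF B, of t] by (subst AE_iff_measurable[OF _ refl]) auto
        then show ?thesis by eventually_elim (use t in \<open>auto simp: B_def spL\<close>)
      qed simp
    qed
  qed
  from 1 2 have ri0: "AE z in L. ri z = 0"
    by eventually_elim (auto simp: indicator_def split: if_splits)
  have "(\<integral>\<^sup>+\<omega>. qi \<omega> \<partial>W) = (\<integral>\<^sup>+\<omega>. qi \<omega> * indicator (space N) (T \<omega>) \<partial>W)"
    using measurable_space[OF T] by (intro nn_integral_cong) simp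
  also have "\<dots> = (\<integral>\<^sup>+z. ri z * indicator (space N) (fst z) \<partial>L)" by (rule mass_inf) simp
  also have "\<dots> = (\<integral>\<^sup>+z. 0 \<partial>L)" using ri0 by (intro nn_integral_cong_AE) auto
  finally have qi0: "AE \<omega> in W. qi \<omega> = 0" by (simp add: nn_integral_0_iff_AE)
  have lim: "g \<longlonglongrightarrow> 0" if "(INF k. ennreal (g k)) = 0" "\<And>k. 0 \<le> g k" "\<And>k. g (Suc k) \<le> g k" for g :: "nat \<Rightarrow> real"
  proof -
    have "(\<lambda>k. ennreal (g k)) \<longlonglongrightarrow> (INF k. ennreal (g k))"
      using that by (intro LIMSEQ_INF decseq_SucI ennreal_leI)
    then show ?thesis using that by (simp add: tendsto_ennreal_iff[of _ _ 0, simplified])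
  qed
  show thesis
  proof
    show "AE \<omega> in W. (\<lambda>k. q k \<omega>) \<longlonglongrightarrow> 0"
      using qi0 by eventually_elim (use q01 q_mono in \<open>auto simp: qi_def intro!: lim\<close>)
    fix A assume A [measurable]: "A \<in> sets L"
    have "(\<Sum>k. \<integral>\<^sup>+\<omega>. ennreal (q k \<omega> - q (Suc k) \<omega>) * indicator A (T \<omega>, X k \<omega>) \<partial>W)
        = (\<Sum>k. \<integral>\<^sup>+z. ennreal (r k z - r (Suc k) z) * indicator A z \<partial>L)"
      using bal[OF A] by (simp add: Z_def)
    also have "\<dots> = (\<integral>\<^sup>+z. (\<Sum>k. ennreal (r k z - r (Suc k) z) * indicator A z) \<partial>L)"
      by (rule nn_integral_suminf[symmetric]) measurable
    also have "\<dots> = (\<integral>\<^sup>+z. indicator A z \<partial>L)"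
    proof (rule nn_integral_cong_AE)
      \<comment> \<open>The remainder falls from 1 to 0, so the shares telescope to the density
        1.\<close>
      show "AE z in L. (\<Sum>k. ennreal (r k z - r (Suc k) z) * indicator A z) = indicator A z"
        using ri0
      proof eventually_elim
        case (elim z)
        then have "(\<lambda>k. r k z) \<longlonglongrightarrow> 0"
          unfolding ri_def using r01[THEN conjunct1] r_mono by (rule lim)
        then have "(\<lambda>k. r k z - r (Suc k) z) sums (r 0 z - 0)" by (rule telescope_sums')
        then have "(\<Sum>k. ennreal (r k z - r (Suc k) z)) = 1"
          using r_mono[of _ z] by (subst suminf_ennreal_eq) (simp_all add: init)
        then show ?case by (simp add: ennreal_suminf_multc)
      qed
    qed
    also have "\<dots> = emeasure L A" by simp
    finally show "(\<Sum>k. \<integral>\<^sup>+\<omega>. ennreal (q k \<omega> - q (Suc k) \<omega>) * indicator A (T \<omega>, X k \<omega>) \<partial>W) = emeasure L A" .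
  qed (use q01 q_mono q_G init in auto)
qed

lemma emeasure_U01_Ico:
  assumes "0 \<le> a" "a \<le> b" "b \<le> 1" shows "emeasure U01 {a..<b} = ennreal (b - a)"
proof -
  have "AE t in lborel. t \<noteq> a" by (rule AE_lborel_singleton)
  then have "emeasure lborel ({a..<b} \<inter> {0<..<1}) = emeasure lborel {a..<b}"
    using assms by (intro emeasure_eq_AE) (auto elim!: eventually_mono)
  then show ?thesis using assms by (simp add: emeasure_U01)
qed

text \<open>One uniform variable decides all acceptances. As q 0 = 1 and q k decreases to 0, the
  intervals from q (k + 1) to q k partition (0,1) almost surely, and v selects the candidate whose
  interval contains it. Given the outcome, candidate k is chosen with probability q k - q (k + 1); a
  candidate that is not allowed has an empty interval.\<close>

lemma random_selection:
  fixes W :: "'w measure" and N :: "'n measure" and X :: "nat \<Rightarrow> 'w \<Rightarrow> real" and v :: "'v \<Rightarrow> real"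
  assumes W: "prob_space W" and T [measurable]: "T \<in> measurable W N" and N: "distr W N T = N"
    and X [measurable]: "\<And>k. X k \<in> borel_measurable W" and G [measurable]: "\<And>k. G k \<in> sets W"
    and ac: "\<And>B. B \<in> sets (N \<Otimes>\<^sub>M borel) \<Longrightarrow>
      AE \<omega> in W. emeasure U01 {t. (T \<omega>, t) \<in> B} = 0 \<longrightarrow> (\<forall>k. \<omega> \<in> G k \<longrightarrow> (T \<omega>, X k \<omega>) \<notin> B)"
    and hit: "\<And>B. B \<in> sets (N \<Otimes>\<^sub>M borel) \<Longrightarrow>
      AE \<omega> in W. emeasure U01 {t. (T \<omega>, t) \<in> B} \<noteq> 0 \<longrightarrow> (\<exists>k. \<omega> \<in> G k \<and> (T \<omega>, X k \<omega>) \<in> B)"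
    and V: "prob_space V" and v [measurable]: "v \<in> borel_measurable V" and law_v: "distr V borel v = U01"
  obtains \<kappa> where "\<kappa> \<in> measurable (W \<Otimes>\<^sub>M V) (count_space UNIV)"
    "AE z in W \<Otimes>\<^sub>M V. fst z \<in> G (\<kappa> z)"
    "distr (W \<Otimes>\<^sub>M V) (N \<Otimes>\<^sub>M U01) (\<lambda>z. (T (fst z), X (\<kappa> z) (fst z))) = N \<Otimes>\<^sub>M U01"
proof -
  interpret W: prob_space W by fact
  interpret V: prob_space V by fact
  interpret WV: pair_prob_space W V by unfold_locales
  let ?L = "N \<Otimes>\<^sub>M U01"
  have sets_L: "sets ?L = sets (N \<Otimes>\<^sub>M borel)" by (rule sets_pair_measure_cong) simp_all
  show thesis
  proof (rule greedy[OF W T N X G ac hit])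
  fix q assume q [measurable]: "\<And>k. q k \<in> borel_measurable W" and q0: "\<And>k \<omega>. 0 \<le> q k \<omega>"
    and q_mono: "\<And>k \<omega>. q (Suc k) \<omega> \<le> q k \<omega>" and q_init: "\<And>\<omega>. q 0 \<omega> = 1"
    and q_G: "\<And>k \<omega>. \<omega> \<notin> G k \<Longrightarrow> q (Suc k) \<omega> = q k \<omega>" and q_lim: "AE \<omega> in W. (\<lambda>k. q k \<omega>) \<longlonglongrightarrow> 0"
    and q_sum: "\<And>A. A \<in> sets ?L \<Longrightarrow>
      (\<Sum>k. \<integral>\<^sup>+\<omega>. ennreal (q k \<omega> - q (Suc k) \<omega>) * indicator A (T \<omega>, X k \<omega>) \<partial>W) = emeasure ?L A"
  have "decseq (\<lambda>k. q k \<omega>)" for \<omega> using q_mono by (rule decseq_SucI)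
  then have anti: "i \<le> j \<Longrightarrow> q j \<omega> \<le> q i \<omega>" for i j \<omega> by (rule decseqD)
  then have q1: "q k \<omega> \<le> 1" for k \<omega> using q_init[of \<omega>] by (metis le0)
  \<comment> \<open>The first k with q (k + 1) at most v is the k whose interval contains v. Writing
    it with \<open>LEAST\<close> makes it measurable.\<close>
  define \<kappa> where "\<kappa> z = (LEAST k. q (Suc k) (fst z) \<le> v (snd z))" for z
  have \<kappa> [measurable]: "\<kappa> \<in> measurable (W \<Otimes>\<^sub>M V) (count_space UNIV)" unfolding \<kappa>_def by measurable
  have "AE y in V. 0 < v y \<and> v y < 1"
  proof -
    have "AE t in U01. 0 < t \<and> t < 1"
      unfolding U01_def by (subst AE_density) (auto simp: indicator_def)
    then show ?thesis unfolding law_v[symmetric] by (rule AE_distrD[OF v])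
  qed
  then have good: "AE z in W \<Otimes>\<^sub>M V. 0 < v (snd z) \<and> v (snd z) < 1 \<and> (\<exists>k. q k (fst z) \<le> v (snd z))"
  proof (intro WV.AE_pair_measure)
    assume v01: "AE y in V. 0 < v y \<and> v y < 1"
    from q_lim show "AE \<omega> in W. AE y in V. 0 < v (snd (\<omega>, y)) \<and> v (snd (\<omega>, y)) < 1 \<and> (\<exists>k. q k (fst (\<omega>, y)) \<le> v (snd (\<omega>, y)))"
    proof eventually_elim
      case (elim \<omega>)
      have "\<exists>k. q k \<omega> \<le> v y" if "0 < v y" for y
        using order_tendstoD(2)[OF elim that] by (auto simp: eventually_sequentially intro: less_imp_le)
      with v01 show ?case by (auto elim!: eventually_mono)
    qed
  qed measurable
  have \<kappa>_iff: "\<kappa> z = k \<longleftrightarrow> v (snd z) \<in> {q (Suc k) (fst z)..<q k (fst z)}"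
    if z: "v (snd z) < 1" "\<exists>k. q k (fst z) \<le> v (snd z)" for z k
  proof -
    let ?u = "v (snd z)" and ?q = "\<lambda>k. q k (fst z)"
    from z obtain i where i: "?q i \<le> ?u" by blast
    then have "?q (Suc i) \<le> ?u" using q_mono[of i "fst z"] by simp
    then have A: "?q (Suc (\<kappa> z)) \<le> ?u" unfolding \<kappa>_def by (rule LeastI)
    have B: "?u < ?q (\<kappa> z)"
    proof (cases "\<kappa> z")
      case (Suc m)
      then have "\<not> ?q (Suc m) \<le> ?u" unfolding \<kappa>_def using not_less_Least[of m "\<lambda>k. ?q (Suc k) \<le> ?u"] by auto
      then show ?thesis using Suc by simp
    qed (use z q_init in simp)
    show ?thesis
    proof
      assume "?u \<in> {?q (Suc k)..<?q k}"
      then have "?q (Suc k) < ?q (\<kappa> z)" "?q (Suc (\<kappa> z)) < ?q k" using A B by auto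
      then have "\<not> Suc k \<le> \<kappa> z" "\<not> Suc (\<kappa> z) \<le> k"
        using anti[of "Suc k" "\<kappa> z" "fst z"] anti[of "Suc (\<kappa> z)" k "fst z"] by auto
      then show "\<kappa> z = k" by simp
    qed (use A B in auto)
  qed
  show thesis
  proof
    show "\<kappa> \<in> measurable (W \<Otimes>\<^sub>M V) (count_space UNIV)" by (rule \<kappa>)
    show "AE z in W \<Otimes>\<^sub>M V. fst z \<in> G (\<kappa> z)"
      using good
    proof eventually_elim
      case (elim z)
      then have "v (snd z) \<in> {q (Suc (\<kappa> z)) (fst z)..<q (\<kappa> z) (fst z)}" using \<kappa>_iff[of z "\<kappa> z"] by blast
      then have "q (Suc (\<kappa> z)) (fst z) \<noteq> q (\<kappa> z) (fst z)" by auto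
      then show ?case using q_G by blast
    qed
    have X\<kappa> [measurable]: "(\<lambda>z. X (\<kappa> z) (fst z)) \<in> borel_measurable (W \<Otimes>\<^sub>M V)"
    proof (rule measurable_compose_countable[OF _ \<kappa>])
      show "(\<lambda>z. X k (fst z)) \<in> borel_measurable (W \<Otimes>\<^sub>M V)" for k by measurable
    qed
    have F: "(\<lambda>z. (T (fst z), X (\<kappa> z) (fst z))) \<in> measurable (W \<Otimes>\<^sub>M V) ?L"
      unfolding measurable_cong_sets[OF refl sets_L] by measurable
    show "distr (W \<Otimes>\<^sub>M V) ?L (\<lambda>z. (T (fst z), X (\<kappa> z) (fst z))) = ?L"
    proof (rule measure_eqI)
      fix A assume "A \<in> sets (distr (W \<Otimes>\<^sub>M V) ?L (\<lambda>z. (T (fst z), X (\<kappa> z) (fst z))))"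
      then have A: "A \<in> sets ?L" by simp
      then have A' [measurable]: "A \<in> sets (N \<Otimes>\<^sub>M borel)" by (simp add: sets_L)
      have "emeasure (distr (W \<Otimes>\<^sub>M V) ?L (\<lambda>z. (T (fst z), X (\<kappa> z) (fst z)))) A
        = (\<integral>\<^sup>+p. indicator A p \<partial>distr (W \<Otimes>\<^sub>M V) ?L (\<lambda>z. (T (fst z), X (\<kappa> z) (fst z))))"
        using A by simp
      also have "\<dots> = (\<integral>\<^sup>+z. indicator A (T (fst z), X (\<kappa> z) (fst z)) \<partial>(W \<Otimes>\<^sub>M V))"
        using A by (subst nn_integral_distr[OF F]) auto
      also have "\<dots> = (\<integral>\<^sup>+z. (\<Sum>k. indicator A (T (fst z), X k (fst z)) *
          indicator {q (Suc k) (fst z)..<q k (fst z)} (v (snd z))) \<partial>(W \<Otimes>\<^sub>M V))"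
      proof (rule nn_integral_cong_AE)
        show "AE z in W \<Otimes>\<^sub>M V. indicator A (T (fst z), X (\<kappa> z) (fst z)) =
          (\<Sum>k. indicator A (T (fst z), X k (fst z)) * indicator {q (Suc k) (fst z)..<q k (fst z)} (v (snd z)) :: ennreal)"
          using good
        proof eventually_elim
          case (elim z)
          have "indicator {q (Suc k) (fst z)..<q k (fst z)} (v (snd z)) = (if k = \<kappa> z then 1 else 0 :: ennreal)" for k
            using \<kappa>_iff[of z k] elim by (simp only: indicator_def of_bool_def) metis
          then have "(\<Sum>k. indicator A (T (fst z), X k (fst z)) * indicator {q (Suc k) (fst z)..<q k (fst z)} (v (snd z)) :: ennreal)
            = (\<Sum>k. if k = \<kappa> z then indicator A (T (fst z), X (\<kappa> z) (fst z)) else 0)"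
            by (intro suminf_cong) simp
          also have "\<dots> = indicator A (T (fst z), X (\<kappa> z) (fst z))"
            by (rule sums_unique[symmetric]) (rule sums_single)
          finally show ?case by simp
        qed
      qed
      also have "\<dots> = (\<Sum>k. \<integral>\<^sup>+z. indicator A (T (fst z), X k (fst z)) *
          indicator {q (Suc k) (fst z)..<q k (fst z)} (v (snd z)) \<partial>(W \<Otimes>\<^sub>M V))"
      proof (rule nn_integral_suminf)
        fix k
        have "(\<lambda>z. indicator {z. q (Suc k) (fst z) \<le> v (snd z) \<and> v (snd z) < q k (fst z)} z :: ennreal) \<in> borel_measurable (W \<Otimes>\<^sub>M V)"
          by measurable
        then have "(\<lambda>z. indicator {q (Suc k) (fst z)..<q k (fst z)} (v (snd z)) :: ennreal) \<in> borel_measurable (W \<Otimes>\<^sub>M V)"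
          by (simp add: indicator_def)
        then show "(\<lambda>z. indicator A (T (fst z), X k (fst z)) *
          indicator {q (Suc k) (fst z)..<q k (fst z)} (v (snd z)) :: ennreal) \<in> borel_measurable (W \<Otimes>\<^sub>M V)"
          by measurable
      qed
      also have "\<dots> = (\<Sum>k. \<integral>\<^sup>+\<omega>. ennreal (q k \<omega> - q (Suc k) \<omega>) * indicator A (T \<omega>, X k \<omega>) \<partial>W)"
      proof (rule suminf_cong)
        fix k
        have m: "(\<lambda>z. indicator {z. q (Suc k) (fst z) \<le> v (snd z) \<and> v (snd z) < q k (fst z)} z :: ennreal) \<in> borel_measurable (W \<Otimes>\<^sub>M V)"
          by measurable
        have m': "(\<lambda>z. indicator {q (Suc k) (fst z)..<q k (fst z)} (v (snd z)) :: ennreal) \<in> borel_measurable (W \<Otimes>\<^sub>M V)"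
          using m by (simp add: indicator_def)
        have "(\<integral>\<^sup>+z. indicator A (T (fst z), X k (fst z)) *
            indicator {q (Suc k) (fst z)..<q k (fst z)} (v (snd z)) \<partial>(W \<Otimes>\<^sub>M V))
          = (\<integral>\<^sup>+\<omega>. (\<integral>\<^sup>+y. indicator A (T \<omega>, X k \<omega>) * indicator {q (Suc k) \<omega>..<q k \<omega>} (v y) \<partial>V) \<partial>W)"
          using m' by (subst V.nn_integral_fst[symmetric]) simp_all
        also have "\<dots> = (\<integral>\<^sup>+\<omega>. ennreal (q k \<omega> - q (Suc k) \<omega>) * indicator A (T \<omega>, X k \<omega>) \<partial>W)"
        proof (rule nn_integral_cong)
          fix \<omega>
          have "(\<integral>\<^sup>+y. indicator {q (Suc k) \<omega>..<q k \<omega>} (v y) \<partial>V) = (\<integral>\<^sup>+t. indicator {q (Suc k) \<omega>..<q k \<omega>} t \<partial>distr V borel v)"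
            by (subst nn_integral_distr[OF v]) auto
          also have "\<dots> = ennreal (q k \<omega> - q (Suc k) \<omega>)"
            unfolding law_v by (simp add: emeasure_U01_Ico q0 q_mono q1)
          finally show "(\<integral>\<^sup>+y. indicator A (T \<omega>, X k \<omega>) * indicator {q (Suc k) \<omega>..<q k \<omega>} (v y) \<partial>V)
            = ennreal (q k \<omega> - q (Suc k) \<omega>) * indicator A (T \<omega>, X k \<omega>)"
            by (simp add: nn_integral_cmult mult.commute)
        qed
        finally show "(\<integral>\<^sup>+z. indicator A (T (fst z), X k (fst z)) *
            indicator {q (Suc k) (fst z)..<q k (fst z)} (v (snd z)) \<partial>(W \<Otimes>\<^sub>M V))
          = (\<integral>\<^sup>+\<omega>. ennreal (q k \<omega> - q (Suc k) \<omega>) * indicator A (T \<omega>, X k \<omega>) \<partial>W)" .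
      qed
      also have "\<dots> = emeasure ?L A" by (rule q_sum[OF A])
      finally show "emeasure (distr (W \<Otimes>\<^sub>M V) ?L (\<lambda>z. (T (fst z), X (\<kappa> z) (fst z)))) A = emeasure ?L A" .
    qed simp
  qed
  qed
qed

section \<open>A fresh uniform point of the random set\<close>

context rcs begin

lemma fresh_measurable:
  fixes n :: nat
  assumes x: "x \<in> measurable W seqsp" and \<tau>: "\<tau> \<in> measurable W (PiM {..<n} (\<lambda>_. borel))"
  shows "{\<omega>\<in>space W. x \<omega> k \<notin> \<tau> \<omega> ` {..<n}} \<in> sets W"
proof -
  have x' [measurable]: "(\<lambda>\<omega>. x \<omega> k) \<in> borel_measurable W"
    by (rule measurable_compose[OF x measurable_seqsp_nth])
  have "{\<omega>\<in>space W. x \<omega> k \<noteq> \<tau> \<omega> l} \<in> sets W" if "l \<in> {..<n}" for l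
  proof -
    have "(\<lambda>\<omega>. \<tau> \<omega> l) \<in> borel_measurable W"
      by (rule measurable_compose[OF \<tau> measurable_component_singleton[OF that]])
    with x' show ?thesis by (rule borel_measurable_neq)
  qed
  then have "{\<omega>\<in>space W. \<forall>l\<in>{..<n}. x \<omega> k \<noteq> \<tau> \<omega> l} \<in> sets W" by (intro sets.sets_Collect_finite_All) auto
  also have "{\<omega>\<in>space W. \<forall>l\<in>{..<n}. x \<omega> k \<noteq> \<tau> \<omega> l} = {\<omega>\<in>space W. x \<omega> k \<notin> \<tau> \<omega> ` {..<n}}" by auto
  finally show ?thesis .
qed

text \<open>The almost sure statement of \<open>hit_fresh\<close> covers all tuples at once. This is
  why a random tuple may be inserted, even one that depends on further randomness carried by
  W.\<close>

lemma hit_fresh_distr: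
  fixes n :: nat
  assumes x: "x \<in> measurable W seqsp" and law_x: "distr W seqsp x = \<mu>"
    and \<tau>: "\<And>\<omega>. \<omega> \<in> space W \<Longrightarrow> \<tau> \<omega> \<in> PiE {..<n} (\<lambda>_. range (x \<omega>))"
    and B: "B \<in> sets (PiM {..<n} (\<lambda>_. borel) \<Otimes>\<^sub>M borel)"
  shows "AE \<omega> in W. (\<exists>k. x \<omega> k \<notin> \<tau> \<omega> ` {..<n} \<and> (\<tau> \<omega>, x \<omega> k) \<in> B) \<longleftrightarrow> emeasure U01 {t. (\<tau> \<omega>, t) \<in> B} \<noteq> 0"
proof -
  have "AE \<omega> in W. \<forall>s\<in>PiE {..<n} (\<lambda>_. range (x \<omega>)).
      (\<exists>t\<in>range (x \<omega>). t \<notin> s ` {..<n} \<and> (s, t) \<in> B) \<longleftrightarrow> emeasure U01 {t. (s, t) \<in> B} \<noteq> 0"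
    using hit_fresh[OF B] unfolding law_x[symmetric] by (rule AE_distrD[OF x])
  then show ?thesis using AE_space
  proof eventually_elim
    case (elim \<omega>)
    then show ?case using \<tau>[of \<omega>] by (simp only: bex_range)
  qed
qed

text \<open>The selection requires its reference measure to be the law of the past, hence the use of
  \<open>distr W N \<tau>\<close>. The conditions \<open>ac\<close> and \<open>hit\<close> of the
  selection are the two directions of the hitting equivalence, with the fresh positions as allowed
  candidates.\<close>

lemma next_point:
  fixes n :: nat and W :: "'w measure" and v :: "'v \<Rightarrow> real"
  defines "N \<equiv> PiM {..<n} (\<lambda>_. borel :: real measure)"
  assumes W: "prob_space W" and x: "x \<in> measurable W seqsp" and law_x: "distr W seqsp x = \<mu>"
    and \<tau>: "\<tau> \<in> measurable W N" "\<And>\<omega>. \<omega> \<in> space W \<Longrightarrow> \<tau> \<omega> \<in> PiE {..<n} (\<lambda>_. range (x \<omega>))"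
    and V: "prob_space V" and v: "v \<in> borel_measurable V" and law_v: "distr V borel v = U01"
  obtains \<kappa> where "\<kappa> \<in> measurable (W \<Otimes>\<^sub>M V) (count_space UNIV)"
    "AE z in W \<Otimes>\<^sub>M V. x (fst z) (\<kappa> z) \<notin> \<tau> (fst z) ` {..<n}"
    "distr (W \<Otimes>\<^sub>M V) (distr W N \<tau> \<Otimes>\<^sub>M U01) (\<lambda>z. (\<tau> (fst z), x (fst z) (\<kappa> z))) = distr W N \<tau> \<Otimes>\<^sub>M U01"
proof -
  let ?N = "distr W N \<tau>"
  let ?G = "\<lambda>k. {\<omega>\<in>space W. x \<omega> k \<notin> \<tau> \<omega> ` {..<n}}"
  have sets_N: "sets (?N \<Otimes>\<^sub>M borel) = sets (N \<Otimes>\<^sub>M borel)" by (rule sets_pair_measure_cong) simp_all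
  have T: "\<tau> \<in> measurable W ?N" using \<tau>(1) by simp
  have dN: "distr W ?N \<tau> = ?N" by (rule distr_cong) simp_all
  have X: "(\<lambda>\<omega>. x \<omega> k) \<in> borel_measurable W" for k by (rule measurable_compose[OF x measurable_seqsp_nth])
  have G: "?G k \<in> sets W" for k using fresh_measurable[OF x \<tau>(1)[unfolded N_def]] .
  have ac: "AE \<omega> in W. emeasure U01 {t. (\<tau> \<omega>, t) \<in> B} = 0 \<longrightarrow> (\<forall>k. \<omega> \<in> ?G k \<longrightarrow> (\<tau> \<omega>, x \<omega> k) \<notin> B)"
    and hit: "AE \<omega> in W. emeasure U01 {t. (\<tau> \<omega>, t) \<in> B} \<noteq> 0 \<longrightarrow> (\<exists>k. \<omega> \<in> ?G k \<and> (\<tau> \<omega>, x \<omega> k) \<in> B)"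
    if "B \<in> sets (?N \<Otimes>\<^sub>M borel)" for B
  proof -
    have "B \<in> sets (N \<Otimes>\<^sub>M borel)" using that by (simp only: sets_N)
    then have hf: "AE \<omega> in W. (\<exists>k. x \<omega> k \<notin> \<tau> \<omega> ` {..<n} \<and> (\<tau> \<omega>, x \<omega> k) \<in> B) \<longleftrightarrow> emeasure U01 {t. (\<tau> \<omega>, t) \<in> B} \<noteq> 0"
      using \<tau>(2) by (intro hit_fresh_distr[OF x law_x]) (auto simp: N_def)
    show "AE \<omega> in W. emeasure U01 {t. (\<tau> \<omega>, t) \<in> B} = 0 \<longrightarrow> (\<forall>k. \<omega> \<in> ?G k \<longrightarrow> (\<tau> \<omega>, x \<omega> k) \<notin> B)"
      using hf by eventually_elim blast
    show "AE \<omega> in W. emeasure U01 {t. (\<tau> \<omega>, t) \<in> B} \<noteq> 0 \<longrightarrow> (\<exists>k. \<omega> \<in> ?G k \<and> (\<tau> \<omega>, x \<omega> k) \<in> B)"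
      using hf
    proof (rule AE_mp, intro AE_I2 impI)
      fix \<omega>
      assume "\<omega> \<in> space W" "(\<exists>k. x \<omega> k \<notin> \<tau> \<omega> ` {..<n} \<and> (\<tau> \<omega>, x \<omega> k) \<in> B) \<longleftrightarrow> emeasure U01 {t. (\<tau> \<omega>, t) \<in> B} \<noteq> 0"
        "emeasure U01 {t. (\<tau> \<omega>, t) \<in> B} \<noteq> 0"
      then show "\<exists>k. \<omega> \<in> ?G k \<and> (\<tau> \<omega>, x \<omega> k) \<in> B" by blast
    qed
  qed
  show thesis
  proof (rule random_selection[OF W T dN X G ac hit V v law_v])
    fix \<kappa> assume "\<kappa> \<in> measurable (W \<Otimes>\<^sub>M V) (count_space UNIV)"
      "AE z in W \<Otimes>\<^sub>M V. fst z \<in> ?G (\<kappa> z)"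
      "distr (W \<Otimes>\<^sub>M V) (?N \<Otimes>\<^sub>M U01) (\<lambda>z. (\<tau> (fst z), x (fst z) (\<kappa> z))) = ?N \<Otimes>\<^sub>M U01"
    then show thesis by (intro that[of \<kappa>]) auto
  qed
qed
end

section \<open>Recursive construction of the enumeration from independent seeds\<close>

text \<open>Presents the newest seed as external randomness independent of everything before, in the
  product form that the selection expects.\<close>

lemma distr_PiM_split_last:
  fixes M :: "nat \<Rightarrow> 'a measure"
  assumes M: "\<And>i. prob_space (M i)"
  shows "distr (PiM {..Suc n} M) (PiM {..n} M \<Otimes>\<^sub>M M (Suc n)) (\<lambda>\<omega>. (restrict \<omega> {..n}, \<omega> (Suc n)))
    = PiM {..n} M \<Otimes>\<^sub>M M (Suc n)" (is "distr ?S ?L ?g = ?L")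
proof -
  let ?P = "PiM {..n} M"
  interpret Mn: prob_space "M (Suc n)" by (rule M)
  interpret PM: prob_space ?P by (rule prob_space_PiM) (rule M)
  interpret pair_prob_space "M (Suc n)" ?P by unfold_locales
  have ins: "{..Suc n} = insert (Suc n) {..n}" by auto
  have S: "?S = distr (M (Suc n) \<Otimes>\<^sub>M ?P) ?S (\<lambda>(x, X). X(Suc n := x))"
    unfolding ins using M by (intro distr_pair_PiM_eq_PiM[symmetric])
  have g: "?g \<in> measurable ?S ?L"
    by (intro measurable_Pair measurable_restrict_subset measurable_component_singleton) auto
  have upd: "(\<lambda>(x, X). X(Suc n := x)) \<in> measurable (M (Suc n) \<Otimes>\<^sub>M ?P) ?S"
    unfolding ins by measurable
  have "distr ?S ?L ?g = distr (distr (M (Suc n) \<Otimes>\<^sub>M ?P) ?S (\<lambda>(x, X). X(Suc n := x))) ?L ?g"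
    using S by simp
  also have "\<dots> = distr (M (Suc n) \<Otimes>\<^sub>M ?P) ?L (?g \<circ> (\<lambda>(x, X). X(Suc n := x)))"
    by (rule distr_distr[OF g upd])
  also have "\<dots> = distr (M (Suc n) \<Otimes>\<^sub>M ?P) ?L (\<lambda>(x, X). (X, x))"
  proof (rule distr_cong)
    fix z assume "z \<in> space (M (Suc n) \<Otimes>\<^sub>M ?P)"
    then obtain x X where z: "z = (x, X)" and "X \<in> extensional {..n}"
      by (auto simp: space_pair_measure space_PiM PiE_def)
    then have "restrict (X(Suc n := x)) {..n} = X" by (auto simp: fun_eq_iff extensional_def restrict_def)
    then show "(?g \<circ> (\<lambda>(x, X). X(Suc n := x))) z = (\<lambda>(x, X). (X, x)) z" by (simp add: z)
  qed simp_all
  also have "\<dots> = ?L"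
  proof -
    interpret swap: pair_sigma_finite ?P "M (Suc n)" by unfold_locales
    show ?thesis using swap.distr_pair_swap by simp
  qed
  finally show ?thesis .
qed

context rcs begin

text \<open>The coordinate 0 carries the random set; the coordinates \<open>Suc i\<close> carry independent uniform
  variables, coded as constant sequences so that all coordinates have the same type.\<close>
definition seeds :: "nat \<Rightarrow> (nat \<Rightarrow> real) measure" where
  "seeds n = (if n = 0 then \<mu> else distr U01 (PiM UNIV (\<lambda>_. borel)) (\<lambda>u _. u))"

lemma prob_space_seeds: "prob_space (seeds n)"
proof -
  have "(\<lambda>u _. u) \<in> measurable U01 (PiM UNIV (\<lambda>_::nat. borel))" by (rule measurable_PiM_single') (simp_all add: measurable_ident_sets)
  then show ?thesis by (simp add: seeds_def prob_mu U01.prob_space_distr)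
qed

lemma seeds_Suc:
  "(\<lambda>y. y 0) \<in> borel_measurable (seeds (Suc n))" "distr (seeds (Suc n)) borel (\<lambda>y. y 0) = U01"
proof -
  have m: "(\<lambda>u _. u) \<in> measurable U01 (PiM UNIV (\<lambda>_::nat. borel))" by (rule measurable_PiM_single') (simp_all add: measurable_ident_sets)
  have c: "(\<lambda>y. y 0) \<in> measurable (PiM UNIV (\<lambda>_::nat. borel)) (borel :: real measure)" by simp
  then show "(\<lambda>y. y 0) \<in> borel_measurable (seeds (Suc n))" by (simp add: seeds_def)
  have "distr (seeds (Suc n)) borel (\<lambda>y. y 0) = distr U01 borel (\<lambda>u. u)"
    using distr_distr[OF c m] by (simp add: seeds_def comp_def)
  also have "\<dots> = U01" by (rule distr_id2) simp
  finally show "distr (seeds (Suc n)) borel (\<lambda>y. y 0) = U01" .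
qed

abbreviation "Om n \<equiv> PiM {..n} seeds"
abbreviation "bor n \<equiv> PiM {..<n} (\<lambda>_. borel :: real measure)"

lemma prob_space_Om: "prob_space (Om n)"
  by (rule prob_space_PiM) (rule prob_space_seeds)

lemma measurable_coord0:
  assumes "0 \<in> I" shows "(\<lambda>\<omega>. \<omega> 0) \<in> measurable (PiM I seeds) seqsp"
  using measurable_component_singleton[OF assms, of seeds]
  by (simp add: seeds_def measurable_cong_sets[OF refl sets_mu])

lemma distr_coord0:
  assumes "0 \<in> I" shows "distr (PiM I seeds) seqsp (\<lambda>\<omega>. \<omega> 0) = \<mu>"
proof -
  have "distr (PiM I seeds) seqsp (\<lambda>\<omega>. \<omega> 0) = distr (PiM I seeds) (seeds 0) (\<lambda>\<omega>. \<omega> 0)"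
    by (rule distr_cong) (simp_all add: seeds_def sets_mu)
  also have "\<dots> = \<mu>" using assms prob_space_seeds by (subst distr_PiM_component) (auto simp: seeds_def)
  finally show ?thesis .
qed

text \<open>At stage n the points found so far are a function of the coordinates up to n only, while
  the next index may also look at coordinate \<open>Suc n\<close>. This leaves the new seed
  independent of the past. The parity of n separates the uniform steps from those that exhaust the
  set.\<close>

definition fresh_step :: "nat \<Rightarrow> ((nat \<Rightarrow> nat \<Rightarrow> real) \<Rightarrow> nat \<Rightarrow> real) \<Rightarrow> ((nat \<Rightarrow> nat \<Rightarrow> real) \<Rightarrow> nat) \<Rightarrow> bool" where
  "fresh_step n \<tau> k \<longleftrightarrow> k \<in> measurable (Om (Suc n)) (count_space UNIV) \<and>
     (AE \<omega> in Om (Suc n). \<omega> 0 (k \<omega>) \<notin> \<tau> (restrict \<omega> {..n}) ` {..<n}) \<and>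
     (odd n \<longrightarrow> (\<forall>\<omega>. k \<omega> = (LEAST j. \<omega> 0 j \<notin> \<tau> (restrict \<omega> {..n}) ` {..<n}))) \<and>
     (even n \<longrightarrow> distr (Om (Suc n)) (distr (Om n) (bor n) \<tau> \<Otimes>\<^sub>M U01) (\<lambda>\<omega>. (\<tau> (restrict \<omega> {..n}), \<omega> 0 (k \<omega>)))
        = distr (Om n) (bor n) \<tau> \<Otimes>\<^sub>M U01)"

lemma ex_fresh_step:
  assumes \<tau>: "\<tau> \<in> measurable (Om n) (bor n)" "\<And>\<omega>. \<omega> \<in> space (Om n) \<Longrightarrow> \<tau> \<omega> \<in> PiE {..<n} (\<lambda>_. range (\<omega> 0))"
  shows "\<exists>k. fresh_step n \<tau> k"
proof (cases "even n")
  case True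
  let ?V = "seeds (Suc n)" and ?g = "\<lambda>\<omega>. (restrict \<omega> {..n}, \<omega> (Suc n))"
  have g: "?g \<in> measurable (Om (Suc n)) (Om n \<Otimes>\<^sub>M ?V)"
    by (intro measurable_Pair measurable_restrict_subset measurable_component_singleton) auto
  have law_g: "distr (Om (Suc n)) (Om n \<Otimes>\<^sub>M ?V) ?g = Om n \<Otimes>\<^sub>M ?V"
    by (rule distr_PiM_split_last) (rule prob_space_seeds)
  let ?x = "\<lambda>\<omega>::nat \<Rightarrow> nat \<Rightarrow> real. \<omega> 0"
  have x: "?x \<in> measurable (Om n) seqsp" by (rule measurable_coord0) simp
  have law_x: "distr (Om n) seqsp ?x = \<mu>" by (rule distr_coord0) simp
  let ?L = "distr (Om n) (bor n) \<tau> \<Otimes>\<^sub>M U01"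
  show ?thesis
  proof (rule next_point[OF prob_space_Om x law_x \<tau> prob_space_seeds seeds_Suc])
    fix \<kappa> assume \<kappa>: "\<kappa> \<in> measurable (Om n \<Otimes>\<^sub>M ?V) (count_space UNIV)"
      and fr: "AE z in Om n \<Otimes>\<^sub>M ?V. fst z 0 (\<kappa> z) \<notin> \<tau> (fst z) ` {..<n}"
      and law: "distr (Om n \<Otimes>\<^sub>M ?V) ?L (\<lambda>z. (\<tau> (fst z), fst z 0 (\<kappa> z))) = ?L"
    define k where "k \<omega> = \<kappa> (?g \<omega>)" for \<omega>
    have "fresh_step n \<tau> k"
      unfolding fresh_step_def
    proof (intro conjI impI)
      show "k \<in> measurable (Om (Suc n)) (count_space UNIV)"
        unfolding k_def by (rule measurable_compose[OF g \<kappa>])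
      have "AE z in distr (Om (Suc n)) (Om n \<Otimes>\<^sub>M ?V) ?g. fst z 0 (\<kappa> z) \<notin> \<tau> (fst z) ` {..<n}"
        unfolding law_g by (rule fr)
      from AE_distrD[OF g this]
      show "AE \<omega> in Om (Suc n). \<omega> 0 (k \<omega>) \<notin> \<tau> (restrict \<omega> {..n}) ` {..<n}"
        by (simp add: k_def)
      have F: "(\<lambda>z. (\<tau> (fst z), fst z 0 (\<kappa> z))) \<in> measurable (Om n \<Otimes>\<^sub>M ?V) ?L"
      proof (rule measurable_Pair)
        show "(\<lambda>z. \<tau> (fst z)) \<in> measurable (Om n \<Otimes>\<^sub>M ?V) (distr (Om n) (bor n) \<tau>)"
          using measurable_compose[OF measurable_fst \<tau>(1)] by simp
        have "(\<lambda>z. fst z 0 (\<kappa> z)) \<in> borel_measurable (Om n \<Otimes>\<^sub>M ?V)"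
          by (rule measurable_seqsp_nth'[OF measurable_compose[OF measurable_fst x] \<kappa>])
        then show "(\<lambda>z. fst z 0 (\<kappa> z)) \<in> measurable (Om n \<Otimes>\<^sub>M ?V) U01"
          by (simp add: measurable_cong_sets[OF refl sets_U01])
      qed
      have "distr (distr (Om (Suc n)) (Om n \<Otimes>\<^sub>M ?V) ?g) ?L (\<lambda>z. (\<tau> (fst z), fst z 0 (\<kappa> z))) = ?L"
        unfolding law_g by (rule law)
      then show "distr (Om (Suc n)) ?L (\<lambda>\<omega>. (\<tau> (restrict \<omega> {..n}), \<omega> 0 (k \<omega>))) = ?L"
        unfolding distr_distr[OF F g] by (simp add: comp_def k_def)
    qed (use True in simp)
    then show ?thesis by blast
  qed
next
  case False
  define k where "k \<omega> = (LEAST j. \<omega> 0 j \<notin> \<tau> (restrict \<omega> {..n}) ` {..<n})" for \<omega>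
  have r: "(\<lambda>\<omega>. restrict \<omega> {..n}) \<in> measurable (Om (Suc n)) (Om n)"
    by (rule measurable_restrict_subset) auto
  have \<tau>r: "(\<lambda>\<omega>. \<tau> (restrict \<omega> {..n})) \<in> measurable (Om (Suc n)) (bor n)"
    by (rule measurable_compose[OF r \<tau>(1)])
  have x: "(\<lambda>\<omega>. \<omega> 0) \<in> measurable (Om (Suc n)) seqsp" by (rule measurable_coord0) simp
  have "fresh_step n \<tau> k"
    unfolding fresh_step_def
  proof (intro conjI impI allI)
    show "k \<in> measurable (Om (Suc n)) (count_space UNIV)"
      unfolding k_def using fresh_measurable[OF x \<tau>r] by (intro measurable_Least) (simp add: pred_def)
    \<comment> \<open>The set is almost surely infinite, so a fresh position exists and
      \<open>LEAST\<close> picks one.\<close>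
    have "AE x in \<mu>. infinite (range x)"
      using dense_mu
    proof eventually_elim
      case (elim x)
      from dense_infinite_interval[OF this, of 0 1] show ?case by auto
    qed
    moreover have "distr (Om (Suc n)) seqsp (\<lambda>\<omega>. \<omega> 0) = \<mu>" by (rule distr_coord0) simp
    ultimately have "AE x in distr (Om (Suc n)) seqsp (\<lambda>\<omega>. \<omega> 0). infinite (range x)"
      by (simp only:)
    then have "AE \<omega> in Om (Suc n). infinite (range (\<omega> 0))"
      by (rule AE_distrD[OF x])
    then show "AE \<omega> in Om (Suc n). \<omega> 0 (k \<omega>) \<notin> \<tau> (restrict \<omega> {..n}) ` {..<n}"
    proof eventually_elim
      case (elim \<omega>)
      then have "\<exists>j. \<omega> 0 j \<notin> \<tau> (restrict \<omega> {..n}) ` {..<n}"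
        by (metis finite_imageI finite_lessThan finite_subset image_subsetI)
      then show ?case unfolding k_def by (rule LeastI_ex)
    qed
    show "k \<omega> = (LEAST j. \<omega> 0 j \<notin> \<tau> (restrict \<omega> {..n}) ` {..<n})" for \<omega> by (rule k_def)
  qed (use False in simp)
  then show ?thesis by blast
qed

text \<open>The index chosen at stage n determines the tuple map of stage n + 1, whence dependent
  choice. The index maps themselves are hidden in Q and recovered afterwards by ordinary
  choice.\<close>

lemma ex_fresh_sequence:
  "\<exists>\<tau> \<kappa>. \<forall>n. \<tau> n \<in> measurable (Om n) (bor n) \<and>
     (\<forall>\<omega>\<in>space (Om n). \<tau> n \<omega> \<in> PiE {..<n} (\<lambda>_. range (\<omega> 0))) \<and> fresh_step n (\<tau> n) (\<kappa> n) \<and>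
     \<tau> (Suc n) = (\<lambda>\<omega>. (\<tau> n (restrict \<omega> {..n}))(n := \<omega> 0 (\<kappa> n \<omega>)))"
proof -
  define P where "P n \<tau> \<longleftrightarrow> \<tau> \<in> measurable (Om n) (bor n) \<and>
     (\<forall>\<omega>\<in>space (Om n). \<tau> \<omega> \<in> PiE {..<n} (\<lambda>_. range (\<omega> 0)))" for n \<tau>
  define Q where "Q n \<tau> \<tau>' \<longleftrightarrow> (\<exists>k. fresh_step n \<tau> k \<and>
     \<tau>' = (\<lambda>\<omega>. (\<tau> (restrict \<omega> {..n}))(n := \<omega> 0 (k \<omega>))))" for n \<tau> \<tau>'
  have "\<exists>\<tau>. \<forall>n. P n (\<tau> n) \<and> Q n (\<tau> n) (\<tau> (Suc n))"
  proof (rule dependent_nat_choice)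
    \<comment> \<open>The empty tuple: the product over an empty index set has the constant
      \<open>undefined\<close> as its only element.\<close>
    have "P 0 (\<lambda>_ _. undefined)" by (auto simp: P_def space_PiM intro!: measurable_const)
    then show "\<exists>\<tau>. P 0 \<tau>" by blast
  next
    fix \<tau> n assume P: "P n \<tau>"
    then have \<tau>: "\<tau> \<in> measurable (Om n) (bor n)" "\<And>\<omega>. \<omega> \<in> space (Om n) \<Longrightarrow> \<tau> \<omega> \<in> PiE {..<n} (\<lambda>_. range (\<omega> 0))"
      by (auto simp: P_def)
    then obtain k where k: "fresh_step n \<tau> k" using ex_fresh_step by blast
    define \<tau>' where "\<tau>' = (\<lambda>\<omega>. (\<tau> (restrict \<omega> {..n}))(n := \<omega> 0 (k \<omega>)))"
    have r: "(\<lambda>\<omega>. restrict \<omega> {..n}) \<in> measurable (Om (Suc n)) (Om n)"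
      by (rule measurable_restrict_subset) auto
    have ins: "{..<Suc n} = insert n {..<n}" by auto
    have "\<tau>' \<in> measurable (Om (Suc n)) (bor (Suc n))"
    proof -
      have "(\<lambda>\<omega>. \<omega> 0 (k \<omega>)) \<in> borel_measurable (Om (Suc n))"
        using k by (intro measurable_seqsp_nth'[OF measurable_coord0]) (auto simp: fresh_step_def)
      from measurable_compose[OF measurable_Pair[OF measurable_compose[OF r \<tau>(1)] this]
        measurable_add_dim[of n "{..<n}" "\<lambda>_. borel"]]
      show ?thesis unfolding \<tau>'_def ins by simp
    qed
    moreover have "\<tau>' \<omega> \<in> PiE {..<Suc n} (\<lambda>_. range (\<omega> 0))" if "\<omega> \<in> space (Om (Suc n))" for \<omega>
    proof -
      have "\<tau> (restrict \<omega> {..n}) \<in> PiE {..<n} (\<lambda>_. range (\<omega> 0))"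
        using \<tau>(2)[OF measurable_space[OF r that]] by simp
      then show ?thesis unfolding \<tau>'_def ins by (intro PiE_fun_upd) auto
    qed
    ultimately have "P (Suc n) \<tau>' \<and> Q n \<tau> \<tau>'" using k by (auto simp: P_def Q_def \<tau>'_def)
    then show "\<exists>\<tau>'. P (Suc n) \<tau>' \<and> Q n \<tau> \<tau>'" by blast
  qed
  then obtain \<tau> where "\<And>n. P n (\<tau> n)" and "\<And>n. Q n (\<tau> n) (\<tau> (Suc n))" by blast
  moreover from this(2) have "\<exists>\<kappa>. \<forall>n. fresh_step n (\<tau> n) (\<kappa> n) \<and>
     \<tau> (Suc n) = (\<lambda>\<omega>. (\<tau> n (restrict \<omega> {..n}))(n := \<omega> 0 (\<kappa> n \<omega>)))"
    unfolding Q_def by (intro choice) blast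
  ultimately show ?thesis unfolding P_def by blast
qed

text \<open>Every stage lives on a finite product of seeds. The restriction from the infinite
  product has exactly that law, so all stages can be realised on one space together with the random
  set.\<close>

lemma enumeration:
  obtains \<Omega> :: "(nat \<Rightarrow> nat \<Rightarrow> real) measure" and x and K :: "nat \<Rightarrow> (nat \<Rightarrow> nat \<Rightarrow> real) \<Rightarrow> nat"
    where "prob_space \<Omega>" "x \<in> measurable \<Omega> seqsp" "distr \<Omega> seqsp x = \<mu>"
    "\<And>n. K n \<in> measurable \<Omega> (count_space UNIV)"
    "\<And>n. AE \<omega> in \<Omega>. x \<omega> (K n \<omega>) \<notin> (\<lambda>l. x \<omega> (K l \<omega>)) ` {..<n}"
    "\<And>n \<omega>. odd n \<Longrightarrow> \<omega> \<in> space \<Omega> \<Longrightarrow> K n \<omega> = (LEAST j. x \<omega> j \<notin> (\<lambda>l. x \<omega> (K l \<omega>)) ` {..<n})"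
    "\<And>n. even n \<Longrightarrow> distr \<Omega> (distr \<Omega> (bor n) (\<lambda>\<omega>. \<lambda>l\<in>{..<n}. x \<omega> (K l \<omega>)) \<Otimes>\<^sub>M U01)
         (\<lambda>\<omega>. (\<lambda>l\<in>{..<n}. x \<omega> (K l \<omega>), x \<omega> (K n \<omega>)))
       = distr \<Omega> (bor n) (\<lambda>\<omega>. \<lambda>l\<in>{..<n}. x \<omega> (K l \<omega>)) \<Otimes>\<^sub>M U01"
proof -
  from ex_fresh_sequence obtain \<tau> \<kappa> where all: "\<forall>n. \<tau> n \<in> measurable (Om n) (bor n) \<and>
     (\<forall>\<omega>\<in>space (Om n). \<tau> n \<omega> \<in> PiE {..<n} (\<lambda>_. range (\<omega> 0))) \<and> fresh_step n (\<tau> n) (\<kappa> n) \<and>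
     \<tau> (Suc n) = (\<lambda>\<omega>. (\<tau> n (restrict \<omega> {..n}))(n := \<omega> 0 (\<kappa> n \<omega>)))" by (elim exE)
  have \<tau>: "\<tau> n \<in> measurable (Om n) (bor n)"
    and \<tau>_ran: "\<omega> \<in> space (Om n) \<Longrightarrow> \<tau> n \<omega> \<in> PiE {..<n} (\<lambda>_. range (\<omega> 0))"
    and step: "fresh_step n (\<tau> n) (\<kappa> n)"
    and \<tau>_Suc: "\<tau> (Suc n) = (\<lambda>\<omega>. (\<tau> n (restrict \<omega> {..n}))(n := \<omega> 0 (\<kappa> n \<omega>)))" for n \<omega>
    using spec[OF all, of n] by blast+
  interpret S: product_prob_space seeds UNIV
    using prob_space_seeds by (simp add: product_prob_space_def product_sigma_finite_def
      product_prob_space_axioms_def prob_space_imp_sigma_finite)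
  define \<Omega> where "\<Omega> = PiM UNIV seeds"
  let ?r = "\<lambda>n \<omega>. restrict \<omega> {..n :: nat}"
  have r: "?r n \<in> measurable \<Omega> (Om n)" for n unfolding \<Omega>_def by (rule measurable_restrict_subset) auto
  have law_r: "distr \<Omega> (Om n) (?r n) = Om n" for n
    unfolding \<Omega>_def by (rule S.distr_PiM_restrict_finite) auto
  have rr: "?r n (?r (Suc n) \<omega>) = ?r n \<omega>" for n and \<omega> :: "nat \<Rightarrow> nat \<Rightarrow> real"
    by (auto simp: fun_eq_iff restrict_def)
  define K where "K n \<omega> = \<kappa> n (?r (Suc n) \<omega>)" for n \<omega>
  \<comment> \<open>Consistency of the stages: their tuples are initial segments of a single
    sequence.\<close>
  have T: "(\<lambda>l\<in>{..<n}. \<omega> 0 (K l \<omega>)) = \<tau> n (?r n \<omega>)" if "\<omega> \<in> space \<Omega>" for n \<omega>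
  proof (induction n)
    case 0
    show ?case using \<tau>_ran[OF measurable_space[OF r that], of 0] by (auto simp: restrict_def)
  next
    case (Suc n)
    have "(\<lambda>l\<in>{..<Suc n}. \<omega> 0 (K l \<omega>)) = (\<lambda>l\<in>{..<n}. \<omega> 0 (K l \<omega>))(n := \<omega> 0 (K n \<omega>))"
      by (auto simp: fun_eq_iff restrict_def)
    then show ?case unfolding Suc \<tau>_Suc by (simp add: rr K_def)
  qed
  have img: "(\<lambda>l. \<omega> 0 (K l \<omega>)) ` {..<n} = \<tau> n (?r n \<omega>) ` {..<n}" if "\<omega> \<in> space \<Omega>" for n \<omega>
    unfolding T[OF that, symmetric] by auto
  have distr_T: "distr \<Omega> (bor n) (\<lambda>\<omega>. \<lambda>l\<in>{..<n}. \<omega> 0 (K l \<omega>)) = distr (Om n) (bor n) (\<tau> n)" for n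
  proof -
    have "distr \<Omega> (bor n) (\<lambda>\<omega>. \<lambda>l\<in>{..<n}. \<omega> 0 (K l \<omega>)) = distr \<Omega> (bor n) (\<tau> n \<circ> ?r n)"
      by (rule distr_cong) (simp_all add: T)
    also have "\<dots> = distr (distr \<Omega> (Om n) (?r n)) (bor n) (\<tau> n)" by (rule distr_distr[OF \<tau> r, symmetric])
    finally show ?thesis unfolding law_r .
  qed
  have x: "(\<lambda>\<omega>. \<omega> 0) \<in> measurable \<Omega> seqsp" unfolding \<Omega>_def by (rule measurable_coord0) simp
  show thesis
  proof
    show "prob_space \<Omega>" unfolding \<Omega>_def by (rule prob_space_PiM) (rule prob_space_seeds)
    show "(\<lambda>\<omega>. \<omega> 0) \<in> measurable \<Omega> seqsp" by (rule x)
    show "distr \<Omega> seqsp (\<lambda>\<omega>. \<omega> 0) = \<mu>" unfolding \<Omega>_def by (rule distr_coord0) simp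
    have \<kappa>: "\<kappa> n \<in> measurable (Om (Suc n)) (count_space UNIV)" for n using step[of n] by (simp add: fresh_step_def)
    then show "K n \<in> measurable \<Omega> (count_space UNIV)" for n
      unfolding K_def by (rule measurable_compose[OF r])
    show "AE \<omega> in \<Omega>. \<omega> 0 (K n \<omega>) \<notin> (\<lambda>l. \<omega> 0 (K l \<omega>)) ` {..<n}" for n
    proof -
      have "AE \<omega> in distr \<Omega> (Om (Suc n)) (?r (Suc n)). \<omega> 0 (\<kappa> n \<omega>) \<notin> \<tau> n (?r n \<omega>) ` {..<n}"
        unfolding law_r using step[of n] by (simp add: fresh_step_def)
      from AE_distrD[OF r this] AE_space[of \<Omega>] show ?thesis
      proof eventually_elim
        case (elim \<omega>)
        then show ?case unfolding img[OF elim(2)] rr by (simp add: K_def)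
      qed
    qed
    show "K n \<omega> = (LEAST j. \<omega> 0 j \<notin> (\<lambda>l. \<omega> 0 (K l \<omega>)) ` {..<n})" if "odd n" "\<omega> \<in> space \<Omega>" for n \<omega>
    proof -
      have "\<kappa> n (?r (Suc n) \<omega>) = (LEAST j. ?r (Suc n) \<omega> 0 j \<notin> \<tau> n (?r n (?r (Suc n) \<omega>)) ` {..<n})"
        using step[of n] that(1) unfolding fresh_step_def by blast
      then show ?thesis unfolding img[OF that(2)] rr by (simp add: K_def)
    qed
    show "distr \<Omega> (distr \<Omega> (bor n) (\<lambda>\<omega>. \<lambda>l\<in>{..<n}. \<omega> 0 (K l \<omega>)) \<Otimes>\<^sub>M U01)
         (\<lambda>\<omega>. (\<lambda>l\<in>{..<n}. \<omega> 0 (K l \<omega>), \<omega> 0 (K n \<omega>)))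
       = distr \<Omega> (bor n) (\<lambda>\<omega>. \<lambda>l\<in>{..<n}. \<omega> 0 (K l \<omega>)) \<Otimes>\<^sub>M U01" if "even n" for n
    proof -
      let ?L = "distr (Om n) (bor n) (\<tau> n) \<Otimes>\<^sub>M U01"
      let ?F = "\<lambda>\<omega>. (\<tau> n (?r n \<omega>), \<omega> 0 (\<kappa> n \<omega>))"
      have F: "?F \<in> measurable (Om (Suc n)) ?L"
      proof (rule measurable_Pair)
        have "?r n \<in> measurable (Om (Suc n)) (Om n)" by (rule measurable_restrict_subset) auto
        from measurable_compose[OF this \<tau>]
        show "(\<lambda>\<omega>. \<tau> n (?r n \<omega>)) \<in> measurable (Om (Suc n)) (distr (Om n) (bor n) (\<tau> n))" by simp
        have "(\<lambda>\<omega>. \<omega> 0 (\<kappa> n \<omega>)) \<in> borel_measurable (Om (Suc n))"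
          by (rule measurable_seqsp_nth'[OF measurable_coord0 \<kappa>]) simp
        then show "(\<lambda>\<omega>. \<omega> 0 (\<kappa> n \<omega>)) \<in> measurable (Om (Suc n)) U01"
          by (simp add: measurable_cong_sets[OF refl sets_U01])
      qed
      have "distr \<Omega> ?L (\<lambda>\<omega>. (\<lambda>l\<in>{..<n}. \<omega> 0 (K l \<omega>), \<omega> 0 (K n \<omega>))) = distr \<Omega> ?L (?F \<circ> ?r (Suc n))"
      proof (rule distr_cong)
        fix \<omega> assume "\<omega> \<in> space \<Omega>"
        from T[OF this] show "(\<lambda>l\<in>{..<n}. \<omega> 0 (K l \<omega>), \<omega> 0 (K n \<omega>)) = (?F \<circ> ?r (Suc n)) \<omega>"
          by (simp only: comp_def rr) (simp add: K_def)
      qed simp_all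
      also have "\<dots> = distr (distr \<Omega> (Om (Suc n)) (?r (Suc n))) ?L ?F" by (rule distr_distr[OF F r, symmetric])
      also have "\<dots> = ?L" unfolding law_r using step[of n] that by (simp add: fresh_step_def)
      finally show ?thesis unfolding distr_T .
    qed
  qed
qed
end

section \<open>Joint densities from conditional densities, and exhaustion of the set\<close>

lemma distr_add_dim_lborel:
  fixes n :: nat
  shows "distr (PiM {..<n} (\<lambda>_. lborel :: real measure) \<Otimes>\<^sub>M lborel) (PiM {..<Suc n} (\<lambda>_. lborel)) (\<lambda>z. (fst z)(n := snd z))
    = PiM {..<Suc n} (\<lambda>_. lborel)" (is "distr ?PL ?P' ?u = _")
proof (rule measure_eqI)
  interpret product_sigma_finite "\<lambda>_::nat. lborel :: real measure" by standard
  interpret P: sigma_finite_measure "PiM {..<n} (\<lambda>_. lborel :: real measure)" by (rule sigma_finite) simp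
  have ins: "{..<Suc n} = insert n {..<n}" by auto
  have u: "?u \<in> measurable ?PL ?P'"
    using measurable_add_dim[of n "{..<n}" "\<lambda>_. lborel :: real measure"] unfolding ins by (simp add: split_beta')
  fix A assume "A \<in> sets (distr ?PL ?P' ?u)"
  then have A [measurable]: "A \<in> sets ?P'" by simp
  have "emeasure (distr ?PL ?P' ?u) A = (\<integral>\<^sup>+p. indicator A p \<partial>distr ?PL ?P' ?u)" by simp
  also have "\<dots> = (\<integral>\<^sup>+z. indicator A (?u z) \<partial>?PL)" by (rule nn_integral_distr[OF u]) simp
  also have "\<dots> = (\<integral>\<^sup>+t. \<integral>\<^sup>+y. indicator A (t(n := y)) \<partial>lborel \<partial>PiM {..<n} (\<lambda>_. lborel))"
    using measurable_compose[OF u borel_measurable_indicator[OF A]]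
    by (subst lborel.nn_integral_fst[symmetric]) simp_all
  also have "\<dots> = (\<integral>\<^sup>+p. indicator A p \<partial>?P')"
    unfolding ins using A by (subst product_nn_integral_insert) (simp_all add: ins)
  also have "\<dots> = emeasure ?P' A" by simp
  finally show "emeasure (distr ?PL ?P' ?u) A = emeasure ?P' A" .
qed simp

lemma density_pair_fst:
  assumes [measurable]: "f \<in> borel_measurable M" and "sigma_finite_measure L" "sigma_finite_measure (density M f)"
  shows "density M f \<Otimes>\<^sub>M L = density (M \<Otimes>\<^sub>M L) (\<lambda>z. f (fst z))"
proof -
  have "density M f \<Otimes>\<^sub>M density L (\<lambda>_. 1) = density (M \<Otimes>\<^sub>M L) (\<lambda>(x, y). f x * 1)"
    using assms by (intro pair_measure_density) (simp_all add: density_1)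
  then show ?thesis by (simp add: density_1 split_beta')
qed

lemma suminf_top_odd:
  fixes g :: "nat \<Rightarrow> ennreal"
  assumes "\<And>m. odd m \<Longrightarrow> g m = 1" shows "(\<Sum>m. g m) = \<infinity>"
proof -
  have "of_nat N \<le> (\<Sum>m<2 * N. g m)" for N
  proof (induction N)
    case (Suc N)
    have "(\<Sum>m<2 * Suc N. g m) = (\<Sum>m<2 * N. g m) + g (2 * N) + g (Suc (2 * N))" by (simp add: add.assoc)
    moreover have "g (Suc (2 * N)) = 1" by (rule assms) simp
    ultimately have "(\<Sum>m<2 * Suc N. g m) \<ge> of_nat N + 1"
      using Suc by (metis add_mono add_increasing2 order_refl zero_le)
    then show ?case by (simp add: add.commute)
  qed simp
  moreover have "(\<Sum>m<2 * N. g m) \<le> (\<Sum>m. g m)" for N by (rule sum_le_suminf) auto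
  ultimately have "of_nat N \<le> (\<Sum>m. g m)" for N by (meson order_trans)
  then show ?thesis
    using ennreal_Ex_less_of_nat by (metis infinity_ennreal_def linorder_not_less top.not_eq_extremum)
qed

text \<open>The chain rule: \<open>h n\<close> stands for the conditional density of the next value
  given the first n. Restricting y makes the first argument of \<open>h n\<close> an element of the
  n-fold product space, whose members are extensional.\<close>

primrec seq_density :: "(nat \<Rightarrow> (nat \<Rightarrow> real) \<times> real \<Rightarrow> ennreal) \<Rightarrow> nat \<Rightarrow> (nat \<Rightarrow> real) \<Rightarrow> ennreal" where
  "seq_density h 0 y = 1"
| "seq_density h (Suc n) y = seq_density h n (restrict y {..<n}) * h n (restrict y {..<n}, y n)"

lemma seq_density_measurable:
  assumes "\<And>n. h n \<in> borel_measurable (PiM {..<n} (\<lambda>_. lborel) \<Otimes>\<^sub>M lborel)"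
  shows "seq_density h n \<in> borel_measurable (PiM {..<n} (\<lambda>_. lborel :: real measure))"
proof (induction n)
  case (Suc n)
  have r: "(\<lambda>y. restrict y {..<n}) \<in> measurable (PiM {..<Suc n} (\<lambda>_. lborel)) (PiM {..<n} (\<lambda>_. lborel :: real measure))"
    by (rule measurable_restrict_subset) auto
  moreover have "(\<lambda>y. y n) \<in> measurable (PiM {..<Suc n} (\<lambda>_. lborel)) (lborel :: real measure)"
    by (rule measurable_component_singleton) simp
  ultimately have "(\<lambda>y. h n (restrict y {..<n}, y n)) \<in> borel_measurable (PiM {..<Suc n} (\<lambda>_. lborel))"
    by (rule measurable_compose[OF measurable_Pair assms])
  with measurable_compose[OF r Suc]
  have "(\<lambda>y. seq_density h n (restrict y {..<n}) * h n (restrict y {..<n}, y n))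
      \<in> borel_measurable (PiM {..<Suc n} (\<lambda>_. lborel))" by (rule borel_measurable_times_ennreal)
  moreover have "seq_density h (Suc n) = (\<lambda>y. seq_density h n (restrict y {..<n}) * h n (restrict y {..<n}, y n))"
    by (rule ext) (rule seq_density.simps)
  ultimately show ?case by (simp only:)
qed simp

text \<open>By \<open>step\<close> a new coordinate multiplies the density by \<open>h n\<close>,
  and appending a coordinate carries the product of Lebesgue measures to the next such
  product.\<close>

lemma law_step_density:
  fixes \<Omega> :: "'a measure" and Y :: "nat \<Rightarrow> 'a \<Rightarrow> real" and n :: nat
  defines "P \<equiv> \<lambda>n. PiM {..<n} (\<lambda>_. lborel :: real measure)"
  defines "T \<equiv> \<lambda>n \<omega>. \<lambda>l\<in>{..<n}. Y l \<omega>"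
  assumes \<Omega>: "prob_space \<Omega>" and Y: "\<And>n. Y n \<in> borel_measurable \<Omega>"
    and h: "\<And>n. h n \<in> borel_measurable (P n \<Otimes>\<^sub>M (lborel :: real measure))"
    and step: "\<And>n. distr \<Omega> (P n \<Otimes>\<^sub>M (lborel :: real measure)) (\<lambda>\<omega>. (T n \<omega>, Y n \<omega>)) = density (distr \<Omega> (P n) (T n) \<Otimes>\<^sub>M (lborel :: real measure)) (h n)"
  shows "distr \<Omega> (P n) (T n) = density (P n) (seq_density h n)"
proof (induction n)
  case 0
  interpret prob_space \<Omega> by fact
  have "distr \<Omega> (P 0) (T 0) = P 0"
  proof (rule measure_eqI)
    fix A assume "A \<in> sets (distr \<Omega> (P 0) (T 0))"
    then have A: "A = {} \<or> A = {\<lambda>_. undefined}" by (auto simp: P_def sets_PiM_empty)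
    have T0: "T 0 \<in> measurable \<Omega> (P 0)" by (auto simp: T_def P_def space_PiM restrict_def intro!: measurable_const)
    show "emeasure (distr \<Omega> (P 0) (T 0)) A = emeasure (P 0) A"
      using A
    proof
      assume "A = {\<lambda>_. undefined}"
      then show ?thesis using T0
        by (subst emeasure_distr) (auto simp: P_def sets_PiM_empty T_def restrict_def emeasure_PiM_empty vimage_def emeasure_space_1)
    qed simp
  qed (simp add: P_def)
  then show ?case by (simp add: density_1)
next
  case (Suc n)
  interpret prob_space \<Omega> by fact
  have T: "T n \<in> measurable \<Omega> (P n)" for n
    unfolding T_def P_def using Y by (intro measurable_restrict) simp
  have f: "seq_density h n \<in> borel_measurable (P n)" for n
    unfolding P_def using h by (intro seq_density_measurable) (simp add: P_def)
  have TY: "(\<lambda>\<omega>. (T n \<omega>, Y n \<omega>)) \<in> measurable \<Omega> (P n \<Otimes>\<^sub>M (lborel :: real measure))"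
    using T Y by (intro measurable_Pair) simp_all
  let ?u = "\<lambda>z :: (nat \<Rightarrow> real) \<times> real. (fst z)(n := snd z)"
  have ins: "{..<Suc n} = insert n {..<n}" by auto
  have u: "?u \<in> measurable (P n \<Otimes>\<^sub>M (lborel :: real measure)) (P (Suc n))"
    using measurable_add_dim[of n "{..<n}" "\<lambda>_. lborel :: real measure"] unfolding ins P_def by (simp add: split_beta')
  have "distr \<Omega> (P (Suc n)) (T (Suc n)) = distr \<Omega> (P (Suc n)) (?u \<circ> (\<lambda>\<omega>. (T n \<omega>, Y n \<omega>)))"
    by (rule distr_cong) (auto simp: T_def fun_eq_iff restrict_def)
  also have "\<dots> = distr (distr \<Omega> (P n \<Otimes>\<^sub>M (lborel :: real measure)) (\<lambda>\<omega>. (T n \<omega>, Y n \<omega>))) (P (Suc n)) ?u"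
    by (rule distr_distr[OF u TY, symmetric])
  also have "\<dots> = distr (density (density (P n) (seq_density h n) \<Otimes>\<^sub>M (lborel :: real measure)) (h n)) (P (Suc n)) ?u"
    by (simp only: step Suc)
  also have "density (P n) (seq_density h n) \<Otimes>\<^sub>M (lborel :: real measure) = density (P n \<Otimes>\<^sub>M (lborel :: real measure)) (\<lambda>z. seq_density h n (fst z))"
  proof (rule density_pair_fst[OF f sigma_finite_lborel])
    show "sigma_finite_measure (density (P n) (seq_density h n))"
      unfolding Suc[symmetric] by (rule prob_space_imp_sigma_finite) (rule prob_space_distr[OF T])
  qed
  also have "density (density (P n \<Otimes>\<^sub>M (lborel :: real measure)) (\<lambda>z. seq_density h n (fst z))) (h n)
      = density (P n \<Otimes>\<^sub>M (lborel :: real measure)) (\<lambda>z. seq_density h n (fst z) * h n z)"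
    using h by (intro density_density_eq measurable_compose[OF measurable_fst f])
  also have "\<dots> = density (P n \<Otimes>\<^sub>M (lborel :: real measure)) (\<lambda>z. seq_density h (Suc n) (?u z))"
  proof (rule density_cong)
    show "(\<lambda>z. seq_density h n (fst z) * h n z) \<in> borel_measurable (P n \<Otimes>\<^sub>M (lborel :: real measure))"
      using h by (intro borel_measurable_times_ennreal measurable_compose[OF measurable_fst f])
    show "(\<lambda>z. seq_density h (Suc n) (?u z)) \<in> borel_measurable (P n \<Otimes>\<^sub>M (lborel :: real measure))"
      by (rule measurable_compose[OF u f])
    show "AE z in P n \<Otimes>\<^sub>M (lborel :: real measure). seq_density h n (fst z) * h n z = seq_density h (Suc n) (?u z)"
    proof (rule AE_I2)
      fix z assume "z \<in> space (P n \<Otimes>\<^sub>M (lborel :: real measure))"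
      then have "fst z \<in> extensional {..<n}" by (auto simp: space_pair_measure P_def space_PiM PiE_def)
      then have "restrict (?u z) {..<n} = fst z" by (auto simp: fun_eq_iff extensional_def restrict_def)
      then show "seq_density h n (fst z) * h n z = seq_density h (Suc n) (?u z)" by simp
    qed
  qed
  also have "distr (density (P n \<Otimes>\<^sub>M (lborel :: real measure)) (\<lambda>z. seq_density h (Suc n) (?u z))) (P (Suc n)) ?u
     = density (distr (P n \<Otimes>\<^sub>M (lborel :: real measure)) (P (Suc n)) ?u) (seq_density h (Suc n))"
    by (rule density_distr[OF f u, symmetric])
  also have "distr (P n \<Otimes>\<^sub>M (lborel :: real measure)) (P (Suc n)) ?u = P (Suc n)"
    unfolding P_def by (rule distr_add_dim_lborel)
  finally show ?case .
qed

text \<open>By induction, x j is listed within the first 2 * (j + 1) choices. Before the odd step 2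
  * j + 1 all x i with i < j are listed, so this step takes position j unless x j is already
  there.\<close>

lemma range_selection:
  fixes x :: "nat \<Rightarrow> 'a" and K :: "nat \<Rightarrow> nat"
  assumes fresh: "\<And>n. x (K n) \<notin> (\<lambda>l. x (K l)) ` {..<n}"
    and least: "\<And>n. odd n \<Longrightarrow> K n = (LEAST j. x j \<notin> (\<lambda>l. x (K l)) ` {..<n})"
  shows "range (\<lambda>n. x (K n)) = range x"
proof -
  have "x j \<in> (\<lambda>l. x (K l)) ` {..<2 * (j + 1)}" for j
  proof (induction j rule: less_induct)
    case (less j)
    let ?n = "2 * j + 1"
    show ?case
    proof (cases "x j \<in> (\<lambda>l. x (K l)) ` {..<?n}")
      case False
      have "K ?n = (LEAST j. x j \<notin> (\<lambda>l. x (K l)) ` {..<?n})" by (rule least) simp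
      also have "\<dots> = j"
      proof (rule Least_equality)
        fix i assume i: "x i \<notin> (\<lambda>l. x (K l)) ` {..<?n}"
        show "j \<le> i"
        proof (rule ccontr)
          assume "\<not> j \<le> i"
          then have "x i \<in> (\<lambda>l. x (K l)) ` {..<2 * (i + 1)}" "2 * (i + 1) \<le> ?n" using less by auto
          with i show False by (meson image_mono lessThan_subset_iff subset_iff)
        qed
      qed (rule False)
      finally have "x j = x (K ?n)" by simp
      then show ?thesis by auto
    qed auto
  qed
  then show ?thesis by blast
qed

section \<open>The enumerated sequence witnesses the uniform distribution\<close>

context rcs begin

lemma uniform: "uniform_rcs \<mu>"
proof (rule enumeration)
  fix \<Omega> :: "(nat \<Rightarrow> nat \<Rightarrow> real) measure" and x and K :: "nat \<Rightarrow> (nat \<Rightarrow> nat \<Rightarrow> real) \<Rightarrow> nat"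
  assume \<Omega>: "prob_space \<Omega>" and x: "x \<in> measurable \<Omega> seqsp" and law_x: "distr \<Omega> seqsp x = \<mu>"
    and K: "\<And>n. K n \<in> measurable \<Omega> (count_space UNIV)"
    and fresh: "\<And>n. AE \<omega> in \<Omega>. x \<omega> (K n \<omega>) \<notin> (\<lambda>l. x \<omega> (K l \<omega>)) ` {..<n}"
    and least: "\<And>n \<omega>. odd n \<Longrightarrow> \<omega> \<in> space \<Omega> \<Longrightarrow> K n \<omega> = (LEAST j. x \<omega> j \<notin> (\<lambda>l. x \<omega> (K l \<omega>)) ` {..<n})"
    and unif: "\<And>n. even n \<Longrightarrow> distr \<Omega> (distr \<Omega> (bor n) (\<lambda>\<omega>. \<lambda>l\<in>{..<n}. x \<omega> (K l \<omega>)) \<Otimes>\<^sub>M U01)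
         (\<lambda>\<omega>. (\<lambda>l\<in>{..<n}. x \<omega> (K l \<omega>), x \<omega> (K n \<omega>)))
       = distr \<Omega> (bor n) (\<lambda>\<omega>. \<lambda>l\<in>{..<n}. x \<omega> (K l \<omega>)) \<Otimes>\<^sub>M U01"
  interpret \<Omega>: prob_space \<Omega> by fact
  let ?P = "\<lambda>n. PiM {..<n} (\<lambda>_. lborel :: real measure)"
  define Y where "Y n \<omega> = x \<omega> (K n \<omega>)" for n \<omega>
  define T where "T n \<omega> = (\<lambda>l\<in>{..<n}. Y l \<omega>)" for n \<omega>
  have Y: "Y n \<in> borel_measurable \<Omega>" for n unfolding Y_def by (rule measurable_seqsp_nth'[OF x K])
  have sets_P: "sets (?P n) = sets (bor n)" for n by (rule sets_PiM_cong) simp_all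
  have T: "T n \<in> measurable \<Omega> (?P n)" for n unfolding T_def using Y by (intro measurable_restrict) simp
  have Y_seq: "(\<lambda>\<omega> n. Y n \<omega>) \<in> measurable \<Omega> seqsp"
  proof (rule measurable_into_seqsp)
    fix \<omega> n assume "\<omega> \<in> space \<Omega>"
    then show "Y n \<omega> \<in> {0<..<1}" using measurable_space[OF x] by (simp add: Y_def space_seqsp)
  qed (rule Y)
  define law where "law n = distr \<Omega> (?P n) (T n)" for n
  have law_bor: "distr \<Omega> (bor n) (T n) = law n" for n
    unfolding law_def by (rule distr_cong) (simp_all add: sets_P)
  have law_prob: "prob_space (law n)" for n unfolding law_def by (rule \<Omega>.prob_space_distr[OF T])
  define joint where "joint n = distr \<Omega> (?P n \<Otimes>\<^sub>M (lborel :: real measure)) (\<lambda>\<omega>. (T n \<omega>, Y n \<omega>))" for n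
  have TY: "(\<lambda>\<omega>. (T n \<omega>, Y n \<omega>)) \<in> measurable \<Omega> (?P n \<Otimes>\<^sub>M (lborel :: real measure))" for n
    using T Y by (intro measurable_Pair) simp_all
  have sets_joint: "sets (joint n) = sets (law n \<Otimes>\<^sub>M (lborel :: real measure))" for n
    unfolding joint_def sets_distr by (rule sets_pair_measure_cong) (simp_all add: law_def)
  have fresh_all: "AE \<omega> in \<Omega>. \<forall>n. Y n \<omega> \<notin> (\<lambda>l. Y l \<omega>) ` {..<n}"
    using fresh by (simp add: AE_all_countable Y_def)
  have even_law: "joint n = density (law n \<Otimes>\<^sub>M (lborel :: real measure)) (\<lambda>z. indicator {0<..<1} (snd z))" if "even n" for n
  proof -
    have "joint n = distr \<Omega> (law n \<Otimes>\<^sub>M U01) (\<lambda>\<omega>. (T n \<omega>, Y n \<omega>))"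
      unfolding joint_def by (rule distr_cong) (auto simp: law_def intro!: sets_pair_measure_cong)
    also have "\<dots> = law n \<Otimes>\<^sub>M U01"
      using unif[OF that] unfolding law_bor[symmetric] T_def Y_def .
    also have "\<dots> = density (law n) (\<lambda>_. 1) \<Otimes>\<^sub>M density lborel (indicator {0<..<1})"
      by (simp add: density_1 U01_def)
    also have "\<dots> = density (law n \<Otimes>\<^sub>M (lborel :: real measure)) (\<lambda>(x, y). 1 * indicator {0<..<1} y)"
      using prob_space_imp_sigma_finite[OF prob_space_U01]
      by (intro pair_measure_density) (auto simp: U01_def sigma_finite_lborel)
    finally show ?thesis by (simp add: split_beta')
  qed
  \<comment> \<open>No rule of selection enters: almost surely no fresh point of the set falls into
    a null section, so the next point does not either. At odd steps this is the only information on
    its law.\<close>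
  have abs: "absolutely_continuous (law n \<Otimes>\<^sub>M (lborel :: real measure)) (joint n)" for n
    unfolding absolutely_continuous_def
  proof
    interpret L: prob_space "law n" by (rule law_prob)
    interpret LL: pair_sigma_finite "law n" "lborel :: real measure" by unfold_locales
    fix B assume B: "B \<in> null_sets (law n \<Otimes>\<^sub>M (lborel :: real measure))"
    then have Bs: "B \<in> sets (law n \<Otimes>\<^sub>M (lborel :: real measure))" by auto
    also have "sets (law n \<Otimes>\<^sub>M (lborel :: real measure)) = sets (bor n \<Otimes>\<^sub>M borel)"
      by (rule sets_pair_measure_cong) (simp_all add: law_def sets_P)
    finally have Bb: "B \<in> sets (bor n \<Otimes>\<^sub>M borel)" .
    have sec: "{t. (s, t) \<in> B} \<in> sets borel" for s by (rule sections_measurable[OF Bb])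
    have "AE z in law n \<Otimes>\<^sub>M (lborel :: real measure). z \<notin> B" using B by (rule AE_not_in)
    then have "AE s in law n. AE t in lborel. (s, t) \<notin> B" by (rule LL.AE_pair)
    then have "AE \<omega> in \<Omega>. AE t in lborel. (T n \<omega>, t) \<notin> B" unfolding law_def by (rule AE_distrD[OF T])
    moreover have "AE \<omega> in \<Omega>. (\<exists>k. x \<omega> k \<notin> T n \<omega> ` {..<n} \<and> (T n \<omega>, x \<omega> k) \<in> B)
        \<longleftrightarrow> emeasure U01 {t. (T n \<omega>, t) \<in> B} \<noteq> 0"
      by (rule hit_fresh_distr[OF x law_x _ Bb]) (auto simp: T_def Y_def)
    ultimately have "AE \<omega> in \<Omega>. (T n \<omega>, Y n \<omega>) \<notin> B"
      using fresh_all
    proof eventually_elim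
      case (elim \<omega>)
      have "emeasure lborel {t. (T n \<omega>, t) \<in> B} = 0"
        using elim(1) sec[of "T n \<omega>"] by (subst (asm) AE_iff_measurable[OF _ refl]) auto
      then have "emeasure U01 {t. (T n \<omega>, t) \<in> B} = 0"
        using sec[of "T n \<omega>"] emeasure_mono[of "{t. (T n \<omega>, t) \<in> B} \<inter> {0<..<1}" "{t. (T n \<omega>, t) \<in> B}" lborel]
        by (simp add: emeasure_U01)
      moreover have "Y n \<omega> \<notin> T n \<omega> ` {..<n}" using elim(3) by (auto simp: T_def)
      ultimately show ?case using elim(2) by (auto simp: Y_def)
    qed
    moreover have BP: "B \<in> sets (?P n \<Otimes>\<^sub>M (lborel :: real measure))"
      using Bs sets_joint[of n] by (simp only: joint_def sets_distr)
    have "{z \<in> space (?P n \<Otimes>\<^sub>M (lborel :: real measure)). z \<notin> B} = space (?P n \<Otimes>\<^sub>M lborel) - B"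
      by blast
    with BP have "{z \<in> space (?P n \<Otimes>\<^sub>M (lborel :: real measure)). z \<notin> B} \<in> sets (?P n \<Otimes>\<^sub>M lborel)"
      by (simp only: sets.compl_sets)
    ultimately have "AE z in joint n. z \<notin> B"
      unfolding joint_def by (simp only: AE_distr_iff[OF TY])
    moreover have "B \<in> sets (joint n)" using Bs by (simp add: sets_joint)
    ultimately show "B \<in> null_sets (joint n)" by (simp add: AE_iff_null_sets)
  qed
  \<comment> \<open>A Radon-Nikodym derivative is fixed only up to null sets, whereas the ratios are
    to be evaluated at every t in (0,1). At even steps the indicator itself is therefore taken as
    the density.\<close>
  define h where "h n = (if even n then \<lambda>z. indicator {0<..<1} (snd z) else RN_deriv (law n \<Otimes>\<^sub>M (lborel :: real measure)) (joint n))" for n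
  have h_meas: "h n \<in> borel_measurable (?P n \<Otimes>\<^sub>M (lborel :: real measure))" for n
  proof -
    have eq: "measurable (?P n \<Otimes>\<^sub>M (lborel :: real measure)) borel = measurable (law n \<Otimes>\<^sub>M (lborel :: real measure)) (borel :: ennreal measure)"
      by (intro measurable_cong_sets sets_pair_measure_cong) (simp_all add: law_def)
    show ?thesis unfolding eq by (simp add: h_def)
  qed
  have step: "joint n = density (law n \<Otimes>\<^sub>M (lborel :: real measure)) (h n)" for n
  proof (cases "even n")
    case True
    then show ?thesis by (simp add: even_law h_def)
  next
    case False
    interpret L: prob_space "law n" by (rule law_prob)
    interpret LL: pair_sigma_finite "law n" "lborel :: real measure" by unfold_locales
    show ?thesis using LL.density_RN_deriv[OF abs sets_joint] False by (simp add: h_def)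
  qed
  define f where "f = seq_density h"
  have law_f: "law n = density (?P n) (f n)" for n
  proof -
    have T_eq: "T n = (\<lambda>\<omega>. \<lambda>l\<in>{..<n}. Y l \<omega>)" for n by (rule ext) (rule T_def)
    show ?thesis
      unfolding law_def f_def T_eq
      by (rule law_step_density[OF \<Omega> Y h_meas step[unfolded joint_def law_def T_eq]])
  qed
  have f_meas: "f n \<in> borel_measurable (?P n)" for n unfolding f_def by (rule seq_density_measurable[OF h_meas])
  define \<nu> where "\<nu> = distr \<Omega> seqsp (\<lambda>\<omega> n. Y n \<omega>)"
  have res: "(\<lambda>y. restrict y {..<n}) \<in> measurable seqsp (?P n)" for n
    by (rule measurable_restrict) simp
  have law_\<nu>: "distr \<nu> (?P n) (\<lambda>y. restrict y {..<n}) = law n" for n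
    unfolding \<nu>_def law_def T_def distr_distr[OF res Y_seq] by (simp add: comp_def)
  have ident: "ident_distr_rcs \<mu> \<nu>"
    unfolding ident_distr_rcs_def
  proof (intro exI conjI)
    let ?g = "\<lambda>\<omega>. (x \<omega>, \<lambda>n. Y n \<omega>)"
    let ?C = "distr \<Omega> (seqsp \<Otimes>\<^sub>M seqsp) ?g"
    have g: "?g \<in> measurable \<Omega> (seqsp \<Otimes>\<^sub>M seqsp)" using x Y_seq by (rule measurable_Pair)
    show "prob_space ?C" by (rule \<Omega>.prob_space_distr[OF g])
    show "sets ?C = sets (seqsp \<Otimes>\<^sub>M seqsp)" by simp
    show "distr ?C seqsp fst = \<mu>" using law_x by (simp add: distr_distr[OF measurable_fst g] comp_def)
    show "distr ?C seqsp snd = \<nu>" by (simp add: distr_distr[OF measurable_snd g] comp_def \<nu>_def)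
    have eq: "range (fst z) = range (snd z) \<longleftrightarrow> (\<forall>i. \<exists>j. fst z i = snd z j) \<and> (\<forall>j. \<exists>i. snd z j = fst z i)"
      for z :: "(nat \<Rightarrow> real) \<times> (nat \<Rightarrow> real)" by (auto simp: set_eq_iff image_iff)
    have [measurable]: "(\<lambda>z. fst z i) \<in> borel_measurable (seqsp \<Otimes>\<^sub>M seqsp)"
      "(\<lambda>z. snd z i) \<in> borel_measurable (seqsp \<Otimes>\<^sub>M seqsp)" for i
      by (rule measurable_compose[OF _ measurable_seqsp_nth], simp)+
    have "AE \<omega> in \<Omega>. range (x \<omega>) = range (\<lambda>n. Y n \<omega>)"
      using fresh_all AE_space[of \<Omega>]
    proof eventually_elim
      case (elim \<omega>)
      then have "range (\<lambda>n. x \<omega> (K n \<omega>)) = range (x \<omega>)"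
        using least by (intro range_selection) (auto simp: Y_def)
      then show ?case by (simp add: Y_def)
    qed
    then show "AE z in ?C. range (fst z) = range (snd z)"
    proof (subst AE_distr_iff[OF g])
      show "{z \<in> space (seqsp \<Otimes>\<^sub>M seqsp). range (fst z) = range (snd z)} \<in> sets (seqsp \<Otimes>\<^sub>M seqsp)"
        unfolding eq by measurable
    qed simp
  qed
  \<comment> \<open>In \<open>ennreal\<close> a quotient of equal terms is 1 only away from 0 and
    \<infinity>. A law with density f gives probability 0 to either value of f.\<close>
  have f_fin: "AE y in \<nu>. \<forall>n. 0 < f n (restrict y {..<n}) \<and> f n (restrict y {..<n}) < \<infinity>"
    unfolding AE_all_countable
  proof
    fix n
    interpret L: prob_space "law n" by (rule law_prob)
    have "(\<integral>\<^sup>+z. f n z \<partial>?P n) = emeasure (law n) (space (law n))"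
      unfolding law_f using f_meas by (subst emeasure_density) (auto intro!: nn_integral_cong)
    then have "(\<integral>\<^sup>+z. f n z \<partial>?P n) \<noteq> \<infinity>" by (simp add: L.emeasure_space_1)
    then have "AE z in ?P n. f n z \<noteq> \<infinity>" using f_meas by (intro nn_integral_PInf_AE)
    then have "AE z in law n. 0 < f n z \<and> f n z < \<infinity>"
      unfolding law_f using f_meas by (subst AE_density) (auto simp: less_top elim!: eventually_mono)
    then have ae: "AE z in distr \<nu> (?P n) (\<lambda>y. restrict y {..<n}). 0 < f n z \<and> f n z < \<infinity>"
      unfolding law_\<nu> .
    have "(\<lambda>y. restrict y {..<n}) \<in> measurable \<nu> (?P n)" using res by (simp add: \<nu>_def)
    from AE_distrD[OF this ae]
    show "AE y in \<nu>. 0 < f n (restrict y {..<n}) \<and> f n (restrict y {..<n}) < \<infinity>" .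
  qed
  have diverge: "AE y in \<nu>. (\<Sum>m. f (Suc (Suc m)) ((restrict y {..<Suc m})(Suc m := t)) / f (Suc m) (restrict y {..<Suc m})) = (\<infinity>::ennreal)"
    if t: "t \<in> {0<..<1}" for t :: real
    using f_fin
  proof eventually_elim
    case (elim y)
    show ?case
    proof (rule suminf_top_odd)
      \<comment> \<open>Term m compares f (m + 2) with f (m + 1), so it belongs to step m + 1 of an
        enumeration that starts at 0. The even, uniform steps are thus the terms with odd m.\<close>
      fix m :: nat assume "odd m"
      have "restrict ((restrict y {..<Suc m})(Suc m := t)) {..<Suc m} = restrict y {..<Suc m}"
        by (auto simp: fun_eq_iff restrict_def)
      then have eq: "f (Suc (Suc m)) ((restrict y {..<Suc m})(Suc m := t)) = f (Suc m) (restrict y {..<Suc m})"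
        using \<open>odd m\<close> t unfolding f_def seq_density.simps(2)[of h "Suc m"] by (simp del: seq_density.simps add: h_def)
      show "f (Suc (Suc m)) ((restrict y {..<Suc m})(Suc m := t)) / f (Suc m) (restrict y {..<Suc m}) = 1"
        unfolding eq using elim[rule_format, of "Suc m"] by (intro ennreal_divide_self) auto
    qed
  qed
  show "uniform_rcs \<mu>"
    unfolding uniform_rcs_def
  proof (intro exI conjI allI)
    show "prob_space \<nu>" unfolding \<nu>_def by (rule \<Omega>.prob_space_distr[OF Y_seq])
    show "sets \<nu> = sets seqsp" by (simp add: \<nu>_def)
    show "ident_distr_rcs \<mu> \<nu>" by (rule ident)
    show "f n \<in> borel_measurable (?P n)" for n by (rule f_meas)
    show "distr \<nu> (?P n) (\<lambda>y. restrict y {..<n}) = density (?P n) (f n)" for n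
      unfolding law_\<nu> by (rule law_f)
    show "AE t in lborel. t \<in> {0<..<1} \<longrightarrow> (AE y in \<nu>. (\<Sum>m. f (Suc (Suc m)) ((restrict y {..<Suc m})(Suc m := t))
        / f (Suc m) (restrict y {..<Suc m})) = (\<infinity>::ennreal))"
      by (rule AE_I2) (rule impI, rule diverge)
  qed
qed
end

section \<open>Density as a measurable event, and the conclusion\<close>

text \<open>Rational end points reduce density to countably many conditions on coordinates. The
  resulting measurability carries the assumption from the random variables to their joint
  law.\<close>

lemma dense_iff_rational_intervals:
  fixes x :: "nat \<Rightarrow> real"
  shows "{0<..<1} \<subseteq> closure (range x) \<longleftrightarrow>
    (\<forall>p q. 0 < p \<longrightarrow> p < q \<longrightarrow> q < 1 \<longrightarrow> (\<exists>k. x k \<in> {real_of_rat p<..<real_of_rat q}))"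
proof
  assume *: "{0<..<1} \<subseteq> closure (range x)"
  show "\<forall>p q. 0 < p \<longrightarrow> p < q \<longrightarrow> q < 1 \<longrightarrow> (\<exists>k. x k \<in> {real_of_rat p<..<real_of_rat q})"
    by (intro allI impI dense_meets_interval[OF *]) (simp_all add: of_rat_less)
next
  assume *: "\<forall>p q. 0 < p \<longrightarrow> p < q \<longrightarrow> q < 1 \<longrightarrow> (\<exists>k. x k \<in> {real_of_rat p<..<real_of_rat q})"
  show "{0<..<1} \<subseteq> closure (range x)"
  proof
    fix t :: real assume t: "t \<in> {0<..<1}"
    show "t \<in> closure (range x)"
      unfolding closure_approachable
    proof (intro allI impI)
      fix e :: real assume e: "e > 0"
      obtain p where p: "max 0 (t - e) < real_of_rat p" "real_of_rat p < t"
        using of_rat_dense[of "max 0 (t - e)" t] t e by auto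
      obtain q where q: "t < real_of_rat q" "real_of_rat q < min 1 (t + e)"
        using of_rat_dense[of t "min 1 (t + e)"] t e by auto
      have "0 < p" "q < 1" using p q by (simp_all flip: of_rat_less)
      moreover have "p < q" using p q by (metis of_rat_less order_less_trans)
      ultimately obtain k where "x k \<in> {real_of_rat p<..<real_of_rat q}" using * by blast
      then have "dist (x k) t < e" using p q by (auto simp: dist_real_def abs_less_iff)
      then show "\<exists>y\<in>range x. dist y t < e" by blast
    qed
  qed
qed

lemma sets_dense: "{x \<in> space seqsp. {0<..<1} \<subseteq> closure (range x)} \<in> sets seqsp"
  unfolding dense_iff_rational_intervals by measurable

theorem theorem6p9:
  fixes M :: "'a measure" and X :: "nat \<Rightarrow> 'a \<Rightarrow> real"
  assumes "prob_space M"
    and "\<And>k. X k \<in> measurable M (restrict_space borel {0<..<1})"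
    and "AE \<omega> in M. {0<..<1} \<subseteq> closure (range (\<lambda>k. X k \<omega>))"
    and "indep_condition (seq_law M X)"
    and "stationary_rcs (seq_law M X)"
  shows "uniform_rcs (seq_law M X)"
proof -
  interpret prob_space M by fact
  have X: "(\<lambda>\<omega> k. X k \<omega>) \<in> measurable M seqsp"
    unfolding seqsp_def using assms(2) measurable_space[OF assms(2)]
    by (intro measurable_PiM_single') (auto simp: space_restrict_space PiE_iff)
  have "rcs (seq_law M X)"
  proof (rule rcs.intro)
    show "prob_space (seq_law M X)" unfolding seq_law_def by (rule prob_space_distr[OF X])
    show "sets (seq_law M X) = sets seqsp" by (simp add: seq_law_def)
    show "AE x in seq_law M X. {0<..<1} \<subseteq> closure (range x)"
      unfolding seq_law_def using assms(3) by (subst AE_distr_iff[OF X sets_dense])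
    show "indep_condition (seq_law M X)" "stationary_rcs (seq_law M X)" by fact+
  qed
  then show ?thesis by (rule rcs.uniform)
qed

end
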